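(* Let $\Omega\subset\mathbb{H}^n$ be open and bounded, let $1<p\le q<\infty$ and $0<s\le t<1$, and let $a$ satisfy condition (A1). Assume $$p\le q\le p_s^*=\frac{Qp}{Q-sp}\ \text{ if } sp<Q,\qquad p\le q<\infty\ \text{ if } sp\ge Q .$$ Then every weak solution $u\in\mathcal{A}(\Omega)\cap L^{q-1}_{sp}(\mathbb{H}^n)$ of the equation $$\mathrm{P.V.}\int_{\mathbb{H}^n}\Big[\frac{J_p(u(\xi)-u(\eta))}{\|\eta^{-1}\circ\xi\|_{\mathbb{H}^n}^{Q+sp}}+a(\xi,\eta)\frac{J_q(u(\xi)-u(\eta))}{\|\eta^{-1}\circ\xi\|_{\mathbb{H}^n}^{Q+tq}}\Big]d\eta=0\quad\text{in }\Omega$$ is locally bounded in $\Omega$, i.e. $u\in L^\infty(K)$ for every compact $K\subset\Omega$.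
   Context: The Heisenberg group $\mathbb{H}^n$ ($n\ge1$) is $\mathbb{R}^{2n+1}$ with the group law $\xi\circ\eta=(x_1+y_1,\dots,x_{2n}+y_{2n},\tau+\tau'+\frac12\sum_{i=1}^n(x_iy_{n+i}-x_{n+i}y_i))$ for $\xi=(x_1,\dots,x_{2n},\tau)$, $\eta=(y_1,\dots,y_{2n},\tau')$; measure is Lebesgue measure $|\cdot|$ on $\mathbb{R}^{2n+1}$. The homogeneous norm is $\|\xi\|_{\mathbb{H}^n}=((\sum_{i=1}^{2n}x_i^2)^2+\tau^2)^{1/4}$ and $Q=2n+2$. Balls $B_r(\xi_0)=\{\xi:d(\xi,\xi_0)<r\}$ are taken with respect to the Carnot–Carathéodory distance $d$, which is equivalent to $(\xi,\eta)\mapsto\|\xi^{-1}\circ\eta\|_{\mathbb{H}^n}$. Condition (A1): $a:\mathbb{H}^n\times\mathbb{H}^n\to[0,\infty)$ is measurable with $0\le a(\xi,\eta)=a(\eta,\xi)\le\|a\|_{L^\infty}<\infty$. Notation: $J_l(\tau)=|\tau|^{l-2}\tau$ for $l\in\{p,q\}$; $H(\xi,\eta,\tau)=\frac{\tau^p}{\|\eta^{-1}\circ\xi\|^{sp}_{\mathbb{H}^n}}+a(\xi,\eta)\frac{\tau^q}{\|\eta^{-1}\circ\xi\|^{tq}_{\mathbb{H}^n}}$ for $\tau\ge0$; $\mathcal{C}_\Omega=(\mathbb{H}^n\times\mathbb{H}^n)\setminus((\mathbb{H}^n\setminus\Omega)\times(\mathbb{H}^n\setminus\Omega))$; $\mathcal{A}(\Omega)=\{u:\mathbb{H}^n\to\mathbb{R}$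 measurable: $u|_\Omega\in L^p(\Omega)$ and $\iint_{\mathcal{C}_\Omega}H(\xi,\eta,|u(\xi)-u(\eta)|)\|\eta^{-1}\circ\xi\|^{-Q}_{\mathbb{H}^n}d\xi d\eta<\infty\}$; $L^{q-1}_{sp}(\mathbb{H}^n)=\{u\in L^{q-1}_{loc}(\mathbb{H}^n):\int_{\mathbb{H}^n}|u(\xi)|^{q-1}(1+\|\xi\|_{\mathbb{H}^n})^{-Q-sp}d\xi<\infty\}$. A weak solution is $u\in\mathcal{A}(\Omega)$ such that for every $\varphi\in\mathcal{A}(\Omega)$ with $\varphi=0$ a.e. in $\mathbb{H}^n\setminus\Omega$: $\iint_{\mathcal{C}_\Omega}\Big[\frac{J_p(u(\xi)-u(\eta))(\varphi(\xi)-\varphi(\eta))}{\|\eta^{-1}\circ\xi\|^{Q+sp}_{\mathbb{H}^n}}+a(\xi,\eta)\frac{J_q(u(\xi)-u(\eta))(\varphi(\xi)-\varphi(\eta))}{\|\eta^{-1}\circ\xi\|^{Q+tq}_{\mathbb{H}^n}}\Big]d\xi d\eta=0.$ *)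

theory Defs
  imports "HOL-Analysis.Analysis"
begin

text \<open>The Heisenberg group H^n, realised on R^{2n+1} = R^n x R^n x R.
  A point (x, y, tau) has coordinates x_i = x $ i, x_{n+i} = y $ i, and tau.
  The dimension parameter n is CARD('n).\<close>

type_synonym 'n heis = "((real^'n) \<times> (real^'n)) \<times> real"

definition heis_mult :: "'n::finite heis \<Rightarrow> 'n heis \<Rightarrow> 'n heis" where
  "heis_mult \<xi> \<eta> =
     ((fst (fst \<xi>) + fst (fst \<eta>), snd (fst \<xi>) + snd (fst \<eta>)),
      snd \<xi> + snd \<eta> + (1/2) * (fst (fst \<xi>) \<bullet> snd (fst \<eta>) - snd (fst \<xi>) \<bullet> fst (fst \<eta>)))"

definition heis_inv :: "'n::finite heis \<Rightarrow> 'n heis" where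
  "heis_inv \<xi> = ((- fst (fst \<xi>), - snd (fst \<xi>)), - snd \<xi>)"

definition hnorm :: "'n::finite heis \<Rightarrow> real" where
  "hnorm \<xi> = ((norm (fst (fst \<xi>)) ^ 2 + norm (snd (fst \<xi>)) ^ 2) ^ 2 + (snd \<xi>) ^ 2) powr (1/4)"

definition hdimQ :: "'n::finite itself \<Rightarrow> real" where
  "hdimQ _ = 2 * real CARD('n) + 2"

definition hdist :: "'n::finite heis \<Rightarrow> 'n heis \<Rightarrow> real" where
  "hdist \<xi> \<eta> = hnorm (heis_mult (heis_inv \<eta>) \<xi>)"

definition Jpow :: "real \<Rightarrow> real \<Rightarrow> real" where
  "Jpow l \<tau> = \<bar>\<tau>\<bar> powr (l - 2) * \<tau>"

definition Hfun :: "real \<Rightarrow> real \<Rightarrow> real \<Rightarrow> real \<Rightarrow> ('n::finite heis \<Rightarrow> 'n heis \<Rightarrow> real)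
                     \<Rightarrow> 'n heis \<Rightarrow> 'n heis \<Rightarrow> real \<Rightarrow> real" where
  "Hfun p q s t a \<xi> \<eta> \<tau> =
     \<tau> powr p / hdist \<xi> \<eta> powr (s * p) + a \<xi> \<eta> * \<tau> powr q / hdist \<xi> \<eta> powr (t * q)"

definition COmega :: "'n::finite heis set \<Rightarrow> ('n heis \<times> 'n heis) set" where
  "COmega \<Omega> = UNIV - ((UNIV - \<Omega>) \<times> (UNIV - \<Omega>))"

text \<open>The energy space A(Omega). Double integrals are taken w.r.t. Lebesgue measure
  on H^n x H^n = R^{4n+2}.\<close>
definition Aspace :: "real \<Rightarrow> real \<Rightarrow> real \<Rightarrow> real \<Rightarrow> ('n::finite heis \<Rightarrow> 'n heis \<Rightarrow> real)
                      \<Rightarrow> 'n heis set \<Rightarrow> ('n heis \<Rightarrow> real) set" where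
  "Aspace p q s t a \<Omega> = {u.
     u \<in> borel_measurable lebesgue \<and>
     (\<integral>\<^sup>+ \<xi>. indicator \<Omega> \<xi> * ennreal (\<bar>u \<xi>\<bar> powr p) \<partial>lebesgue) < \<infinity> \<and>
     (\<integral>\<^sup>+ z. indicator (COmega \<Omega>) z *
         ennreal (Hfun p q s t a (fst z) (snd z) \<bar>u (fst z) - u (snd z)\<bar>
                  / hdist (fst z) (snd z) powr hdimQ TYPE('n)) \<partial>lebesgue) < \<infinity>}"

definition Ltail :: "real \<Rightarrow> real \<Rightarrow> ('n::finite heis \<Rightarrow> real) set" where
  "Ltail r sp = {u.
     u \<in> borel_measurable lebesgue \<and>
     (\<forall>K. compact K \<longrightarrow> (\<integral>\<^sup>+ \<xi>. indicator K \<xi> * ennreal (\<bar>u \<xi>\<bar> powr r) \<partial>lebesgue) < \<infinity>) \<and>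
     (\<integral>\<^sup>+ \<xi>. ennreal (\<bar>u \<xi>\<bar> powr r / (1 + hnorm \<xi>) powr (hdimQ TYPE('n) + sp)) \<partial>lebesgue) < \<infinity>}"

definition weak_solution :: "real \<Rightarrow> real \<Rightarrow> real \<Rightarrow> real \<Rightarrow> ('n::finite heis \<Rightarrow> 'n heis \<Rightarrow> real)
                      \<Rightarrow> 'n heis set \<Rightarrow> ('n heis \<Rightarrow> real) \<Rightarrow> bool" where
  "weak_solution p q s t a \<Omega> u \<longleftrightarrow>
     u \<in> Aspace p q s t a \<Omega> \<and>
     (\<forall>\<phi> \<in> Aspace p q s t a \<Omega>. (AE \<xi> in lebesgue. \<xi> \<notin> \<Omega> \<longrightarrow> \<phi> \<xi> = 0) \<longrightarrow>
        (LINT z : COmega \<Omega> | lebesgue.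
            Jpow p (u (fst z) - u (snd z)) * (\<phi> (fst z) - \<phi> (snd z))
              / hdist (fst z) (snd z) powr (hdimQ TYPE('n) + s * p)
          + a (fst z) (snd z) * Jpow q (u (fst z) - u (snd z)) * (\<phi> (fst z) - \<phi> (snd z))
              / hdist (fst z) (snd z) powr (hdimQ TYPE('n) + t * q)) = 0)"

end

theory Submission
  imports Defs
begin

text \<open>
  The proof is a De Giorgi iteration. Testing the equation with \<open>(u - k)\<^sub>+ \<psi>\<^sup>q\<close> bounds the part of the
  Gagliardo energy of the test function over pairs at distance less than \<open>\<delta>\<close>: there the pointwise
  truncation inequalities absorb the cutoff error, while at distance at least \<open>\<delta>\<close> the form is
  bounded below by \<open>- (u - k)\<^sub>+\<^bsup>l-1\<^esup>(\<xi>) (u - k)\<^sub>+(\<eta>)\<close> terms, which the tail condition controls. The only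
  embedding needed is the fractional Sobolev inequality, which follows from the volume growth of
  homogeneous balls: if a ball around \<open>x\<close> has twice the measure of \<open>{f > f(x)/2}\<close>, then half of it
  contributes to the Gagliardo integral at \<open>x\<close>. With \<open>m\<close> the Sobolev exponent, the quantities
  \<open>Y\<^sub>j = \<integral> (u - k\<^sub>j)\<^sub>+\<^sup>m\<close> over shrinking neighbourhoods of the compact set satisfy
  \<open>Y\<^sub>j\<^sub>+\<^sub>1 \<le> C b\<^sup>j Y\<^sub>j\<^bsup>m/p\<^esup>\<close>. Since \<open>q \<le> m\<close>, the critical case needs no special treatment: \<open>Y\<^sub>0\<close> is made
  small by starting at a high level, by dominated convergence.
\<close>

section \<open>Geometry of the Heisenberg group\<close>

text \<open>The coefficient \<open>a\<close> is only measurable and bounded and may vanish, so the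
  q-phase yields no usable energy: near the diagonal it is exploited through its sign, elsewhere it
  is bounded by \<open>A\<close>. All gain of integrability comes from the p-phase, while the errors
  contain the powers 1, p and q of the excess. A gap h between consecutive levels turns each of
  these into the power m at the cost of a factor h^(-m), which is where q <= m is decisive. The same
  inequality makes the test function admissible: the energy space directly gives only L^p, so the
  Sobolev inequality is first applied to the localised truncation without using the equation, which
  puts the excess into L^m and hence into L^q. A single tail weight serves both phases because an
  excess to the power p-1 or q-1 is at most 1 + |u|^(q-1), and sp <= tq. Cutoffs are built from the
  Euclidean distance to the compact set, which is dominated by \<open>hdist\<close> locally on
  bounded sets. All constants are explicit powers of the cutoff scale, so halving that scale at each
  step costs only a geometric factor.\<close>

lemma hnorm_sqrt: "hnorm \<xi> = sqrt (sqrt ((norm (fst (fst \<xi>)) ^ 2 + norm (snd (fst \<xi>)) ^ 2) ^ 2 + (snd \<xi>) ^ 2))"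
proof -
  have "z powr (1/4) = sqrt (sqrt z)" if "z \<ge> 0" for z :: real
    using that by (simp add: powr_half_sqrt[symmetric] powr_powr)
  then show ?thesis unfolding hnorm_def by (simp add: sum_power2_ge_zero)
qed

lemma hnorm_nonneg [simp]: "0 \<le> hnorm \<xi>"
  by (simp add: hnorm_def)

text \<open>Nested square roots are continuous everywhere, whereas continuity of \<open>powr\<close>
  at base 0 carries a side condition; hence the detour through \<open>hnorm_sqrt\<close>.\<close>

lemma continuous_on_hnorm [continuous_intros]:
  assumes "continuous_on A f" shows "continuous_on A (\<lambda>x. hnorm (f x))"
  unfolding hnorm_sqrt by (intro continuous_intros assms)

lemma continuous_on_heis_mult [continuous_intros]:
  assumes "continuous_on A f" "continuous_on A g" shows "continuous_on A (\<lambda>x. heis_mult (f x) (g x))"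
  unfolding heis_mult_def by (intro continuous_intros assms)

lemma continuous_on_heis_inv [continuous_intros]:
  assumes "continuous_on A f" shows "continuous_on A (\<lambda>x. heis_inv (f x))"
  unfolding heis_inv_def by (intro continuous_intros assms)

lemma continuous_on_hdist [continuous_intros]:
  assumes "continuous_on A f" "continuous_on A g" shows "continuous_on A (\<lambda>x. hdist (f x) (g x))"
  unfolding hdist_def by (intro continuous_intros assms)

lemma measurable_hnorm [measurable]: "hnorm \<in> borel_measurable borel"
  by (intro borel_measurable_continuous_onI continuous_intros)

lemma measurable_heis_mult [measurable (raw)]:
  assumes "f \<in> borel_measurable M" "g \<in> borel_measurable M"
  shows "(\<lambda>x. heis_mult (f x) (g x)) \<in> borel_measurable M"
  by (rule borel_measurable_continuous_Pair[OF assms]) (intro continuous_intros)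

lemma measurable_hdist [measurable (raw)]:
  assumes "f \<in> borel_measurable M" "g \<in> borel_measurable M"
  shows "(\<lambda>x. hdist (f x) (g x)) \<in> borel_measurable M"
  by (rule borel_measurable_continuous_Pair[OF assms]) (intro continuous_intros)

lemma hnorm_pow4: "hnorm \<xi> ^ 4 = (norm (fst (fst \<xi>)) ^ 2 + norm (snd (fst \<xi>)) ^ 2) ^ 2 + (snd \<xi>) ^ 2"
proof -
  have "hnorm \<xi> ^ 4 = (hnorm \<xi> ^ 2) ^ 2" by (simp flip: power_mult)
  then show ?thesis by (simp add: hnorm_sqrt)
qed

lemma hnorm_le_iff: "0 \<le> c \<Longrightarrow> hnorm \<xi> \<le> c \<longleftrightarrow> (norm (fst (fst \<xi>)) ^ 2 + norm (snd (fst \<xi>)) ^ 2) ^ 2 + (snd \<xi>) ^ 2 \<le> c ^ 4"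
  by (metis hnorm_nonneg hnorm_pow4 power_mono_iff zero_less_numeral)

lemma norm_fst_pow4: "norm (fst \<xi>) ^ 4 = ((norm (fst (fst \<xi>)))\<^sup>2 + (norm (snd (fst \<xi>)))\<^sup>2)\<^sup>2"
proof -
  have "norm (fst \<xi>) ^ 4 = (norm (fst \<xi>) ^ 2) ^ 2" by (simp flip: power_mult)
  also have "norm (fst \<xi>) ^ 2 = (norm (fst (fst \<xi>)))\<^sup>2 + (norm (snd (fst \<xi>)))\<^sup>2"
    by (simp add: norm_prod_def)
  finally show ?thesis .
qed

lemma norm_le_hnorm: "norm (fst \<xi>) \<le> hnorm \<xi>"
proof -
  have "norm (fst \<xi>) ^ 4 = ((norm (fst (fst \<xi>)))\<^sup>2 + (norm (snd (fst \<xi>)))\<^sup>2)\<^sup>2"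
    by (rule norm_fst_pow4)
  also have "\<dots> \<le> hnorm \<xi> ^ 4" by (simp add: hnorm_pow4)
  finally show ?thesis by (simp add: power_mono_iff)
qed

lemma snd_le_hnorm: "\<bar>snd \<xi>\<bar> \<le> hnorm \<xi> ^ 2"
proof -
  have "\<bar>snd \<xi>\<bar> ^ 2 \<le> (hnorm \<xi> ^ 2) ^ 2" by (simp add: hnorm_pow4 flip: power_mult)
  then show ?thesis by (rule power2_le_imp_le) simp
qed

text \<open>The symplectic form is the inner product of \<open>a\<close> with \<open>b\<close>
  rotated by a quarter turn. The rotation preserves the norm, so Cauchy-Schwarz applies.\<close>

lemma abs_symplectic_le: "\<bar>fst a \<bullet> snd b - snd a \<bullet> fst b\<bar> \<le> norm a * norm (b :: 'a::real_inner \<times> 'a)"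
proof -
  have "fst a \<bullet> snd b - snd a \<bullet> fst b = a \<bullet> (snd b, - fst b)"
    by (simp add: inner_prod_def)
  moreover have "norm (snd b, - fst b) = norm b"
    by (cases b) (simp add: norm_Pair add.commute)
  ultimately show ?thesis using Cauchy_Schwarz_ineq2[of a "(snd b, - fst b)"] by simp
qed

text \<open>With \<open>?r\<close> the sum of the two norms, the horizontal part is at most
  \<open>?r\<close> and the vertical part at most \<open>?r ^ 2\<close>, because the symplectic term
  is covered by the mixed term of the square. The factor 2 absorbs the sum of the two fourth powers.
  A quasi-triangle inequality suffices, since distances are compared only up to constants.\<close>

lemma hnorm_heis_mult_le: "hnorm (heis_mult \<xi> \<eta>) \<le> 2 * (hnorm \<xi> + hnorm \<eta>)"
proof -
  let ?r = "hnorm \<xi> + hnorm \<eta>"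
  let ?z = "heis_mult \<xi> \<eta>"
  have r0: "0 \<le> ?r" by simp
  have "fst ?z = fst \<xi> + fst \<eta>" by (simp add: heis_mult_def prod_eq_iff)
  then have 1: "norm (fst ?z) \<le> ?r"
    using norm_triangle_ineq[of "fst \<xi>" "fst \<eta>"] norm_le_hnorm[of \<xi>] norm_le_hnorm[of \<eta>] by simp
  have "\<bar>snd ?z\<bar> \<le> \<bar>snd \<xi>\<bar> + \<bar>snd \<eta>\<bar> + (1/2) * \<bar>fst (fst \<xi>) \<bullet> snd (fst \<eta>) - snd (fst \<xi>) \<bullet> fst (fst \<eta>)\<bar>"
  proof -
    have "\<bar>a + b + (1/2) * c\<bar> \<le> \<bar>a\<bar> + \<bar>b\<bar> + (1/2) * \<bar>c\<bar>" for a b c :: real by linarith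
    then show ?thesis by (simp only: heis_mult_def snd_conv)
  qed
  also have "\<dots> \<le> hnorm \<xi> ^ 2 + hnorm \<eta> ^ 2 + (1/2) * (hnorm \<xi> * hnorm \<eta>)"
    by (intro add_mono mult_left_mono snd_le_hnorm order_trans[OF abs_symplectic_le] mult_mono norm_le_hnorm) auto
  also have "\<dots> \<le> ?r ^ 2" by (simp add: power2_sum)
  finally have 2: "\<bar>snd ?z\<bar> \<le> ?r ^ 2" .
  have "norm (fst ?z) ^ 4 \<le> ?r ^ 4" using 1 by (intro power_mono) auto
  moreover have "snd ?z ^ 2 \<le> ?r ^ 4" using power_mono[OF 2, of 2] by (simp flip: power_mult)
  moreover have "norm (fst ?z) ^ 4 = ((norm (fst (fst ?z)))\<^sup>2 + (norm (snd (fst ?z)))\<^sup>2)\<^sup>2"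
    by (rule norm_fst_pow4)
  ultimately have "((norm (fst (fst ?z)))\<^sup>2 + (norm (snd (fst ?z)))\<^sup>2)\<^sup>2 + snd ?z ^ 2 \<le> 2 * ?r ^ 4"
    by linarith
  also have "\<dots> \<le> (2 * ?r) ^ 4"
    unfolding power_mult_distrib by (intro mult_right_mono) auto
  finally show ?thesis by (subst hnorm_le_iff) auto
qed

lemma heis_mult_cancel: "heis_mult (heis_mult (heis_inv \<zeta>) \<eta>) (heis_mult (heis_inv \<eta>) \<xi>) = heis_mult (heis_inv \<zeta>) \<xi>"
  by (simp add: heis_mult_def heis_inv_def prod_eq_iff algebra_simps inner_simps inner_commute)

lemma hdist_triangle: "hdist \<xi> \<zeta> \<le> 2 * (hdist \<xi> \<eta> + hdist \<eta> \<zeta>)"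
  using hnorm_heis_mult_le[of "heis_mult (heis_inv \<zeta>) \<eta>" "heis_mult (heis_inv \<eta>) \<xi>"]
  by (simp add: hdist_def heis_mult_cancel)

lemma hdist_nonneg [simp]: "0 \<le> hdist \<xi> \<eta>" by (simp add: hdist_def)

lemma hdist_commute: "hdist \<xi> \<eta> = hdist \<eta> \<xi>"
proof -
  have "heis_mult (heis_inv \<eta>) \<xi> = heis_inv (heis_mult (heis_inv \<xi>) \<eta>)"
    by (simp add: heis_mult_def heis_inv_def prod_eq_iff algebra_simps inner_simps inner_commute)
  moreover have "hnorm (heis_inv \<zeta>) = hnorm \<zeta>" for \<zeta> :: "'a heis"
    by (simp add: hnorm_def heis_inv_def)
  ultimately show ?thesis by (simp add: hdist_def)
qed

lemma hdist_0_right: "hdist \<xi> 0 = hnorm \<xi>"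
  by (simp add: hdist_def heis_mult_def heis_inv_def)

lemma hdist_self [simp]: "hdist \<xi> \<xi> = 0"
  by (simp add: hdist_def heis_mult_def heis_inv_def hnorm_def inner_commute)

text \<open>Undoing the translation by \<open>\<eta>\<close> shears the vertical coordinate by an
  amount linear in \<open>norm \<eta>\<close>, which explains the factor. Below distance 1 the
  vertical coordinate, of order \<open>hnorm v ^ 2\<close>, is dominated by \<open>hnorm v\<close>.
  This is what makes Euclidean cutoffs Lipschitz for \<open>hdist\<close> on bounded sets.\<close>

lemma dist_le_hdist:
  assumes "hdist \<xi> \<eta> \<le> 1"
  shows "dist \<xi> \<eta> \<le> (2 + norm \<eta>) * hdist \<xi> \<eta>"
proof -
  define v where "v = heis_mult (heis_inv \<eta>) \<xi>"
  have v: "hnorm v = hdist \<xi> \<eta>" by (simp add: v_def hdist_def)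
  have "\<xi> - \<eta> = (fst v, snd v + (1/2) * (fst (fst \<eta>) \<bullet> snd (fst v) - snd (fst \<eta>) \<bullet> fst (fst v)))"
    by (simp add: v_def heis_mult_def heis_inv_def prod_eq_iff algebra_simps inner_simps inner_commute)
  then have "dist \<xi> \<eta> \<le> norm (fst v) + \<bar>snd v + (1/2) * (fst (fst \<eta>) \<bullet> snd (fst v) - snd (fst \<eta>) \<bullet> fst (fst v))\<bar>"
    unfolding dist_norm using norm_Pair_le by (metis real_norm_def)
  also have "\<dots> \<le> norm (fst v) + (\<bar>snd v\<bar> + (1/2) * (norm (fst \<eta>) * norm (fst v)))"
  proof -
    have "\<bar>c + (1/2) * b\<bar> \<le> \<bar>c\<bar> + (1/2) * d" if "\<bar>b\<bar> \<le> d" for b c d :: real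
      using that by linarith
    from this[OF abs_symplectic_le] show ?thesis by simp
  qed
  also have "\<dots> \<le> hnorm v + (hnorm v + norm \<eta> * hnorm v)"
  proof (intro add_mono norm_le_hnorm)
    have "hnorm v ^ 2 \<le> hnorm v" using assms by (simp add: v power2_eq_square mult_left_le)
    then show "\<bar>snd v\<bar> \<le> hnorm v" using snd_le_hnorm[of v] by linarith
    have "norm (fst \<eta>) * norm (fst v) \<le> norm \<eta> * hnorm v"
      by (intro mult_mono norm_le_hnorm) (auto simp: norm_fst_le[of "fst \<eta>" "snd \<eta>", simplified])
    moreover have "0 \<le> norm \<eta> * hnorm v" by simp
    ultimately show "(1/2) * (norm (fst \<eta>) * norm (fst v)) \<le> norm \<eta> * hnorm v" by linarith
  qed
  finally show ?thesis by (simp add: v algebra_simps)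
qed

text \<open>Serves to replace the kernel at a base point of a bounded set by the weight of the tail
  space, with the loss explicit in \<open>\<delta>\<close>. It follows from the quasi-triangle
  inequality through the identity and from \<open>\<delta>\<close> being at most both 1 and the
  distance.\<close>

lemma one_plus_hnorm_le_hdist:
  assumes "hnorm \<xi> \<le> R" "0 < \<delta>" "\<delta> \<le> 1" "\<delta> \<le> hdist \<xi> \<eta>"
  shows "\<delta> * (1 + hnorm \<eta>) \<le> (3 + 2 * R) * hdist \<xi> \<eta>"
proof -
  have R0: "0 \<le> R" using assms(1) hnorm_nonneg[of \<xi>] by linarith
  have "hnorm \<eta> \<le> 2 * (hdist \<xi> \<eta> + hnorm \<xi>)"
    using hdist_triangle[of \<eta> 0 \<xi>] hdist_0_right[of \<eta>] hdist_0_right[of \<xi>]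
    hdist_commute[of \<eta> \<xi>] by simp
  then have "1 + hnorm \<eta> \<le> (1 + 2 * R) + 2 * hdist \<xi> \<eta>" using assms(1) by simp
  then have "\<delta> * (1 + hnorm \<eta>) \<le> \<delta> * (1 + 2 * R) + \<delta> * (2 * hdist \<xi> \<eta>)"
    using assms(2) by (metis distrib_left mult_le_cancel_left_pos)
  also have "\<dots> \<le> hdist \<xi> \<eta> * (1 + 2 * R) + 1 * (2 * hdist \<xi> \<eta>)"
    using assms R0 by (intro add_mono mult_right_mono) auto
  finally show ?thesis by (simp add: algebra_simps)
qed

lemma nn_integral_lborel_translation:
  assumes [measurable]: "f \<in> borel_measurable borel"
  shows "(\<integral>\<^sup>+ y. f (x + y) \<partial>lborel) = (\<integral>\<^sup>+ y. f y \<partial>(lborel :: 'a::euclidean_space measure))"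
proof -
  have "(\<integral>\<^sup>+ y. f y \<partial>lborel) = (\<integral>\<^sup>+ y. f y \<partial>distr lborel borel ((+) x))"
    by (simp add: lborel_distr_plus)
  also have "\<dots> = (\<integral>\<^sup>+ y. f (x + y) \<partial>lborel)"
    by (subst nn_integral_distr) auto
  finally show ?thesis by simp
qed

lemma nn_integral_lborel_prod:
  assumes [measurable]: "f \<in> borel_measurable borel"
  shows "(\<integral>\<^sup>+ z. f z \<partial>(lborel :: ('a::euclidean_space \<times> 'b::euclidean_space) measure))
     = (\<integral>\<^sup>+ x. \<integral>\<^sup>+ y. f (x, y) \<partial>lborel \<partial>lborel)"
  by (subst lborel_prod[symmetric], subst lborel.nn_integral_fst[symmetric]) (auto simp: lborel_prod)

text \<open>For a fixed horizontal part the group law shifts the vertical coordinate by a constant,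
  so Fubini and two Euclidean translations give left invariance of the measure.\<close>

lemma nn_integral_heis_mult:
  fixes \<xi> :: "'n::finite heis"
  assumes [measurable]: "f \<in> borel_measurable borel"
  shows "(\<integral>\<^sup>+ \<eta>. f (heis_mult \<xi> \<eta>) \<partial>lborel) = (\<integral>\<^sup>+ \<eta>. f \<eta> \<partial>lborel)"
proof -
  have "(\<integral>\<^sup>+ \<eta>. f (heis_mult \<xi> \<eta>) \<partial>lborel) =
    (\<integral>\<^sup>+ z. \<integral>\<^sup>+ \<tau>. f (fst \<xi> + z, (snd \<xi> + (1/2) * (fst (fst \<xi>) \<bullet> snd z - snd (fst \<xi>) \<bullet> fst z)) + \<tau>) \<partial>lborel \<partial>lborel)"
  proof -
    have "(\<lambda>\<eta>. f (heis_mult \<xi> \<eta>)) \<in> borel_measurable borel" by measurable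
    moreover have "heis_mult \<xi> (z, \<tau>) = (fst \<xi> + z, (snd \<xi> + (1/2) * (fst (fst \<xi>) \<bullet> snd z - snd (fst \<xi>) \<bullet> fst z)) + \<tau>)" for z \<tau>
      by (simp add: heis_mult_def plus_prod_def)
    ultimately show ?thesis by (simp only: nn_integral_lborel_prod)
  qed
  also have "\<dots> = (\<integral>\<^sup>+ z. \<integral>\<^sup>+ \<tau>. f (fst \<xi> + z, \<tau>) \<partial>lborel \<partial>lborel)"
    by (intro nn_integral_cong nn_integral_lborel_translation[where f = "\<lambda>\<tau>. f (fst \<xi> + z, \<tau>)" for z]) auto
  also have "\<dots> = (\<integral>\<^sup>+ z. \<integral>\<^sup>+ \<tau>. f (z, \<tau>) \<partial>lborel \<partial>lborel)"
    by (rule nn_integral_lborel_translation[where f = "\<lambda>z. \<integral>\<^sup>+ \<tau>. f (z, \<tau>) \<partial>lborel"]) auto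
  also have "\<dots> = (\<integral>\<^sup>+ \<eta>. f \<eta> \<partial>lborel)"
    by (subst nn_integral_lborel_prod) simp_all
  finally show ?thesis .
qed

lemma nn_integral_hdist:
  fixes \<xi> :: "'n::finite heis"
  assumes [measurable]: "g \<in> borel_measurable borel"
  shows "(\<integral>\<^sup>+ \<eta>. g (hdist \<xi> \<eta>) \<partial>lborel) = (\<integral>\<^sup>+ \<eta>. g (hnorm (\<eta> :: 'n heis)) \<partial>lborel)"
    and "(\<integral>\<^sup>+ \<eta>. g (hdist \<eta> \<xi>) \<partial>lborel) = (\<integral>\<^sup>+ \<eta>. g (hnorm (\<eta> :: 'n heis)) \<partial>lborel)"
proof -
  show "(\<integral>\<^sup>+ \<eta>. g (hdist \<eta> \<xi>) \<partial>lborel) = (\<integral>\<^sup>+ \<eta>. g (hnorm (\<eta> :: 'n heis)) \<partial>lborel)"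
    unfolding hdist_def by (rule nn_integral_heis_mult[where f = "\<lambda>\<eta>. g (hnorm \<eta>)"]) auto
  then show "(\<integral>\<^sup>+ \<eta>. g (hdist \<xi> \<eta>) \<partial>lborel) = (\<integral>\<^sup>+ \<eta>. g (hnorm (\<eta> :: 'n heis)) \<partial>lborel)"
    by (simp add: hdist_commute)
qed

section \<open>Volumes of homogeneous balls\<close>

lemma nn_integral_lborel_scaleR:
  assumes [measurable]: "f \<in> borel_measurable borel" and "0 < r"
  shows "(\<integral>\<^sup>+ y. f y \<partial>(lborel :: 'a::euclidean_space measure)) = ennreal (r ^ DIM('a)) * (\<integral>\<^sup>+ y. f (r *\<^sub>R y) \<partial>lborel)"
  using assms(2)
  by (subst lborel_affine[of r 0]) (auto simp: nn_integral_density nn_integral_distr nn_integral_cmult)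

text \<open>The 2n horizontal coordinates scale by \<open>r\<close> and the vertical one by
  \<open>r ^ 2\<close>; the Jacobian thus has exponent 2n + 2, the homogeneous dimension.\<close>

lemma nn_integral_heis_dilation:
  fixes f :: "'n::finite heis \<Rightarrow> ennreal"
  assumes [measurable]: "f \<in> borel_measurable borel" and r: "0 < r"
  shows "(\<integral>\<^sup>+ \<eta>. f \<eta> \<partial>lborel) = ennreal (r powr hdimQ TYPE('n)) * (\<integral>\<^sup>+ \<eta>. f (r *\<^sub>R fst \<eta>, r ^ 2 * snd \<eta>) \<partial>lborel)"
proof -
  have "(\<integral>\<^sup>+ \<eta>. f \<eta> \<partial>lborel) = (\<integral>\<^sup>+ z. \<integral>\<^sup>+ \<tau>. f (z, \<tau>) \<partial>lborel \<partial>lborel)"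
    by (simp add: nn_integral_lborel_prod)
  also have "\<dots> = (\<integral>\<^sup>+ z. ennreal (r ^ 2) * (\<integral>\<^sup>+ \<tau>. f (z, r ^ 2 * \<tau>) \<partial>lborel) \<partial>lborel)"
  proof (rule nn_integral_cong)
    fix z
    show "(\<integral>\<^sup>+ \<tau>. f (z, \<tau>) \<partial>lborel) = ennreal (r ^ 2) * (\<integral>\<^sup>+ \<tau>. f (z, r ^ 2 * \<tau>) \<partial>lborel)"
      using nn_integral_lborel_scaleR[of "\<lambda>\<tau>. f (z, \<tau>)" "r ^ 2"] r by simp
  qed
  also have "\<dots> = ennreal (r ^ 2) * (\<integral>\<^sup>+ z. (\<integral>\<^sup>+ \<tau>. f (z, r ^ 2 * \<tau>) \<partial>lborel) \<partial>lborel)"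
    by (rule nn_integral_cmult) measurable
  also have "(\<integral>\<^sup>+ z. (\<integral>\<^sup>+ \<tau>. f (z, r ^ 2 * \<tau>) \<partial>lborel) \<partial>lborel)
      = ennreal (r ^ (2 * CARD('n))) * (\<integral>\<^sup>+ z. (\<integral>\<^sup>+ \<tau>. f (r *\<^sub>R z, r ^ 2 * \<tau>) \<partial>lborel) \<partial>lborel)"
    using nn_integral_lborel_scaleR[of "\<lambda>z. \<integral>\<^sup>+ \<tau>. f (z, r ^ 2 * \<tau>) \<partial>lborel" r] r by (simp add: mult_2)
  also have "(\<integral>\<^sup>+ z. (\<integral>\<^sup>+ \<tau>. f (r *\<^sub>R z, r ^ 2 * \<tau>) \<partial>lborel) \<partial>lborel) = (\<integral>\<^sup>+ \<eta>. f (r *\<^sub>R fst \<eta>, r ^ 2 * snd \<eta>) \<partial>lborel)"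
  proof -
    have "(\<lambda>\<eta>. f (r *\<^sub>R fst \<eta>, r ^ 2 * snd \<eta>)) \<in> borel_measurable borel"
      by (rule measurable_compose[OF borel_measurable_continuous_onI assms(1)]) (intro continuous_intros)
    then show ?thesis by (simp add: nn_integral_lborel_prod)
  qed
  finally have "(\<integral>\<^sup>+ \<eta>. f \<eta> \<partial>lborel) = ennreal (r ^ 2) * (ennreal (r ^ (2 * CARD('n))) * (\<integral>\<^sup>+ \<eta>. f (r *\<^sub>R fst \<eta>, r ^ 2 * snd \<eta>) \<partial>lborel))" .
  moreover have "ennreal (r ^ 2) * ennreal (r ^ (2 * CARD('n))) = ennreal (r powr hdimQ TYPE('n))"
  proof -
    have "r powr hdimQ TYPE('n) = r powr real (2 + 2 * CARD('n))" by (simp add: hdimQ_def add.commute)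
    also have "\<dots> = r ^ 2 * r ^ (2 * CARD('n))" using r by (subst powr_realpow) (simp_all add: power_add power2_eq_square)
    finally show ?thesis by (simp add: ennreal_mult)
  qed
  ultimately show ?thesis by (simp add: mult.assoc[symmetric])
qed

lemma hnorm_dilation: "0 \<le> r \<Longrightarrow> hnorm (r *\<^sub>R z, r ^ 2 * \<tau>) = r * hnorm (z, \<tau>)"
proof -
  assume r: "0 \<le> r"
  have "hnorm (r *\<^sub>R z, r ^ 2 * \<tau>) ^ 4 = (r * hnorm (z, \<tau>)) ^ 4"
    unfolding power_mult_distrib hnorm_pow4 by (simp add: power_mult_distrib distrib_left[symmetric] flip: power_mult)
  then show ?thesis using r by (metis hnorm_nonneg mult_nonneg_nonneg power_eq_imp_eq_base zero_less_numeral)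
qed

definition hvol :: "'n::finite itself \<Rightarrow> real" where
  "hvol _ = measure lborel {\<eta> :: 'n heis. hnorm \<eta> < 1}"

lemma bounded_hball: "bounded {\<eta> :: 'n::finite heis. hnorm \<eta> < r}"
proof (rule boundedI)
  fix x :: "'n heis" assume x: "x \<in> {\<eta>. hnorm \<eta> < r}"
  have "norm x \<le> norm (fst x) + \<bar>snd x\<bar>" using norm_Pair_le[of "fst x" "snd x"] by simp
  also have "\<dots> \<le> hnorm x + hnorm x ^ 2" by (intro add_mono norm_le_hnorm snd_le_hnorm)
  also have "\<dots> \<le> r + r ^ 2" using x by (intro add_mono power_mono) auto
  finally show "norm x \<le> r + r ^ 2" .
qed

lemma open_hball: "open {\<eta> :: 'n::finite heis. hnorm \<eta> < r}"
  by (intro open_Collect_less continuous_intros)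

lemma emeasure_hball_1: "emeasure lborel {\<eta> :: 'n::finite heis. hnorm \<eta> < 1} = ennreal (hvol TYPE('n))"
  unfolding hvol_def
  using emeasure_bounded_finite[OF bounded_hball[of 1, where 'n='n]] by (intro emeasure_eq_ennreal_measure) auto

lemma hvol_pos: "0 < hvol TYPE('n::finite)"
proof -
  let ?B = "{\<eta> :: 'n heis. hnorm \<eta> < 1}"
  have "0 \<in> ?B" by (simp add: hnorm_def zero_prod_def)
  then have "\<not> negligible ?B" using open_not_negligible[OF open_hball] by blast
  then have "emeasure lborel ?B \<noteq> 0"
    using open_hball[of 1] by (metis negligible_iff_null_sets null_sets_completionI null_setsI borel_open sets_lborel)
  then show ?thesis unfolding emeasure_hball_1 by (simp add: ennreal_eq_0_iff not_le)
qed

text \<open>Left invariance moves the centre to the identity, and the dilation then reduces the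
  radius to 1.\<close>

lemma emeasure_hball:
  fixes \<xi> :: "'n::finite heis"
  assumes r: "0 < r"
  shows "emeasure lborel {\<eta>. hdist \<xi> \<eta> < r} = ennreal (hvol TYPE('n) * r powr hdimQ TYPE('n))"
proof -
  have "emeasure lborel {\<eta>. hdist \<xi> \<eta> < r} = (\<integral>\<^sup>+ \<eta>. indicator {..<r} (hdist \<xi> \<eta>) \<partial>lborel)"
  proof -
    have "(\<integral>\<^sup>+ \<eta>. indicator {..<r} (hdist \<xi> \<eta>) \<partial>lborel) = (\<integral>\<^sup>+ \<eta>. indicator {\<eta>. hdist \<xi> \<eta> < r} \<eta> \<partial>lborel)"
      by (intro nn_integral_cong) (simp add: indicator_def)
    then show ?thesis by simp
  qed
  also have "\<dots> = (\<integral>\<^sup>+ \<eta>. indicator {..<r} (hnorm (\<eta> :: 'n heis)) \<partial>lborel)"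
    by (rule nn_integral_hdist) measurable
  also have "\<dots> = ennreal (r powr hdimQ TYPE('n)) * (\<integral>\<^sup>+ \<eta>. indicator {..<r} (hnorm (r *\<^sub>R fst \<eta>, r ^ 2 * snd (\<eta> :: 'n heis))) \<partial>lborel)"
    by (rule nn_integral_heis_dilation) (use r in measurable)
  also have "(\<integral>\<^sup>+ \<eta>. indicator {..<r} (hnorm (r *\<^sub>R fst \<eta>, r ^ 2 * snd (\<eta> :: 'n heis))) \<partial>lborel) =
      (\<integral>\<^sup>+ \<eta>. indicator {\<eta> :: 'n heis. hnorm \<eta> < 1} \<eta> \<partial>lborel)"
    using r by (intro nn_integral_cong) (simp add: hnorm_dilation indicator_def)
  also have "\<dots> = ennreal (hvol TYPE('n))"
    by (subst nn_integral_indicator) (simp_all add: emeasure_hball_1)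
  finally show ?thesis using hvol_pos[where 'n='n] by (simp add: ennreal_mult'' mult.commute)
qed

lemma dyadic_le_1:
  fixes h :: real assumes "0 < h" "h < 1"
  obtains k where "(1/2) ^ Suc k \<le> h" "h < (1/2) ^ k"
proof -
  define n where "n = (LEAST n. (1/2) ^ n \<le> h)"
  have ex: "\<exists>n. (1/2::real) ^ n \<le> h" using real_arch_pow_inv[of h "1/2"] assms by (auto intro: less_imp_le)
  have n: "(1/2) ^ n \<le> h" unfolding n_def using ex by (rule LeastI_ex)
  then obtain k where k: "n = Suc k" using assms by (cases n) auto
  have "\<not> (1/2) ^ k \<le> h" using not_less_Least[of k "\<lambda>n. (1/2) ^ n \<le> h"] k by (simp add: n_def)
  with n k that show ?thesis by auto
qed

lemma dyadic_ge_1: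
  fixes h :: real assumes "1 \<le> h"
  obtains k where "2 ^ k \<le> h" "h < 2 ^ Suc k"
proof -
  define n where "n = (LEAST n. h < 2 ^ n)"
  have ex: "\<exists>n. h < 2 ^ n" using real_arch_pow[of 2 h] by auto
  have n: "h < 2 ^ n" unfolding n_def using ex by (rule LeastI_ex)
  then obtain k where k: "n = Suc k" using assms by (cases n) auto
  have "\<not> h < 2 ^ k" using not_less_Least[of k "\<lambda>n. h < 2 ^ n"] k by (simp add: n_def)
  with n k that show ?thesis by (auto simp: not_less)
qed

text \<open>Dyadic summation in one form for two uses: \<open>\<mu> = 1/2\<close> treats the
  singularity at the identity, \<open>\<mu> = 2\<close> the decay at infinity. By
  \<open>emeasure_hball\<close> the k-th ball contributes a constant times
  \<open>(b * \<mu> powr hdimQ TYPE('n)) ^ k\<close>, a convergent geometric series.\<close>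

lemma nn_integral_le_geometric:
  fixes f :: "'n::finite heis \<Rightarrow> ennreal"
  assumes f: "\<And>\<eta>. f \<eta> \<noteq> 0 \<Longrightarrow> \<exists>k. f \<eta> \<le> ennreal (c * b ^ k) \<and> hnorm \<eta> < \<rho> * \<mu> ^ k"
    and pos: "0 \<le> c" "0 \<le> b" "0 < \<rho>" "0 < \<mu>" and less: "b * \<mu> powr hdimQ TYPE('n) < 1"
  shows "integral\<^sup>N lborel f < \<infinity>"
proof -
  let ?Q = "hdimQ TYPE('n)"
  define B where "B k = {\<eta> :: 'n heis. hnorm \<eta> < \<rho> * \<mu> ^ k}" for k
  have B[measurable]: "B k \<in> sets borel" for k unfolding B_def by measurable
  have eB: "emeasure lborel (B k) = ennreal (hvol TYPE('n) * (\<rho> * \<mu> ^ k) powr ?Q)" for k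
    using emeasure_hball[of "\<rho> * \<mu> ^ k" 0] pos by (simp add: B_def hdist_commute[of 0] hdist_0_right)
  let ?g = "\<lambda>k \<eta>. ennreal (c * b ^ k) * indicator (B k) \<eta>"
  have "integral\<^sup>N lborel f \<le> (\<integral>\<^sup>+ \<eta>. (\<Sum>k. ?g k \<eta>) \<partial>lborel)"
  proof (rule nn_integral_mono)
    fix \<eta> :: "'n heis"
    show "f \<eta> \<le> (\<Sum>k. ?g k \<eta>)"
    proof (cases "f \<eta> = 0")
      case False
      then obtain k where "f \<eta> \<le> ennreal (c * b ^ k)" "\<eta> \<in> B k" using f unfolding B_def by blast
      then have "f \<eta> \<le> (\<Sum>k\<in>{k}. ?g k \<eta>)" by simp
      also have "\<dots> \<le> (\<Sum>k. ?g k \<eta>)" by (intro sum_le_suminf) auto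
      finally show ?thesis .
    qed simp
  qed
  also have "\<dots> = (\<Sum>k. \<integral>\<^sup>+ \<eta>. ?g k \<eta> \<partial>lborel)" by (intro nn_integral_suminf) measurable
  also have "\<dots> = (\<Sum>k. ennreal (c * hvol TYPE('n) * \<rho> powr ?Q * (b * \<mu> powr ?Q) ^ k))"
  proof (rule suminf_cong)
    fix k
    have "(\<integral>\<^sup>+ \<eta>. ?g k \<eta> \<partial>lborel) = ennreal (c * b ^ k) * ennreal (hvol TYPE('n) * (\<rho> * \<mu> ^ k) powr ?Q)"
      by (subst nn_integral_cmult_indicator) (auto simp: eB)
    also have "\<dots> = ennreal (c * b ^ k * (hvol TYPE('n) * (\<rho> * \<mu> ^ k) powr ?Q))"
      using pos hvol_pos[where 'n='n] by (subst ennreal_mult[symmetric]) auto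
    also have "(\<rho> * \<mu> ^ k) powr ?Q = \<rho> powr ?Q * (\<mu> powr ?Q) ^ k"
      using pos by (simp add: powr_mult powr_powr powr_realpow[symmetric] mult.commute)
    finally show "(\<integral>\<^sup>+ \<eta>. ?g k \<eta> \<partial>lborel) = ennreal (c * hvol TYPE('n) * \<rho> powr ?Q * (b * \<mu> powr ?Q) ^ k)"
      by (simp add: power_mult_distrib mult_ac)
  qed
  also have "\<dots> < \<infinity>"
  proof -
    have "summable (\<lambda>k. c * hvol TYPE('n) * \<rho> powr ?Q * (b * \<mu> powr ?Q) ^ k)"
      using pos less by (intro summable_mult summable_geometric) auto
    then have "(\<Sum>k. ennreal (c * hvol TYPE('n) * \<rho> powr ?Q * (b * \<mu> powr ?Q) ^ k)) =
       ennreal (\<Sum>k. c * hvol TYPE('n) * \<rho> powr ?Q * (b * \<mu> powr ?Q) ^ k)"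
      using pos hvol_pos[where 'n='n] by (intro suminf_ennreal2) auto
    then show ?thesis by simp
  qed
  finally show ?thesis .
qed

lemma nn_integral_hnorm_near:
  assumes "0 < e"
  shows "(\<integral>\<^sup>+ \<eta>. indicator {0<..<1} (hnorm \<eta>) * ennreal (hnorm \<eta> powr (e - hdimQ TYPE('n))) \<partial>(lborel :: 'n::finite heis measure)) < \<infinity>"
proof (rule nn_integral_le_geometric[where c = "2 powr \<bar>e - hdimQ TYPE('n)\<bar>" and b = "2 powr (hdimQ TYPE('n) - e)" and \<rho> = 1 and \<mu> = "1/2"])
  let ?a = "e - hdimQ TYPE('n)"
  fix \<eta> :: "'n heis"
  assume "indicator {0<..<1} (hnorm \<eta>) * ennreal (hnorm \<eta> powr (e - hdimQ TYPE('n))) \<noteq> 0"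
  then have h: "0 < hnorm \<eta>" "hnorm \<eta> < 1" by (auto simp: indicator_def split: if_splits)
  then obtain k where k: "(1/2) ^ Suc k \<le> hnorm \<eta>" "hnorm \<eta> < (1/2) ^ k" by (rule dyadic_le_1)
  \<comment> \<open>The position of \<open>hnorm \<eta>\<close> inside its dyadic shell. The
    exponent \<open>?a\<close> may have either sign, so the bound of \<open>\<theta> powr ?a\<close>
    on [1/2, 1] carries an absolute value; this is the constant \<open>c\<close> chosen
    above.\<close>
  define \<theta> where "\<theta> = hnorm \<eta> * 2 ^ k"
  have \<theta>: "1/2 \<le> \<theta>" "\<theta> \<le> 1" using k by (auto simp: \<theta>_def field_simps)
  have eq: "hnorm \<eta> = \<theta> * (1/2) ^ k" by (simp add: \<theta>_def field_simps)
  have "\<theta> powr ?a \<le> 2 powr \<bar>?a\<bar>"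
  proof (cases "?a \<ge> 0")
    case True
    then have "\<theta> powr ?a \<le> 1" using \<theta> powr_mono2[of ?a \<theta> 1] by simp
    also have "1 \<le> 2 powr \<bar>?a\<bar>" using ge_one_powr_ge_zero[of 2 "\<bar>?a\<bar>"] by simp
    finally show ?thesis .
  next
    case False
    then have "\<theta> powr ?a \<le> (1/2) powr ?a" using \<theta> by (intro powr_mono2') auto
    also have "\<dots> = 2 powr \<bar>?a\<bar>" using False by (simp add: powr_divide powr_minus_divide[symmetric])
    finally show ?thesis .
  qed
  moreover have "((1/2) ^ k) powr ?a = (2 powr (hdimQ TYPE('n) - e)) ^ k"
  proof -
    have "((1/2) ^ k) powr ?a = (((1/2) powr ?a)) ^ k"
      by (simp add: powr_powr powr_realpow[symmetric] mult.commute del: power_one_over)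
    also have "(1/2::real) powr ?a = 2 powr (- ?a)" by (simp only: powr_minus_divide) (simp add: powr_divide)
    finally show ?thesis by simp
  qed
  ultimately have "hnorm \<eta> powr ?a \<le> 2 powr \<bar>?a\<bar> * (2 powr (hdimQ TYPE('n) - e)) ^ k"
    unfolding eq using \<theta> by (simp add: powr_mult mult_right_mono)
  then show "\<exists>k. indicator {0<..<1} (hnorm \<eta>) * ennreal (hnorm \<eta> powr ?a)
     \<le> ennreal (2 powr \<bar>?a\<bar> * (2 powr (hdimQ TYPE('n) - e)) ^ k) \<and> hnorm \<eta> < 1 * (1/2) ^ k"
    using k h by (intro exI[of _ k]) (auto simp: indicator_def intro!: ennreal_leI)
next
  have "(1/2::real) powr hdimQ TYPE('n) = 2 powr (- hdimQ TYPE('n))" by (simp add: powr_divide powr_minus_divide)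
  then have "2 powr (hdimQ TYPE('n) - e) * (1/2) powr hdimQ TYPE('n) = 2 powr (- e)" by (simp flip: powr_add)
  also have "\<dots> < 1" using assms powr_less_mono[of "-e" 0 2] by simp
  finally show "2 powr (hdimQ TYPE('n) - e) * (1/2) powr hdimQ TYPE('n) < 1" .
qed auto

lemma nn_integral_hnorm_far:
  assumes "0 < e"
  shows "(\<integral>\<^sup>+ \<eta>. ennreal (1 / (1 + hnorm \<eta>) powr (hdimQ TYPE('n) + e)) \<partial>(lborel :: 'n::finite heis measure)) < \<infinity>"
proof (rule nn_integral_le_geometric[where c = 1 and b = "2 powr (- (hdimQ TYPE('n) + e))" and \<rho> = 2 and \<mu> = 2])
  let ?a = "hdimQ TYPE('n) + e"
  have a: "0 \<le> ?a" using assms by (simp add: hdimQ_def)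
  fix \<eta> :: "'n heis"
  have "1 \<le> 1 + hnorm \<eta>" by simp
  then obtain k where k: "2 ^ k \<le> 1 + hnorm \<eta>" "1 + hnorm \<eta> < 2 ^ Suc k" by (rule dyadic_ge_1)
  have "(2 ^ k) powr ?a \<le> (1 + hnorm \<eta>) powr ?a" using k a by (intro powr_mono2) auto
  then have "1 / (1 + hnorm \<eta>) powr ?a \<le> 1 / (2 ^ k) powr ?a"
    using add_pos_nonneg[OF zero_less_one hnorm_nonneg[of \<eta>]] by (intro divide_left_mono mult_pos_pos) auto
  also have "\<dots> = (2 powr (- ?a)) ^ k"
    by (simp add: powr_powr powr_realpow[symmetric] mult.commute powr_minus_divide[symmetric] algebra_simps)
  finally show "\<exists>k. ennreal (1 / (1 + hnorm \<eta>) powr ?a) \<le> ennreal (1 * (2 powr (- ?a)) ^ k) \<and> hnorm \<eta> < 2 * 2 ^ k"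
    using k by (intro exI[of _ k]) (auto intro!: ennreal_leI)
next
  have "2 powr (- (hdimQ TYPE('n) + e)) * 2 powr hdimQ TYPE('n) = 2 powr (- e)" by (simp flip: powr_add)
  also have "\<dots> < 1" using assms powr_less_mono[of "-e" 0 2] by simp
  finally show "2 powr (- (hdimQ TYPE('n) + e)) * 2 powr hdimQ TYPE('n) < 1" .
qed auto

section \<open>Fractional Sobolev inequality\<close>

abbreviation nnint :: "('a::euclidean_space \<Rightarrow> real) \<Rightarrow> ennreal" where
  "nnint f \<equiv> \<integral>\<^sup>+ x. ennreal (f x) \<partial>lborel"

abbreviation gagliardo :: "('n::finite heis \<Rightarrow> real) \<Rightarrow> real \<Rightarrow> real \<Rightarrow> ennreal" where
  "gagliardo f p e \<equiv> \<integral>\<^sup>+ x. nnint (\<lambda>y. \<bar>f x - f y\<bar> powr p / hdist x y powr e) \<partial>lborel"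

lemma hdist_eq_0_iff [simp]: "hdist \<xi> \<eta> = 0 \<longleftrightarrow> \<xi> = \<eta>"
  using dist_le_hdist[of \<xi> \<eta>] by auto

text \<open>The radius is chosen such that the ball has twice the measure \<open>A\<close> that Markov's inequality gives
  for the set where \<open>f\<close> exceeds \<open>f x / 2\<close>.\<close>

lemma gagliardo_lower_bound:
  fixes f :: "'n::finite heis \<Rightarrow> real" and p \<sigma> :: real
  defines "Q \<equiv> hdimQ TYPE('n)"
  defines "m \<equiv> Q * p / (Q - \<sigma> * p)" and "\<theta> \<equiv> \<sigma> * p / Q" and "v \<equiv> hvol TYPE('n)"
  assumes [measurable]: "f \<in> borel_measurable borel" and f0: "\<And>x. 0 \<le> f x"
    and p: "0 < p" and \<sigma>: "0 < \<sigma>" "\<sigma> * p < Q"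
    and F: "nnint (\<lambda>x. f x powr m) = ennreal F" "0 < F" and fx: "0 < f x"
  shows "ennreal (v / 2 * (1/2) powr p * (2 * 2 powr m / v) powr - \<theta> * F powr - \<theta> * f x powr m)
     \<le> (\<integral>\<^sup>+ y. ennreal (\<bar>f x - f y\<bar> powr p / hdist x y powr (Q + \<sigma> * p)) \<partial>lborel)"
proof -
  have Q: "0 < Q" by (simp add: Q_def hdimQ_def)
  have v: "0 < v" by (simp add: v_def hvol_pos)
  have m: "0 < m" using p \<sigma> Q by (simp add: m_def)
  define A where "A = F * (2 / f x) powr m"
  have A: "0 < A" using F fx by (simp add: A_def)
  define r where "r = (2 * A / v) powr (1 / Q)"
  have r: "0 < r" using A v by (simp add: r_def)
  have rQ: "r powr Q = 2 * A / v" using A v Q by (simp add: r_def powr_powr)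
  define B where "B = {y. hdist x y < r}"
  define S where "S = {y. f x / 2 < f y}"
  have [measurable]: "B \<in> sets borel" "S \<in> sets borel" unfolding B_def S_def by measurable
  have eB: "emeasure lborel B = ennreal (2 * A)"
    using emeasure_hball[OF r, of x] v rQ by (simp add: B_def Q_def v_def)
  have eS: "emeasure lborel S \<le> ennreal A"
  proof -
    have "ennreal ((f x / 2) powr m) * emeasure lborel S = (\<integral>\<^sup>+ y. ennreal ((f x / 2) powr m) * indicator S y \<partial>lborel)"
      by (subst nn_integral_cmult_indicator) auto
    also have "\<dots> \<le> (\<integral>\<^sup>+ y. ennreal (f y powr m) \<partial>lborel)"
      using fx m by (intro nn_integral_mono) (auto simp: S_def indicator_def intro!: ennreal_leI powr_mono2)
    finally have *: "ennreal ((f x / 2) powr m) * emeasure lborel S \<le> ennreal F" by (simp add: F)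
    have "ennreal ((2 / f x) powr m) * (ennreal ((f x / 2) powr m) * emeasure lborel S) \<le> ennreal ((2 / f x) powr m) * ennreal F"
      by (intro mult_left_mono *) auto
    moreover have "ennreal ((2 / f x) powr m) * ennreal ((f x / 2) powr m) = 1"
      using fx by (simp add: ennreal_mult[symmetric] powr_mult[symmetric])
    moreover have "ennreal ((2 / f x) powr m) * ennreal F = ennreal A"
      using F by (simp add: A_def ennreal_mult[symmetric] mult.commute)
    ultimately show ?thesis by (simp add: mult.assoc[symmetric])
  qed
  have eBS: "ennreal A \<le> emeasure lborel (B - S)"
  proof (rule ccontr)
    assume "\<not> ?thesis"
    then have *: "emeasure lborel (B - S) < ennreal A" by simp
    have "ennreal (2 * A) \<le> emeasure lborel ((B - S) \<union> S)"
      unfolding eB[symmetric] by (intro emeasure_mono) auto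
    also have "\<dots> \<le> emeasure lborel (B - S) + emeasure lborel S" by (intro emeasure_subadditive) auto
    also have "\<dots> \<le> emeasure lborel (B - S) + ennreal A" by (intro add_left_mono eS)
    finally have **: "ennreal (2 * A) \<le> emeasure lborel (B - S) + ennreal A" .
    obtain b where "emeasure lborel (B - S) = ennreal b" "0 \<le> b"
      using * by (cases "emeasure lborel (B - S)") auto
    then show False using * ** A by (simp add: ennreal_less_iff flip: ennreal_plus)
  qed
  let ?c = "(f x / 2) powr p / r powr (Q + \<sigma> * p)"
  have "ennreal (?c * A) = ennreal ?c * ennreal A" using A by (subst ennreal_mult[symmetric]) auto
  also have "\<dots> \<le> ennreal ?c * emeasure lborel (B - S)" by (intro mult_left_mono eBS) auto
  also have "\<dots> = (\<integral>\<^sup>+ y. ennreal ?c * indicator (B - S) y \<partial>lborel)"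
    by (subst nn_integral_cmult_indicator) auto
  also have "\<dots> \<le> (\<integral>\<^sup>+ y. ennreal (\<bar>f x - f y\<bar> powr p / hdist x y powr (Q + \<sigma> * p)) \<partial>lborel)"
  proof (rule nn_integral_mono)
    fix y
    show "ennreal ?c * indicator (B - S) y \<le> ennreal (\<bar>f x - f y\<bar> powr p / hdist x y powr (Q + \<sigma> * p))"
    proof (cases "y \<in> B - S")
      case True
      then have y: "hdist x y < r" "f y \<le> f x / 2" by (auto simp: B_def S_def)
      then have "x \<noteq> y" using fx by auto
      then have d: "0 < hdist x y" by (simp add: less_le)
      have "?c \<le> \<bar>f x - f y\<bar> powr p / hdist x y powr (Q + \<sigma> * p)"
        using y d p \<sigma> Q fx by (intro frac_le powr_mono2) auto
      then show ?thesis using True by (simp add: ennreal_leI)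
    qed simp
  qed
  \<comment> \<open>Homogeneity check: \<open>A\<close> is proportional to
    \<open>f x powr - m\<close>, so the factor with exponent \<open>- \<theta>\<close> contributes
    \<open>f x powr (m * \<theta>)\<close>. The identity \<open>p + m * \<theta> = m\<close> singles
    out the Sobolev exponent and makes the bound integrable in \<open>x\<close> against the same
    power \<open>m\<close>.\<close>
  also have "?c * A = v / 2 * (1/2) powr p * (2 * 2 powr m / v) powr - \<theta> * F powr - \<theta> * f x powr m"
  proof -
    have "r powr (Q + \<sigma> * p) = r powr Q * (r powr Q) powr \<theta>"
      using Q by (simp add: powr_add powr_powr \<theta>_def)
    also have "\<dots> = 2 * A / v * (2 * A / v) powr \<theta>" unfolding rQ ..
    finally have rA: "r powr (Q + \<sigma> * p) = 2 * A / v * (2 * A / v) powr \<theta>" .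
    have "X / (2 * A / v * Y) * A = X * (v / 2) * (1 / Y)" if "0 < Y" for X Y :: real
      using A v that by (simp add: field_simps)
    then have "?c * A = (f x / 2) powr p * (v / 2) * (2 * A / v) powr - \<theta>"
      unfolding rA powr_minus_divide using A v by simp
    also have "2 * A / v = (2 * 2 powr m / v) * F * f x powr - m"
      using fx by (simp add: A_def powr_divide powr_minus field_simps)
    also have "\<dots> powr - \<theta> = (2 * 2 powr m / v) powr - \<theta> * F powr - \<theta> * f x powr (m * \<theta>)"
    proof -
      have "(x * y * z) powr e = x powr e * y powr e * z powr e" if "0 \<le> x" "0 \<le> y" "0 \<le> z" for x y z e :: real
        using that by (simp add: powr_mult)
      from this[of "2 * 2 powr m / v" F "f x powr - m" "- \<theta>"] show ?thesis using v F by (simp add: powr_powr)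
    qed
    also have f2: "(f x / 2) powr p = (1/2) powr p * f x powr p" using fx by (simp add: powr_divide)
    also have "(1/2) powr p * f x powr p * (v / 2) * ((2 * 2 powr m / v) powr - \<theta> * F powr - \<theta> * f x powr (m * \<theta>))
       = v / 2 * (1/2) powr p * (2 * 2 powr m / v) powr - \<theta> * F powr - \<theta> * f x powr (p + m * \<theta>)"
      by (simp add: powr_add)
    also have "p + m * \<theta> = m"
      using Q \<sigma> by (simp add: m_def \<theta>_def divide_simps) (simp add: algebra_simps)
    finally show ?thesis by (simp only: f2)
  qed
  finally show ?thesis .
qed

text \<open>Integrating the pointwise lower bound gives
  \<open>c * F powr - \<theta> * F \<le> e\<close> for the integral \<open>F\<close> to be
  estimated, and solving for \<open>F\<close> produces the exponent
  \<open>1 / (1 - \<theta>) = m / p\<close>. This manipulation requires \<open>F\<close> to be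
  finite, an assumption that \<open>sobolev\<close> replaces by integrability of the p-th
  power.\<close>

lemma sobolev_finite:
  fixes f :: "'n::finite heis \<Rightarrow> real" and p \<sigma> :: real
  defines "Q \<equiv> hdimQ TYPE('n)"
  defines "m \<equiv> Q * p / (Q - \<sigma> * p)" and "\<theta> \<equiv> \<sigma> * p / Q" and "v \<equiv> hvol TYPE('n)"
  defines "c \<equiv> v / 2 * (1/2) powr p * (2 * 2 powr m / v) powr - \<theta>"
  assumes [measurable]: "f \<in> borel_measurable borel" and f0: "\<And>x. 0 \<le> f x"
    and p: "0 < p" and \<sigma>: "0 < \<sigma>" "\<sigma> * p < Q"
    and fin: "nnint (\<lambda>x. f x powr m) < \<infinity>"
    and e: "gagliardo f p (Q + \<sigma> * p) \<le> ennreal e" "0 \<le> e"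
  shows "nnint (\<lambda>x. f x powr m) \<le> ennreal ((e / c) powr (m / p))"
proof -
  have Q: "0 < Q" by (simp add: Q_def hdimQ_def)
  have v: "0 < v" by (simp add: v_def hvol_pos)
  have c: "0 < c" using v by (simp add: c_def)
  have \<theta>1: "\<theta> < 1" using \<sigma> Q by (simp add: \<theta>_def)
  have mp: "m / p = 1 / (1 - \<theta>)" using Q \<sigma> p by (simp add: m_def \<theta>_def field_simps)
  obtain F where F: "nnint (\<lambda>x. f x powr m) = ennreal F" "0 \<le> F"
    using fin by (cases "\<integral>\<^sup>+ x. ennreal (f x powr m) \<partial>lborel") auto
  have "F \<le> (e / c) powr (m / p)"
  proof (cases "F = 0")
    case False
    with F have F0: "0 < F" by simp
    have "ennreal (c * F powr - \<theta> * F) = ennreal (c * F powr - \<theta>) * nnint (\<lambda>x. f x powr m)"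
      unfolding F using c F by (subst ennreal_mult) auto
    also have "\<dots> = (\<integral>\<^sup>+ x. ennreal (c * F powr - \<theta>) * ennreal (f x powr m) \<partial>lborel)"
      by (rule nn_integral_cmult[symmetric]) simp
    also have "\<dots> \<le> gagliardo f p (Q + \<sigma> * p)"
    proof (rule nn_integral_mono)
      fix x
      show "ennreal (c * F powr - \<theta>) * ennreal (f x powr m) \<le> (\<integral>\<^sup>+ y. ennreal (\<bar>f x - f y\<bar> powr p / hdist x y powr (Q + \<sigma> * p)) \<partial>lborel)"
      proof (cases "f x = 0")
        case False
        then have fx: "0 < f x" using f0[of x] by simp
        have "ennreal (c * F powr - \<theta>) * ennreal (f x powr m) = ennreal (c * F powr - \<theta> * f x powr m)"
          using c by (subst ennreal_mult) auto
        also have "\<dots> \<le> (\<integral>\<^sup>+ y. ennreal (\<bar>f x - f y\<bar> powr p / hdist x y powr (Q + \<sigma> * p)) \<partial>lborel)"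
          using gagliardo_lower_bound[of f p \<sigma> F x] assms(6) f0 p \<sigma> F F0 fx
          unfolding c_def Q_def m_def \<theta>_def v_def by simp
        finally show ?thesis .
      qed simp
    qed
    also have "\<dots> \<le> ennreal e" by (rule e)
    finally have "c * F powr - \<theta> * F \<le> e" using e by simp
    also have "c * F powr - \<theta> * F = c * F powr (1 - \<theta>)"
      using F0 by (simp add: powr_diff powr_minus field_simps)
    finally have "F powr (1 - \<theta>) \<le> e / c" using c by (simp add: field_simps)
    then have "(F powr (1 - \<theta>)) powr (m / p) \<le> (e / c) powr (m / p)"
      using \<theta>1 by (intro powr_mono2) (auto simp: mp)
    then show ?thesis using F0 \<theta>1 by (simp add: powr_powr mp)
  qed simp
  then show ?thesis unfolding F by (rule ennreal_leI)
qed

text \<open>Truncating \<open>f\<close> at height \<open>N\<close> does not increase the Gagliardo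
  integral, and it makes the m-th power integrable, since that power is at most
  \<open>real N powr (m - p)\<close> times \<open>f x powr p\<close>. The bound of
  \<open>sobolev_finite\<close> is uniform in \<open>N\<close>, so monotone convergence removes the
  truncation.\<close>

lemma sobolev:
  fixes p \<sigma> :: real
  defines "Q \<equiv> hdimQ TYPE('n::finite)"
  defines "m \<equiv> Q * p / (Q - \<sigma> * p)"
  assumes p: "0 < p" and \<sigma>: "0 < \<sigma>" "\<sigma> * p < Q"
  obtains C where "0 < C" "\<And>(f :: 'n heis \<Rightarrow> real) e. f \<in> borel_measurable borel \<Longrightarrow> (\<And>x. 0 \<le> f x) \<Longrightarrow>
    nnint (\<lambda>x. f x powr p) < \<infinity> \<Longrightarrow> 0 \<le> e \<Longrightarrow>
    gagliardo f p (Q + \<sigma> * p) \<le> ennreal e \<Longrightarrow>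
    nnint (\<lambda>x. f x powr m) \<le> ennreal (C * e powr (m / p))"
proof
  define c where "c = hvol TYPE('n) / 2 * (1/2) powr p * (2 * 2 powr m / hvol TYPE('n)) powr - (\<sigma> * p / Q)"
  have c: "0 < c" using hvol_pos[where 'n='n] by (simp add: c_def)
  show "0 < (1 / c) powr (m / p)" using c by simp
  have Q: "0 < Q" by (simp add: Q_def hdimQ_def)
  have mp: "p \<le> m"
  proof -
    have "p * (Q - \<sigma> * p) \<le> Q * p" using p \<sigma> by (simp add: algebra_simps)
    then show ?thesis using \<sigma> by (simp add: m_def pos_le_divide_eq)
  qed
  fix f :: "'n heis \<Rightarrow> real" and e :: real
  assume [measurable]: "f \<in> borel_measurable borel" and f0: "\<And>x. 0 \<le> f x"
    and fp: "nnint (\<lambda>x. f x powr p) < \<infinity>" and e0: "0 \<le> e"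
    and e: "gagliardo f p (Q + \<sigma> * p) \<le> ennreal e"
  define g where "g N x = min (f x) (real N)" for N x
  have [measurable]: "g N \<in> borel_measurable borel" for N unfolding g_def by measurable
  have g0: "0 \<le> g N x" for N x using f0 by (simp add: g_def)
  have gN: "nnint (\<lambda>x. g N x powr m) \<le> ennreal ((e / c) powr (m / p))" for N
    unfolding c_def m_def Q_def
  proof (rule sobolev_finite[OF _ g0 p \<sigma>(1) \<sigma>(2)[unfolded Q_def] _ _ e0])
    have "nnint (\<lambda>x. g N x powr m) \<le> (\<integral>\<^sup>+ x. ennreal (real N powr (m - p)) * ennreal (f x powr p) \<partial>lborel)"
    proof (rule nn_integral_mono)
      fix x
      have "g N x powr m = g N x powr (m - p) * g N x powr p" by (simp flip: powr_add)
      also have "\<dots> \<le> real N powr (m - p) * f x powr p"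
        using mp p g0 f0 by (intro mult_mono powr_mono2) (auto simp: g_def)
      finally show "ennreal (g N x powr m) \<le> ennreal (real N powr (m - p)) * ennreal (f x powr p)"
        by (simp add: ennreal_mult[symmetric] ennreal_leI)
    qed
    also have "\<dots> = ennreal (real N powr (m - p)) * nnint (\<lambda>x. f x powr p)"
      by (rule nn_integral_cmult) simp
    also have "\<dots> < \<infinity>" using fp by (simp add: ennreal_mult_less_top)
    finally show "(\<integral>\<^sup>+ x. ennreal (g N x powr (hdimQ TYPE('n) * p / (hdimQ TYPE('n) - \<sigma> * p))) \<partial>lborel) < \<infinity>"
      by (simp add: m_def Q_def)
    have "gagliardo (g N) p (Q + \<sigma> * p)
      \<le> gagliardo f p (Q + \<sigma> * p)"
      using p by (intro nn_integral_mono ennreal_leI divide_right_mono powr_mono2) (auto simp: g_def)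
    also note e
    finally show "gagliardo (g N) p (hdimQ TYPE('n) + \<sigma> * p) \<le> ennreal e"
      by (simp add: Q_def)
  qed auto
  have "nnint (\<lambda>x. f x powr m) = (\<integral>\<^sup>+ x. (SUP N. ennreal (g N x powr m)) \<partial>lborel)"
  proof (rule nn_integral_cong)
    fix x
    obtain N where "f x \<le> real N" using real_arch_simple by blast
    then have "ennreal (f x powr m) = ennreal (g N x powr m)" by (simp add: g_def)
    also have "\<dots> \<le> (SUP N. ennreal (g N x powr m))" by (rule SUP_upper) simp
    finally have 1: "ennreal (f x powr m) \<le> (SUP N. ennreal (g N x powr m))" .
    have 2: "(SUP N. ennreal (g N x powr m)) \<le> ennreal (f x powr m)"
      using p mp g0 by (intro SUP_least ennreal_leI powr_mono2) (auto simp: g_def)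
    show "ennreal (f x powr m) = (SUP N. ennreal (g N x powr m))" using 1 2 by (rule antisym)
  qed
  also have "\<dots> = (SUP N. \<integral>\<^sup>+ x. ennreal (g N x powr m) \<partial>lborel)"
    using p mp g0 by (intro nn_integral_monotone_convergence_SUP)
      (auto simp: incseq_def le_fun_def g_def intro!: ennreal_leI powr_mono2 f0)
  also have "\<dots> \<le> ennreal ((e / c) powr (m / p))" by (intro SUP_least gN)
  also have "(e / c) powr (m / p) = (1 / c) powr (m / p) * e powr (m / p)"
    using c e0 by (simp add: powr_mult[symmetric])
  finally show "nnint (\<lambda>x. f x powr m) \<le> ennreal ((1 / c) powr (m / p) * e powr (m / p))" .
qed

section \<open>Truncation inequalities\<close>

lemma Jpow_nonneg_eq: "0 \<le> \<tau> \<Longrightarrow> Jpow l \<tau> = \<tau> powr (l - 1)"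
proof (cases "\<tau> = 0")
  case False
  assume "0 \<le> \<tau>"
  with False have "\<tau> powr (l - 1) = \<tau> powr (l - 2) * \<tau> powr 1" by (subst powr_add[symmetric]) simp
  then show ?thesis using \<open>0 \<le> \<tau>\<close> by (simp add: Jpow_def)
qed (simp add: Jpow_def)

lemma Jpow_minus: "Jpow l (- \<tau>) = - Jpow l \<tau>"
  by (simp add: Jpow_def)

lemma Jpow_diff_swap: "Jpow l (U - V) * (A - B) = Jpow l (V - U) * (B - A)"
  using Jpow_minus[of l "U - V"] by (simp add: algebra_simps)

lemma abs_Jpow: "\<bar>Jpow l \<tau>\<bar> = \<bar>\<tau>\<bar> powr (l - 1)"
proof (cases "0 \<le> \<tau>")
  case True
  then show ?thesis by (simp add: Jpow_nonneg_eq)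
next
  case False
  then have "Jpow l \<tau> = - (\<bar>\<tau>\<bar> powr (l - 1))"
    using Jpow_nonneg_eq[of "- \<tau>" l] Jpow_minus[of l \<tau>] by simp
  then show ?thesis by simp
qed

lemma powr_minus_one_mult: "0 \<le> (x::real) \<Longrightarrow> x powr (l - 1) * x = x powr l"
  by (cases "x = 0") (simp_all add: powr_diff)

text \<open>A crude form of Young's inequality: both factors are estimated by the larger of the two
  absolute values.\<close>

lemma abs_Jpow_mult_le:
  assumes "1 \<le> l"
  shows "\<bar>Jpow l a * b\<bar> \<le> \<bar>a\<bar> powr l + \<bar>b\<bar> powr l"
proof -
  let ?m = "max \<bar>a\<bar> \<bar>b\<bar>"
  have "\<bar>Jpow l a * b\<bar> = \<bar>a\<bar> powr (l - 1) * \<bar>b\<bar>" by (simp add: abs_mult abs_Jpow)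
  also have "\<dots> \<le> ?m powr (l - 1) * ?m" using assms by (intro mult_mono powr_mono2) auto
  also have "\<dots> = ?m powr l" by (intro powr_minus_one_mult) auto
  also have "\<dots> \<le> \<bar>a\<bar> powr l + \<bar>b\<bar> powr l" by (simp add: max_def)
  finally show ?thesis .
qed

lemma powr_add_le:
  assumes "0 \<le> x" "0 \<le> y" "0 \<le> (p::real)"
  shows "(x + y) powr p \<le> 2 powr p * (x powr p + y powr p)"
proof -
  have "(x + y) powr p \<le> (2 * max x y) powr p" using assms by (intro powr_mono2) auto
  also have "\<dots> = 2 powr p * max x y powr p" using assms by (simp add: powr_mult)
  also have "\<dots> \<le> 2 powr p * (x powr p + y powr p)"
    by (intro mult_left_mono) (auto simp: max_def)
  finally show ?thesis .
qed

text \<open>Mean value theorem. The endpoint 0 is split off because the derivative of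
  \<open>powr\<close> is taken at positive base.\<close>

lemma powr_diff_le:
  assumes "0 \<le> a" "a \<le> b" "1 \<le> (q::real)"
  shows "b powr q - a powr q \<le> q * b powr (q - 1) * (b - a)"
proof (cases "a = 0 \<or> a = b")
  case True
  then show ?thesis
  proof
    assume "a = 0"
    moreover have "b powr (q - 1) * b = b powr q" using assms by (intro powr_minus_one_mult) auto
    moreover have "1 * b powr q \<le> q * b powr q" using assms by (intro mult_right_mono) auto
    ultimately show ?thesis by (simp add: mult.assoc)
  qed simp
next
  case False
  with assms have ab: "0 < a" "a < b" by auto
  have "\<And>z. a \<le> z \<Longrightarrow> z \<le> b \<Longrightarrow> DERIV (\<lambda>z. z powr q) z :> q * z powr (q - 1)"
    using ab by (auto intro!: derivative_eq_intros simp: powr_diff)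
  then obtain z where z: "a < z" "z < b" "b powr q - a powr q = (b - a) * (q * z powr (q - 1))"
    using MVT2[OF ab(2), of "\<lambda>z. z powr q" "\<lambda>z. q * z powr (q - 1)"] by blast
  have "(b - a) * (q * z powr (q - 1)) \<le> (b - a) * (q * b powr (q - 1))"
    using z ab assms by (intro mult_left_mono powr_mono2) auto
  with z show ?thesis by (simp add: mult_ac)
qed

definition pos_above :: "real \<Rightarrow> real \<Rightarrow> real" where
  "pos_above k z = max (z - k) 0"

lemma pos_above_nonneg [simp]: "0 \<le> pos_above k z" by (simp add: pos_above_def)

lemma pos_above_mono: "z \<le> z' \<Longrightarrow> pos_above k z \<le> pos_above k z'" by (simp add: pos_above_def)

context
  fixes q k U V a b :: real
  assumes q: "1 \<le> q" and ab: "0 \<le> a" "a \<le> 1" "0 \<le> b" "b \<le> 1"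
begin

text \<open>\<open>U\<close>, \<open>V\<close> stand for the solution and \<open>a\<close>,
  \<open>b\<close> for the cutoff at two points. If the larger cutoff value sits at
  \<open>U\<close>, replacing both values by \<open>M\<close> drops a nonnegative term; if it sits
  at \<open>V\<close>, the loss is \<open>W\<close> times \<open>b powr q - a powr q\<close>, which
  \<open>powr_diff_le\<close> controls. The first bound keeps \<open>M powr (q - 1)\<close>, on
  which the later absorption depends.\<close>

lemma cutoff_diff_lower:
  assumes UV: "V \<le> U"
  defines "A \<equiv> pos_above k U - pos_above k V" and "W \<equiv> pos_above k U" and "M \<equiv> max a b" and "D \<equiv> \<bar>a - b\<bar>"
  shows "A * M powr q - q * M powr (q - 1) * W * D \<le> pos_above k U * a powr q - pos_above k V * b powr q"
    and "\<bar>pos_above k U * a powr q - pos_above k V * b powr q\<bar> \<le> A * M powr q + q * W * D"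
proof -
  have V: "pos_above k V \<le> W" unfolding W_def by (rule pos_above_mono[OF UV])
  have A: "0 \<le> A" using V by (simp add: A_def W_def)
  have W: "0 \<le> W" by (simp add: W_def)
  have M1: "M powr (q - 1) \<le> 1" using ab q by (intro powr_le1) (auto simp: M_def)
  have T: "q * M powr (q - 1) * W * D \<le> q * W * D"
    using mult_left_mono[OF M1, of "q * W * D"] q W by (simp add: D_def mult_ac)
  have T0: "0 \<le> q * M powr (q - 1) * W * D" using q W by (simp add: D_def)
  have eq: "A * M powr q = pos_above k U * M powr q - pos_above k V * M powr q"
    by (simp add: A_def left_diff_distrib)
  have AM: "0 \<le> A * M powr q" using A by simp
  consider "b \<le> a" | "a < b" by linarith
  then have "A * M powr q - q * M powr (q - 1) * W * D \<le> pos_above k U * a powr q - pos_above k V * b powr q \<and>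
    \<bar>pos_above k U * a powr q - pos_above k V * b powr q\<bar> \<le> A * M powr q + q * M powr (q - 1) * W * D"
  proof cases
    case 1
    then have M: "M = a" "D = a - b" by (auto simp: M_def D_def)
    have 2: "a powr q - b powr q \<le> q * a powr (q - 1) * (a - b)" using powr_diff_le[of b a q] ab q 1 by simp
    have 3: "b powr q \<le> a powr q" using ab 1 q by (intro powr_mono2) auto
    have "pos_above k V * (a powr q - b powr q) \<le> W * (q * a powr (q - 1) * (a - b))"
      using V 2 3 W by (intro mult_mono) auto
    moreover have "0 \<le> pos_above k V * (a powr q - b powr q)" using 3 by simp
    moreover have "pos_above k U * a powr q - pos_above k V * b powr q = A * M powr q + pos_above k V * (a powr q - b powr q)"
      using eq unfolding M by (simp add: algebra_simps)
    ultimately show ?thesis using AM T0 unfolding M by (simp add: mult_ac)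
  next
    case 2
    then have M: "M = b" "D = b - a" by (auto simp: M_def D_def)
    have 3: "b powr q - a powr q \<le> q * b powr (q - 1) * (b - a)" using powr_diff_le[of a b q] ab q 2 by simp
    have 4: "a powr q \<le> b powr q" using ab 2 q by (intro powr_mono2) auto
    have "W * (b powr q - a powr q) \<le> W * (q * b powr (q - 1) * (b - a))"
      using W 3 by (intro mult_left_mono) auto
    moreover have "0 \<le> W * (b powr q - a powr q)" using 4 W by simp
    moreover have "pos_above k U * a powr q - pos_above k V * b powr q = A * M powr q - W * (b powr q - a powr q)"
      using eq unfolding M by (simp add: algebra_simps W_def)
    ultimately show ?thesis using AM T0 unfolding M by (simp add: mult_ac)
  qed
  then show "A * M powr q - q * M powr (q - 1) * W * D \<le> pos_above k U * a powr q - pos_above k V * b powr q"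
    and "\<bar>pos_above k U * a powr q - pos_above k V * b powr q\<bar> \<le> A * M powr q + q * W * D"
    using T by auto
qed

text \<open>For \<open>V\<close> above \<open>k\<close> the truncated and the full difference agree.
  For \<open>V\<close> at most \<open>k\<close> and \<open>U\<close> above it, the truncated
  difference is smaller and the test function difference is nonnegative, its value at
  \<open>V\<close> being 0. Otherwise both sides vanish.\<close>

lemma Jpow_cutoff_ge:
  assumes UV: "V \<le> U" and l: "1 < l"
  shows "(pos_above k U - pos_above k V) powr (l - 1) * (pos_above k U * a powr q - pos_above k V * b powr q)
    \<le> Jpow l (U - V) * (pos_above k U * a powr q - pos_above k V * b powr q)"
proof (cases "k < V")
  case True
  with UV have "pos_above k U - pos_above k V = U - V" by (simp add: pos_above_def)
  then show ?thesis using UV by (simp add: Jpow_nonneg_eq)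
next
  case False
  then have V: "pos_above k V = 0" by (simp add: pos_above_def)
  show ?thesis
  proof (cases "k < U")
    case True
    with False UV have "pos_above k U powr (l - 1) \<le> (U - V) powr (l - 1)"
      using l by (intro powr_mono2) (auto simp: pos_above_def)
    then show ?thesis using V UV by (simp add: Jpow_nonneg_eq mult_right_mono)
  next
    case False
    then show ?thesis using V by (simp add: pos_above_def)
  qed
qed

text \<open>Coercivity near the diagonal: half of the main term survives, and the cutoff error is
  paid separately. The cutoff always carries the power \<open>q\<close>, whatever \<open>l\<close>,
  which the hypothesis \<open>l \<le> q\<close> makes possible.\<close>

lemma Jpow_cutoff_near_ordered:
  assumes UV: "V \<le> U" and l: "1 < l" "l \<le> q"
  defines "A \<equiv> pos_above k U - pos_above k V" and "W \<equiv> pos_above k U" and "M \<equiv> max a b" and "D \<equiv> \<bar>a - b\<bar>"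
  shows "A powr l * M powr q / 2 \<le> Jpow l (U - V) * (pos_above k U * a powr q - pos_above k V * b powr q) + (2 * q * W * D) powr l"
proof -
  let ?G = "Jpow l (U - V) * (pos_above k U * a powr q - pos_above k V * b powr q)"
  have A: "0 \<le> A" using pos_above_mono[OF UV, of k] by (simp add: A_def)
  have W: "0 \<le> W" by (simp add: W_def)
  have M: "0 \<le> M" "M \<le> 1" using ab by (auto simp: M_def)
  have D: "0 \<le> D" by (simp add: D_def)
  have qWD: "0 \<le> q * W * D" using q W D by simp
  have "A powr (l - 1) * (A * M powr q - q * M powr (q - 1) * W * D) \<le> A powr (l - 1) * (pos_above k U * a powr q - pos_above k V * b powr q)"
    unfolding A_def W_def M_def D_def by (intro mult_left_mono cutoff_diff_lower(1)[OF UV]) auto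
  also have "\<dots> \<le> ?G" unfolding A_def by (rule Jpow_cutoff_ge[OF UV l(1)])
  finally have G: "A powr (l - 1) * (A * M powr q) - A powr (l - 1) * (q * M powr (q - 1) * W * D) \<le> ?G"
    by (simp add: right_diff_distrib)
  have AA: "A powr (l - 1) * (A * M powr q) = A powr l * M powr q"
    using powr_minus_one_mult[OF A, of l] by (simp add: mult.assoc[symmetric])
  have nn: "0 \<le> A powr l * M powr q" "0 \<le> (2 * q * W * D) powr l" by auto
  \<comment> \<open>In place of Young's inequality, compare the two factors directly.\<close>
  show ?thesis
  proof (cases "q * W * D \<le> A * M / 2")
    case True
    have "A powr (l - 1) * (q * M powr (q - 1) * W * D) = A powr (l - 1) * M powr (q - 1) * (q * W * D)" by simp
    also have "\<dots> \<le> A powr (l - 1) * M powr (q - 1) * (A * M / 2)" using True by (intro mult_left_mono) auto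
    also have "\<dots> = (A powr (l - 1) * A) * (M powr (q - 1) * M) / 2" by simp
    also have "\<dots> = A powr l * M powr q / 2" by (simp only: powr_minus_one_mult A M)
    finally show ?thesis using G AA nn by linarith
  next
    case False
    have "A powr (l - 1) * (q * M powr (q - 1) * W * D) = A powr (l - 1) * M powr (q - 1) * (q * W * D)" by simp
    \<comment> \<open>As \<open>M \<le> 1\<close> and \<open>l \<le> q\<close>, the exponent of
      \<open>M\<close> may be lowered. Then \<open>A\<close> and \<open>M\<close> combine into a
      product, which in this case is below \<open>2 * q * W * D\<close>.\<close>
    also have "\<dots> \<le> A powr (l - 1) * M powr (l - 1) * (q * W * D)"
      using M l qWD by (intro mult_right_mono mult_left_mono powr_mono') auto
    also have "\<dots> = (A * M) powr (l - 1) * (q * W * D)" using A M by (simp add: powr_mult)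
    also have "\<dots> \<le> (2 * q * W * D) powr (l - 1) * (2 * q * W * D)"
    proof -
      have "N powr (l - 1) * E \<le> (2 * E) powr (l - 1) * (2 * E)" if "0 \<le> E" "\<not> E \<le> N / 2" "0 \<le> N" for E N
        using that l by (intro mult_mono powr_mono2) auto
      from this[OF qWD False mult_nonneg_nonneg[OF A M(1)]] show ?thesis by (simp only: mult.assoc)
    qed
    also have "\<dots> = (2 * q * W * D) powr l" using q W D by (intro powr_minus_one_mult) simp
    finally show ?thesis using G AA nn by linarith
  qed
qed

text \<open>The point is that only \<open>M powr q\<close> appears, although the test function
  difference is raised to the power \<open>l\<close>: this matches the coercive term of
  \<open>Jpow_cutoff_near_ordered\<close>. It works because \<open>M powr q\<close> is at most 1 and
  \<open>l\<close> exceeds 1.\<close>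

lemma cutoff_diff_powr_ordered:
  assumes UV: "V \<le> U" and l: "1 < l"
  defines "A \<equiv> pos_above k U - pos_above k V" and "W \<equiv> pos_above k U" and "M \<equiv> max a b" and "D \<equiv> \<bar>a - b\<bar>"
  shows "\<bar>pos_above k U * a powr q - pos_above k V * b powr q\<bar> powr l \<le> 2 powr l * (A powr l * M powr q + (q * W * D) powr l)"
proof -
  have A: "0 \<le> A" using pos_above_mono[OF UV, of k] by (simp add: A_def)
  have W: "0 \<le> W" by (simp add: W_def)
  have M: "0 \<le> M" "M \<le> 1" using ab by (auto simp: M_def)
  have qWD: "0 \<le> q * W * D" using q W by (simp add: D_def)
  have "\<bar>pos_above k U * a powr q - pos_above k V * b powr q\<bar> powr l \<le> (A * M powr q + q * W * D) powr l"
    using cutoff_diff_lower(2)[OF UV] l unfolding A_def W_def M_def D_def by (intro powr_mono2) auto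
  also have "\<dots> \<le> 2 powr l * ((A * M powr q) powr l + (q * W * D) powr l)"
    using A M qWD l by (intro powr_add_le) auto
  also have "(A * M powr q) powr l = A powr l * (M powr q) powr l" using A by (simp add: powr_mult)
  also have "\<dots> \<le> A powr l * M powr q"
  proof (intro mult_left_mono)
    have "M powr q \<le> 1" using M q by (intro powr_le1) auto
    then have "(M powr q) powr l \<le> (M powr q) powr 1" using l by (intro powr_mono') auto
    then show "(M powr q) powr l \<le> M powr q" by simp
  qed auto
  finally show ?thesis by simp
qed

text \<open>A negative contribution can come only from the test function at the lower point, and
  only if \<open>V\<close> exceeds \<open>k\<close>; in that case \<open>U - V\<close> is at most
  the excess of \<open>U\<close>.\<close>

lemma Jpow_cutoff_far_ordered:
  assumes UV: "V \<le> U" and l: "1 < l"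
  shows "- (pos_above k U powr (l - 1) * (pos_above k V * b powr q))
    \<le> Jpow l (U - V) * (pos_above k U * a powr q - pos_above k V * b powr q)"
proof (cases "k < V")
  case True
  have "(U - V) powr (l - 1) * (pos_above k V * b powr q) \<le> pos_above k U powr (l - 1) * (pos_above k V * b powr q)"
    using True UV l by (intro mult_right_mono powr_mono2) (auto simp: pos_above_def)
  moreover have "0 \<le> (U - V) powr (l - 1) * (pos_above k U * a powr q)" by simp
  moreover have J: "Jpow l (U - V) = (U - V) powr (l - 1)" using UV by (simp add: Jpow_nonneg_eq)
  ultimately show ?thesis unfolding J right_diff_distrib by linarith
next
  case False
  then have "pos_above k V = 0" by (simp add: pos_above_def)
  then show ?thesis using UV by (simp add: Jpow_nonneg_eq)
qed

end

text \<open>The three bounds have separate uses: the first discards the q-phase up to an error, the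
  second controls the p-energy of the test function by the form, and the third shows that the test
  function has finite energy. The unordered case follows from the ordered one by exchanging the two
  points.\<close>

lemma Jpow_cutoff_near:
  fixes q k U V a b :: real
  assumes q: "1 \<le> q" and ab: "0 \<le> a" "a \<le> 1" "0 \<le> b" "b \<le> 1" and l: "1 < l" "l \<le> q"
  defines "W \<equiv> max (pos_above k U) (pos_above k V)"
  defines "\<Phi> \<equiv> pos_above k U * a powr q - pos_above k V * b powr q"
  shows "0 \<le> Jpow l (U - V) * \<Phi> + (2 * q * W * \<bar>a - b\<bar>) powr l"
    and "\<bar>\<Phi>\<bar> powr l \<le> 2 * 2 powr l * (Jpow l (U - V) * \<Phi>) + 3 * 2 powr l * (2 * q * W * \<bar>a - b\<bar>) powr l"
    and "\<bar>\<Phi>\<bar> powr l \<le> 2 powr l * (\<bar>U - V\<bar> powr l + (2 * q * W * \<bar>a - b\<bar>) powr l)"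
proof -
  have main: "0 \<le> Jpow l (U - V) * (pos_above k U * a powr q - pos_above k V * b powr q) + (2 * q * max (pos_above k U) (pos_above k V) * \<bar>a - b\<bar>) powr l \<and>
     \<bar>pos_above k U * a powr q - pos_above k V * b powr q\<bar> powr l \<le> 2 * 2 powr l * (Jpow l (U - V) * (pos_above k U * a powr q - pos_above k V * b powr q)) + 3 * 2 powr l * (2 * q * max (pos_above k U) (pos_above k V) * \<bar>a - b\<bar>) powr l \<and>
     \<bar>pos_above k U * a powr q - pos_above k V * b powr q\<bar> powr l \<le> 2 powr l * (\<bar>U - V\<bar> powr l + (2 * q * max (pos_above k U) (pos_above k V) * \<bar>a - b\<bar>) powr l)"
    if UV: "V \<le> U" and ab: "0 \<le> a" "a \<le> 1" "0 \<le> b" "b \<le> 1" for U V a b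
  proof -
    define A where "A = pos_above k U - pos_above k V"
    define M where "M = max a b"
    define X where "X = (2 * q * pos_above k U * \<bar>a - b\<bar>) powr l"
    define G where "G = Jpow l (U - V) * (pos_above k U * a powr q - pos_above k V * b powr q)"
    have W: "max (pos_above k U) (pos_above k V) = pos_above k U" using pos_above_mono[OF UV, of k] by simp
    have 1: "A powr l * M powr q / 2 \<le> G + X"
      using Jpow_cutoff_near_ordered[OF q ab UV l, of k] by (simp add: A_def M_def X_def G_def)
    have 2: "\<bar>pos_above k U * a powr q - pos_above k V * b powr q\<bar> powr l \<le> 2 powr l * (A powr l * M powr q + (q * pos_above k U * \<bar>a - b\<bar>) powr l)"
      using cutoff_diff_powr_ordered[OF q ab UV l(1), of k] by (simp add: A_def M_def)
    have 3: "(q * pos_above k U * \<bar>a - b\<bar>) powr l \<le> X"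
    proof -
      have "0 \<le> q * pos_above k U * \<bar>a - b\<bar>" using q by simp
      then show ?thesis unfolding X_def using q l by (intro powr_mono2) auto
    qed
    have 4: "0 \<le> A powr l * M powr q" by simp
    have 5: "A powr l * M powr q \<le> \<bar>U - V\<bar> powr l * 1"
      using UV l q ab by (intro mult_mono powr_mono2 powr_le1) (auto simp: A_def M_def pos_above_def)
    have "2 powr l * (A powr l * M powr q + (q * pos_above k U * \<bar>a - b\<bar>) powr l) \<le> 2 powr l * (2 * G + 3 * X)"
      using 1 3 by (intro mult_left_mono) auto
    moreover have "2 powr l * (A powr l * M powr q + (q * pos_above k U * \<bar>a - b\<bar>) powr l) \<le> 2 powr l * (\<bar>U - V\<bar> powr l + X)"
      using 5 3 by (intro mult_left_mono) auto
    moreover have "2 powr l * (2 * G + 3 * X) = 2 * 2 powr l * G + 3 * 2 powr l * X" by (simp add: algebra_simps)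
    ultimately show ?thesis unfolding W X_def[symmetric] G_def[symmetric] using 1 2 4
      by (intro conjI) linarith+
  qed
  have "0 \<le> Jpow l (U - V) * \<Phi> + (2 * q * W * \<bar>a - b\<bar>) powr l \<and>
    \<bar>\<Phi>\<bar> powr l \<le> 2 * 2 powr l * (Jpow l (U - V) * \<Phi>) + 3 * 2 powr l * (2 * q * W * \<bar>a - b\<bar>) powr l \<and>
    \<bar>\<Phi>\<bar> powr l \<le> 2 powr l * (\<bar>U - V\<bar> powr l + (2 * q * W * \<bar>a - b\<bar>) powr l)"
  proof (cases "V \<le> U")
    case True
    then show ?thesis using main[OF True ab] by (simp add: W_def \<Phi>_def)
  next
    case False
    then have "U \<le> V" by simp
    then show ?thesis using main[OF _ ab(3,4,1,2), of U V]
      Jpow_diff_swap[of l V U "pos_above k V * b powr q" "pos_above k U * a powr q"]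
      by (simp add: W_def \<Phi>_def abs_minus_commute max.commute)
  qed
  then show "0 \<le> Jpow l (U - V) * \<Phi> + (2 * q * W * \<bar>a - b\<bar>) powr l"
    and "\<bar>\<Phi>\<bar> powr l \<le> 2 * 2 powr l * (Jpow l (U - V) * \<Phi>) + 3 * 2 powr l * (2 * q * W * \<bar>a - b\<bar>) powr l"
    and "\<bar>\<Phi>\<bar> powr l \<le> 2 powr l * (\<bar>U - V\<bar> powr l + (2 * q * W * \<bar>a - b\<bar>) powr l)"
    by auto
qed

text \<open>Under the integral it is not known which value is larger, so the error contains the term
  of either order.\<close>

lemma Jpow_cutoff_far:
  fixes q k U V a b :: real
  assumes q: "1 \<le> q" and ab: "0 \<le> a" "a \<le> 1" "0 \<le> b" "b \<le> 1" and l: "1 < l"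
  shows "0 \<le> Jpow l (U - V) * (pos_above k U * a powr q - pos_above k V * b powr q) +
    (pos_above k U powr (l - 1) * (pos_above k V * b powr q) + pos_above k V powr (l - 1) * (pos_above k U * a powr q))"
proof (cases "V \<le> U")
  case True
  have "0 \<le> pos_above k V powr (l - 1) * (pos_above k U * a powr q)" by simp
  with Jpow_cutoff_far_ordered[OF q ab True l, of k] show ?thesis by linarith
next
  case False
  have "0 \<le> pos_above k U powr (l - 1) * (pos_above k V * b powr q)" by simp
  with Jpow_cutoff_far_ordered[OF q ab(3,4,1,2) _ l, of U V k] False
    Jpow_diff_swap[of l V U "pos_above k V * b powr q" "pos_above k U * a powr q"]
  show ?thesis by linarith
qed

section \<open>Cutoffs and singular kernels\<close>

lemma measurable_fst_borel [measurable]: "fst \<in> borel_measurable (borel :: ('a::second_countable_topology \<times> 'b::second_countable_topology) measure)"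
  by (intro borel_measurable_continuous_onI continuous_intros)

lemma measurable_snd_borel [measurable]: "snd \<in> borel_measurable (borel :: ('a::second_countable_topology \<times> 'b::second_countable_topology) measure)"
  by (intro borel_measurable_continuous_onI continuous_intros)

lemma nn_integral_lborel_prod':
  assumes [measurable]: "f \<in> borel_measurable borel"
  shows "(\<integral>\<^sup>+ z. f z \<partial>(lborel :: ('a::euclidean_space \<times> 'b::euclidean_space) measure))
     = (\<integral>\<^sup>+ y. \<integral>\<^sup>+ x. f (x, y) \<partial>lborel \<partial>lborel)"
  by (subst lborel_prod[symmetric], subst lborel_pair.nn_integral_snd[symmetric]) (auto simp: lborel_prod)

text \<open>Translation invariance makes the inner integral of a kernel depending only on
  \<open>hdist\<close> independent of the base point, so the double integral factorises.\<close>

lemma nn_integral_kernel: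
  fixes g :: "'n::finite heis \<Rightarrow> ennreal"
  assumes [measurable]: "k \<in> borel_measurable borel" "g \<in> borel_measurable borel"
  shows "(\<integral>\<^sup>+ z. k (hdist (fst z) (snd z)) * g (fst z) \<partial>lborel) = (\<integral>\<^sup>+ \<eta>. k (hnorm (\<eta> :: 'n heis)) \<partial>lborel) * (\<integral>\<^sup>+ x. g x \<partial>lborel)"
    and "(\<integral>\<^sup>+ z. k (hdist (fst z) (snd z)) * g (snd z) \<partial>lborel) = (\<integral>\<^sup>+ \<eta>. k (hnorm (\<eta> :: 'n heis)) \<partial>lborel) * (\<integral>\<^sup>+ x. g x \<partial>lborel)"
proof -
  have "(\<integral>\<^sup>+ z. k (hdist (fst z) (snd z)) * g (fst z) \<partial>lborel) = (\<integral>\<^sup>+ x. \<integral>\<^sup>+ y. k (hdist x y) * g x \<partial>lborel \<partial>lborel)"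
    by (subst nn_integral_lborel_prod) simp_all
  also have "\<dots> = (\<integral>\<^sup>+ x. (\<integral>\<^sup>+ \<eta>. k (hnorm (\<eta> :: 'n heis)) \<partial>lborel) * g x \<partial>lborel)"
    by (intro nn_integral_cong, subst nn_integral_multc) (auto simp: nn_integral_hdist)
  finally show "(\<integral>\<^sup>+ z. k (hdist (fst z) (snd z)) * g (fst z) \<partial>lborel) = (\<integral>\<^sup>+ \<eta>. k (hnorm (\<eta> :: 'n heis)) \<partial>lborel) * (\<integral>\<^sup>+ x. g x \<partial>lborel)"
    by (simp add: nn_integral_cmult)
  have "(\<integral>\<^sup>+ z. k (hdist (fst z) (snd z)) * g (snd z) \<partial>lborel) = (\<integral>\<^sup>+ y. \<integral>\<^sup>+ x. k (hdist x y) * g y \<partial>lborel \<partial>lborel)"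
    by (subst nn_integral_lborel_prod') simp_all
  also have "\<dots> = (\<integral>\<^sup>+ x. (\<integral>\<^sup>+ \<eta>. k (hnorm (\<eta> :: 'n heis)) \<partial>lborel) * g x \<partial>lborel)"
    by (intro nn_integral_cong, subst nn_integral_multc) (auto simp: nn_integral_hdist)
  finally show "(\<integral>\<^sup>+ z. k (hdist (fst z) (snd z)) * g (snd z) \<partial>lborel) = (\<integral>\<^sup>+ \<eta>. k (hnorm (\<eta> :: 'n heis)) \<partial>lborel) * (\<integral>\<^sup>+ x. g x \<partial>lborel)"
    by (simp add: nn_integral_cmult)
qed

lemma near_kernel_bound:
  assumes "0 < e"
  obtains C where "0 < C" "(\<integral>\<^sup>+ \<eta>. ennreal (if hnorm \<eta> < 1 then hnorm \<eta> powr (e - hdimQ TYPE('n)) else 0) \<partial>(lborel :: 'n::finite heis measure)) \<le> ennreal C"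
proof -
  let ?I = "(\<integral>\<^sup>+ \<eta>. ennreal (if hnorm \<eta> < 1 then hnorm \<eta> powr (e - hdimQ TYPE('n)) else 0) \<partial>(lborel :: 'n heis measure))"
  have "?I \<le> (\<integral>\<^sup>+ \<eta>. indicator {0<..<1} (hnorm \<eta>) * ennreal (hnorm \<eta> powr (e - hdimQ TYPE('n))) \<partial>(lborel :: 'n::finite heis measure))"
  proof (rule nn_integral_mono)
    fix \<eta> :: "'n heis"
    \<comment> \<open>At the identity \<open>0 powr x = 0\<close>, so including that point changes
      nothing, even for a negative exponent.\<close>
    show "ennreal (if hnorm \<eta> < 1 then hnorm \<eta> powr (e - hdimQ TYPE('n)) else 0) \<le> indicator {0<..<1} (hnorm \<eta>) * ennreal (hnorm \<eta> powr (e - hdimQ TYPE('n)))"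
      by (cases "hnorm \<eta> = 0") (use hnorm_nonneg[of \<eta>] in \<open>auto simp: indicator_def less_le\<close>)
  qed
  also note nn_integral_hnorm_near[OF assms, where 'n='n]
  finally obtain r where "?I = ennreal r" "0 \<le> r" by (cases ?I) auto
  then show ?thesis using that[of "r + 1"] by (simp add: ennreal_leI)
qed

text \<open>Outside the ball of radius \<open>\<delta>\<close> the norm is at least
  \<open>\<delta> / 3\<close> times \<open>1 + hnorm \<eta>\<close>, which reduces the claim to
  \<open>nn_integral_hnorm_far\<close>. The power of \<open>\<delta>\<close> is explicit because the
  iteration lets \<open>\<delta>\<close> tend to 0.\<close>

lemma far_kernel_bound:
  assumes "0 < e"
  obtains C where "0 < C" "\<And>\<delta>. 0 < \<delta> \<Longrightarrow> \<delta> \<le> 1 \<Longrightarrow>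
    (\<integral>\<^sup>+ \<eta>. ennreal (if \<delta> \<le> hnorm \<eta> then 1 / hnorm \<eta> powr (hdimQ TYPE('n) + e) else 0) \<partial>(lborel :: 'n::finite heis measure)) \<le> ennreal (C * \<delta> powr - (hdimQ TYPE('n) + e))"
proof -
  let ?a = "hdimQ TYPE('n) + e"
  have a: "0 < ?a" using assms by (simp add: hdimQ_def)
  let ?I = "\<integral>\<^sup>+ \<eta>. ennreal (1 / (1 + hnorm \<eta>) powr ?a) \<partial>(lborel :: 'n::finite heis measure)"
  obtain r where r: "?I = ennreal r" "0 \<le> r"
    using nn_integral_hnorm_far[OF assms, where 'n='n] by (cases ?I) auto
  show ?thesis
  proof (rule that[of "3 powr ?a * (r + 1)"])
    show "0 < 3 powr ?a * (r + 1)" using r by simp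
    fix \<delta> :: real assume \<delta>: "0 < \<delta>" "\<delta> \<le> 1"
    have "(\<integral>\<^sup>+ \<eta>. ennreal (if \<delta> \<le> hnorm \<eta> then 1 / hnorm \<eta> powr ?a else 0) \<partial>(lborel :: 'n::finite heis measure))
      \<le> (\<integral>\<^sup>+ \<eta>. ennreal ((3 / \<delta>) powr ?a) * ennreal (1 / (1 + hnorm \<eta>) powr ?a) \<partial>(lborel :: 'n::finite heis measure))"
    proof (rule nn_integral_mono)
      fix \<eta> :: "'n heis"
      have "1 / hnorm \<eta> powr ?a \<le> (3 / \<delta>) powr ?a * (1 / (1 + hnorm \<eta>) powr ?a)" if "\<delta> \<le> hnorm \<eta>"
      proof -
        have "\<delta> * (1 + hnorm \<eta>) \<le> 3 * hnorm \<eta>"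
          using one_plus_hnorm_le_hdist[of "0 :: 'n heis" 0 \<delta> \<eta>] \<delta> that hdist_0_right[of \<eta>]
          by (simp add: hdist_commute[of 0 \<eta>] hnorm_def[of 0])
        then have 1: "\<delta> / 3 * (1 + hnorm \<eta>) \<le> hnorm \<eta>" by simp
        have 2: "0 < 1 + hnorm \<eta>" using hnorm_nonneg[of \<eta>] by linarith
        then have 3: "0 < \<delta> / 3 * (1 + hnorm \<eta>)" using \<delta> by simp
        have "(\<delta> / 3 * (1 + hnorm \<eta>)) powr ?a \<le> hnorm \<eta> powr ?a"
          using 1 3 a by (intro powr_mono2) auto
        then have "1 / hnorm \<eta> powr ?a \<le> 1 / (\<delta> / 3 * (1 + hnorm \<eta>)) powr ?a"
          using 3 \<delta> that by (intro divide_left_mono mult_pos_pos) auto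
        also have "\<dots> = (3 / \<delta>) powr ?a * (1 / (1 + hnorm \<eta>) powr ?a)"
          using \<delta> 2 by (simp add: powr_mult powr_divide)
        finally show ?thesis .
      qed
      then show "ennreal (if \<delta> \<le> hnorm \<eta> then 1 / hnorm \<eta> powr ?a else 0) \<le> ennreal ((3 / \<delta>) powr ?a) * ennreal (1 / (1 + hnorm \<eta>) powr ?a)"
        by (auto simp: ennreal_mult[symmetric] intro!: ennreal_leI)
    qed
    also have "\<dots> = ennreal ((3 / \<delta>) powr ?a) * ?I" by (rule nn_integral_cmult) measurable
    also have "\<dots> = ennreal ((3 / \<delta>) powr ?a * r)" using r by (simp add: ennreal_mult)
    also have "\<dots> \<le> ennreal (3 powr ?a * (r + 1) * \<delta> powr - ?a)"
    proof (rule ennreal_leI)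
      have "(3 / \<delta>) powr ?a * r = 3 powr ?a * r * \<delta> powr - ?a"
        unfolding powr_minus_divide using \<delta> by (simp add: powr_divide)
      also have "\<dots> \<le> 3 powr ?a * (r + 1) * \<delta> powr - ?a" using r by (intro mult_right_mono) auto
      finally show "(3 / \<delta>) powr ?a * r \<le> 3 powr ?a * (r + 1) * \<delta> powr - ?a" .
    qed
    finally show "(\<integral>\<^sup>+ \<eta>. ennreal (if \<delta> \<le> hnorm \<eta> then 1 / hnorm \<eta> powr ?a else 0) \<partial>(lborel :: 'n::finite heis measure)) \<le> ennreal (3 powr ?a * (r + 1) * \<delta> powr - ?a)" .
  qed
qed

text \<open>\<open>\<delta>\<close> is at once the inverse Lipschitz constant of \<open>\<psi>\<close> and the distance from its support to the
  complement of \<open>S\<close>, so that all constants depend on the cutoff through \<open>\<delta>\<close> only.\<close>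

definition is_cutoff :: "real \<Rightarrow> 'n::finite heis set \<Rightarrow> ('n heis \<Rightarrow> real) \<Rightarrow> bool" where
  "is_cutoff \<delta> S \<psi> \<longleftrightarrow> 0 < \<delta> \<and> \<delta> \<le> 1 \<and> S \<in> sets borel \<and> \<psi> \<in> borel_measurable borel \<and>
     (\<forall>x. 0 \<le> \<psi> x \<and> \<psi> x \<le> 1) \<and>
     (\<forall>x y. hdist x y < \<delta> \<longrightarrow> \<psi> x \<noteq> 0 \<longrightarrow> y \<in> S) \<and>
     (\<forall>x y. hdist x y < \<delta> \<longrightarrow> \<bar>\<psi> x - \<psi> y\<bar> \<le> hdist x y / \<delta>)"

lemma is_cutoffD:
  assumes "is_cutoff \<delta> S \<psi>"
  shows "0 < \<delta>" "\<delta> \<le> 1" "S \<in> sets borel" "\<psi> \<in> borel_measurable borel" "0 \<le> \<psi> x" "\<psi> x \<le> 1"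
    "\<psi> x \<noteq> 0 \<Longrightarrow> x \<in> S"
    "hdist x y < \<delta> \<Longrightarrow> \<psi> x \<noteq> 0 \<Longrightarrow> y \<in> S"
    "hdist x y < \<delta> \<Longrightarrow> \<psi> y \<noteq> 0 \<Longrightarrow> x \<in> S"
    "hdist x y < \<delta> \<Longrightarrow> \<bar>\<psi> x - \<psi> y\<bar> \<le> hdist x y / \<delta>"
proof -
  note d = assms[unfolded is_cutoff_def]
  show "0 < \<delta>" "\<delta> \<le> 1" "S \<in> sets borel" "\<psi> \<in> borel_measurable borel" "0 \<le> \<psi> x" "\<psi> x \<le> 1"
    "hdist x y < \<delta> \<Longrightarrow> \<psi> x \<noteq> 0 \<Longrightarrow> y \<in> S"
    "hdist x y < \<delta> \<Longrightarrow> \<bar>\<psi> x - \<psi> y\<bar> \<le> hdist x y / \<delta>"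
    using d by blast+
  show "\<psi> x \<noteq> 0 \<Longrightarrow> x \<in> S" using d hdist_self[of x] by metis
  show "hdist x y < \<delta> \<Longrightarrow> \<psi> y \<noteq> 0 \<Longrightarrow> x \<in> S" using d hdist_commute[of x y] by metis
qed

section \<open>Integral estimates for near and far pairs\<close>

definition locint :: "'n::finite heis set \<Rightarrow> real \<Rightarrow> ('n heis \<Rightarrow> real) \<Rightarrow> ennreal" where
  "locint S l w = (\<integral>\<^sup>+ x. ennreal (indicator S x * w x powr l) \<partial>lborel)"

abbreviation excess where
  "excess S l k u \<equiv> locint S l (\<lambda>x. pos_above k (u x))"

text \<open>Of the four integrands over pairs, \<open>cutoff_error\<close> and
  \<open>far_tail\<close> majorise the negative part of the form at near and far pairs, as the
  truncation inequalities show. \<open>near_diff\<close> is the Gagliardo integrand at near pairs,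
  and \<open>far_sum\<close> a majorant of it at far pairs for nonnegative \<open>f\<close>.\<close>

abbreviation cutoff_error where
  "cutoff_error \<delta> q w \<psi> l e z \<equiv> if hdist (fst z) (snd z) < \<delta>
     then (2 * q * max (w (fst z)) (w (snd z)) * \<bar>\<psi> (fst z) - \<psi> (snd z)\<bar>) powr l / hdist (fst z) (snd z) powr e else (0 :: real)"

abbreviation near_diff where
  "near_diff \<delta> f l e z \<equiv> if hdist (fst z) (snd z) < \<delta>
     then \<bar>f (fst z) - f (snd z)\<bar> powr l / hdist (fst z) (snd z) powr e else (0 :: real)"

abbreviation far_sum where
  "far_sum \<delta> f l e z \<equiv> if \<delta> \<le> hdist (fst z) (snd z)
     then (f (fst z) powr l + f (snd z) powr l) / hdist (fst z) (snd z) powr e else (0 :: real)"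

abbreviation far_tail where
  "far_tail \<delta> w f l e z \<equiv> if \<delta> \<le> hdist (fst z) (snd z)
     then (w (fst z) powr (l - 1) * f (snd z) + w (snd z) powr (l - 1) * f (fst z)) / hdist (fst z) (snd z) powr e else (0 :: real)"

text \<open>The Lipschitz bound on the cutoff gains the l-th power of the distance, which leaves a
  kernel of exponent \<open>(1 - \<tau>) * l\<close> minus the homogeneous dimension; this is
  integrable at 0 because \<open>\<tau> < 1\<close>. If the cutoff values differ at two near points,
  both points lie in \<open>S\<close>.\<close>

lemma near_error_bound:
  assumes l: "0 < l" and \<tau>: "\<tau> < 1" and q: "0 \<le> q"
  obtains C where "0 < C" "\<And>\<delta> S \<psi> (w :: 'n::finite heis \<Rightarrow> real). is_cutoff \<delta> S \<psi> \<Longrightarrow> w \<in> borel_measurable borel \<Longrightarrow> (\<And>x. 0 \<le> w x) \<Longrightarrow>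
    (\<integral>\<^sup>+ z. ennreal (cutoff_error \<delta> q w \<psi> l (hdimQ TYPE('n) + \<tau> * l) z) \<partial>(lborel :: ('n::finite heis \<times> 'n heis) measure))
     \<le> ennreal (C * \<delta> powr - l) * locint S l w"
proof -
  let ?Q = "hdimQ TYPE('n)"
  define e where "e = l - \<tau> * l"
  have e: "0 < e" using l \<tau> by (simp add: e_def)
  obtain C where C: "0 < C" "(\<integral>\<^sup>+ \<eta>. ennreal (if hnorm \<eta> < 1 then hnorm \<eta> powr (e - ?Q) else 0) \<partial>(lborel :: 'n heis measure)) \<le> ennreal C"
    using near_kernel_bound[OF e, where 'n='n] by blast
  define k where "k d = ennreal (if d < 1 then d powr (e - ?Q) else 0)" for d :: real
  have [measurable]: "k \<in> borel_measurable borel" unfolding k_def by measurable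
  show ?thesis
  proof (rule that[of "((2 * q) powr l + 1) * (2 * C)"])
    show "0 < ((2 * q) powr l + 1) * (2 * C)"
      using C by (intro mult_pos_pos add_nonneg_pos) auto
    fix \<delta> and S :: "'n heis set" and \<psi> w :: "'n heis \<Rightarrow> real"
    assume cut: "is_cutoff \<delta> S \<psi>" and [measurable]: "w \<in> borel_measurable borel" and w0: "\<And>x. 0 \<le> w x"
    note cD = is_cutoffD[OF cut]
    note [measurable] = cD(3,4)
    let ?c = "((2 * q) powr l + 1) * \<delta> powr - l"
    define g where "g x = ennreal (indicator S x * w x powr l)" for x
    have [measurable]: "g \<in> borel_measurable borel" unfolding g_def by measurable
    have "(\<integral>\<^sup>+ z. ennreal (cutoff_error \<delta> q w \<psi> l (?Q + \<tau> * l) z) \<partial>(lborel :: ('n heis \<times> 'n heis) measure))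
      \<le> (\<integral>\<^sup>+ z. ennreal ?c * (k (hdist (fst z) (snd z)) * g (fst z) + k (hdist (fst z) (snd z)) * g (snd z)) \<partial>lborel)"
    proof (rule nn_integral_mono)
      fix z :: "'n heis \<times> 'n heis"
      obtain x y where z: "z = (x, y)" by (cases z)
      show "ennreal (cutoff_error \<delta> q w \<psi> l (?Q + \<tau> * l) z) \<le> ennreal ?c * (k (hdist (fst z) (snd z)) * g (fst z) + k (hdist (fst z) (snd z)) * g (snd z))"
      proof (cases "hdist x y < \<delta> \<and> \<psi> x \<noteq> \<psi> y")
        case True
        then have xy: "x \<noteq> y" "x \<in> S" "y \<in> S" using cD(7)[of x] cD(7)[of y] cD(8,9)[of x y]
          by (auto, (cases "\<psi> x = 0"; simp)+)
        have d: "0 < hdist x y" "hdist x y < 1" using xy True cD(2) by (auto simp: less_le)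
        let ?W = "max (w x) (w y)"
        have W: "0 \<le> ?W" using w0[of x] by simp
        have "(2 * q * ?W * \<bar>\<psi> x - \<psi> y\<bar>) powr l / hdist x y powr (?Q + \<tau> * l) \<le> (2 * q * ?W * (hdist x y / \<delta>)) powr l / hdist x y powr (?Q + \<tau> * l)"
          using True cD(10)[of x y] q W l by (intro divide_right_mono powr_mono2 mult_left_mono) auto
        also have "\<dots> = (2 * q) powr l * \<delta> powr - l * ?W powr l * hdist x y powr (e - ?Q)"
          using q W d cD(1) by (simp add: powr_mult powr_divide e_def powr_diff powr_add powr_minus_divide)
        also have "\<dots> \<le> ((2 * q) powr l + 1) * \<delta> powr - l * (w x powr l + w y powr l) * hdist x y powr (e - ?Q)"
          by (intro mult_right_mono mult_mono) (auto simp: max_def)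
        also have "\<dots> = ?c * (hdist x y powr (e - ?Q) * w x powr l + hdist x y powr (e - ?Q) * w y powr l)"
          by (simp add: algebra_simps)
        finally show ?thesis using True d xy w0
          by (simp add: z k_def g_def ennreal_mult[symmetric] ennreal_plus[symmetric] ennreal_leI del: ennreal_plus)
      qed (auto simp: z)
    qed
    also have "\<dots> = ennreal ?c * ((\<integral>\<^sup>+ z. k (hdist (fst z) (snd z)) * g (fst z) \<partial>lborel) + (\<integral>\<^sup>+ z. k (hdist (fst z) (snd z)) * g (snd z) \<partial>lborel))"
      by (simp add: nn_integral_cmult nn_integral_add)
    also have "\<dots> = ennreal ?c * (2 * ((\<integral>\<^sup>+ \<eta>. k (hnorm (\<eta> :: 'n heis)) \<partial>lborel) * (\<integral>\<^sup>+ x. g x \<partial>lborel)))"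
      unfolding nn_integral_kernel[OF \<open>k \<in> _\<close> \<open>g \<in> _\<close>] mult_2 ..
    also have "\<dots> \<le> ennreal ?c * (2 * (ennreal C * locint S l w))"
      using C(2) by (intro mult_left_mono mult_mono) (auto simp: k_def g_def locint_def)
    also have "\<dots> = ennreal (((2 * q) powr l + 1) * (2 * C) * \<delta> powr - l) * locint S l w"
    proof -
      have "ennreal (((2 * q) powr l + 1) * (2 * C) * \<delta> powr - l) = ennreal (?c * (2 * C))" by (simp add: mult_ac)
      also have "\<dots> = ennreal ?c * (2 * ennreal C)" using C(1) by (simp add: ennreal_mult)
      finally show ?thesis by (simp add: mult.assoc)
    qed
    finally show "(\<integral>\<^sup>+ z. ennreal (cutoff_error \<delta> q w \<psi> l (?Q + \<tau> * l) z) \<partial>(lborel :: ('n heis \<times> 'n heis) measure))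
      \<le> ennreal (((2 * q) powr l + 1) * (2 * C) * \<delta> powr - l) * locint S l w" .
  qed
qed

lemma far_power_bound:
  assumes e: "0 < e"
  obtains C where "0 < C" "\<And>\<delta> (f :: 'n::finite heis \<Rightarrow> real). 0 < \<delta> \<Longrightarrow> \<delta> \<le> 1 \<Longrightarrow> f \<in> borel_measurable borel \<Longrightarrow> (\<And>x. 0 \<le> f x) \<Longrightarrow>
    nnint (far_sum \<delta> f l (hdimQ TYPE('n) + e))
     \<le> ennreal (C * \<delta> powr - (hdimQ TYPE('n) + e)) * nnint (\<lambda>x. f x powr l)"
proof -
  let ?Q = "hdimQ TYPE('n)"
  obtain C where C: "0 < C" "\<And>\<delta>. 0 < \<delta> \<Longrightarrow> \<delta> \<le> 1 \<Longrightarrow>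
    (\<integral>\<^sup>+ \<eta>. ennreal (if \<delta> \<le> hnorm \<eta> then 1 / hnorm \<eta> powr (?Q + e) else 0) \<partial>(lborel :: 'n heis measure)) \<le> ennreal (C * \<delta> powr - (?Q + e))"
    using far_kernel_bound[OF e, where 'n='n] by blast
  show ?thesis
  proof (rule that[of "2 * C"])
    show "0 < 2 * C" using C by simp
    fix \<delta> :: real and f :: "'n heis \<Rightarrow> real"
    assume \<delta>: "0 < \<delta>" "\<delta> \<le> 1" and [measurable]: "f \<in> borel_measurable borel" and f0: "\<And>x. 0 \<le> f x"
    define k where "k d = ennreal (if \<delta> \<le> d then 1 / d powr (?Q + e) else 0)" for d :: real
    have [measurable]: "k \<in> borel_measurable borel" unfolding k_def by measurable
    define g where "g x = ennreal (f x powr l)" for x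
    have [measurable]: "g \<in> borel_measurable borel" unfolding g_def by measurable
    have "nnint (far_sum \<delta> f l (?Q + e))
      = (\<integral>\<^sup>+ z. k (hdist (fst z) (snd z)) * g (fst z) + k (hdist (fst z) (snd z)) * g (snd z) \<partial>lborel)"
      by (intro nn_integral_cong)
        (simp add: k_def g_def ennreal_mult[symmetric] ennreal_plus[symmetric] add_divide_distrib del: ennreal_plus)
    also have "\<dots> = (\<integral>\<^sup>+ z. k (hdist (fst z) (snd z)) * g (fst z) \<partial>lborel) + (\<integral>\<^sup>+ z. k (hdist (fst z) (snd z)) * g (snd z) \<partial>lborel)"
      by (rule nn_integral_add) measurable
    also have "\<dots> = 2 * ((\<integral>\<^sup>+ \<eta>. k (hnorm (\<eta> :: 'n heis)) \<partial>lborel) * (\<integral>\<^sup>+ x. g x \<partial>lborel))"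
      unfolding nn_integral_kernel[OF \<open>k \<in> _\<close> \<open>g \<in> _\<close>] mult_2 ..
    also have "\<dots> \<le> 2 * (ennreal (C * \<delta> powr - (?Q + e)) * (\<integral>\<^sup>+ x. g x \<partial>lborel))"
      using C(2)[OF \<delta>] by (intro mult_left_mono mult_right_mono) (auto simp: k_def)
    also have "\<dots> = ennreal (2 * C * \<delta> powr - (?Q + e)) * (\<integral>\<^sup>+ x. g x \<partial>lborel)"
      using C(1) by (simp add: ennreal_mult mult.assoc)
    finally show "nnint (far_sum \<delta> f l (?Q + e))
      \<le> ennreal (2 * C * \<delta> powr - (?Q + e)) * nnint (\<lambda>x. f x powr l)" by (simp add: g_def)
  qed
qed

lemma abs_diff_powr_le:
  fixes x y p :: real
  assumes "0 \<le> x" "0 \<le> y" "0 \<le> p" shows "\<bar>x - y\<bar> powr p \<le> x powr p + y powr p"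
proof -
  have "\<bar>x - y\<bar> powr p \<le> max x y powr p" using assms by (intro powr_mono2) auto
  also have "\<dots> \<le> x powr p + y powr p" by (simp add: max_def)
  finally show ?thesis .
qed

lemma nn_integral_lborel_mult:
  assumes [measurable]: "f \<in> borel_measurable borel" "g \<in> borel_measurable borel"
  shows "(\<integral>\<^sup>+ z. f (fst z) * g (snd z) \<partial>(lborel :: ('a::euclidean_space \<times> 'b::euclidean_space) measure)) = (\<integral>\<^sup>+ x. f x \<partial>lborel) * (\<integral>\<^sup>+ y. g y \<partial>lborel)"
proof -
  have "(\<integral>\<^sup>+ z. f (fst z) * g (snd z) \<partial>(lborel :: ('a \<times> 'b) measure)) = (\<integral>\<^sup>+ x. \<integral>\<^sup>+ y. f x * g y \<partial>lborel \<partial>lborel)"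
    by (subst nn_integral_lborel_prod) simp_all
  also have "\<dots> = (\<integral>\<^sup>+ x. f x * (\<integral>\<^sup>+ y. g y \<partial>lborel) \<partial>lborel)"
    by (intro nn_integral_cong nn_integral_cmult) measurable
  also have "\<dots> = (\<integral>\<^sup>+ x. f x \<partial>lborel) * (\<integral>\<^sup>+ y. g y \<partial>lborel)"
    by (rule nn_integral_multc) measurable
  finally show ?thesis .
qed

text \<open>Far pairs require no cancellation: the difference is bounded by the sum of the two
  powers, and the kernel is integrable away from the diagonal. Near pairs have distance below 1, so
  raising the order from \<open>\<sigma>\<close> to \<open>s\<close> only enlarges the
  integrand.\<close>

lemma sobolev_near:
  fixes p \<sigma> s :: real
  defines "Q \<equiv> hdimQ TYPE('n::finite)"
  defines "m \<equiv> Q * p / (Q - \<sigma> * p)"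
  assumes p: "0 < p" and \<sigma>: "0 < \<sigma>" "\<sigma> * p < Q" "\<sigma> \<le> s"
  obtains C where "0 < C" "\<And>(f :: 'n heis \<Rightarrow> real) \<delta> X Y. 0 < \<delta> \<Longrightarrow> \<delta> \<le> 1 \<Longrightarrow> f \<in> borel_measurable borel \<Longrightarrow> (\<And>x. 0 \<le> f x) \<Longrightarrow>
    0 \<le> X \<Longrightarrow> 0 \<le> Y \<Longrightarrow>
    nnint (near_diff \<delta> f p (Q + s * p)) \<le> ennreal X \<Longrightarrow>
    nnint (\<lambda>x. f x powr p) \<le> ennreal Y \<Longrightarrow>
    nnint (\<lambda>x. f x powr m) \<le> ennreal (C * (X + \<delta> powr - (Q + \<sigma> * p) * Y) powr (m / p))"
proof -
  have Q: "0 < Q" by (simp add: Q_def hdimQ_def)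
  have m: "0 < m" using p \<sigma> Q by (simp add: m_def)
  obtain C1 where C1: "0 < C1" "\<And>(f :: 'n heis \<Rightarrow> real) e. f \<in> borel_measurable borel \<Longrightarrow> (\<And>x. 0 \<le> f x) \<Longrightarrow>
    nnint (\<lambda>x. f x powr p) < \<infinity> \<Longrightarrow> 0 \<le> e \<Longrightarrow>
    gagliardo f p (Q + \<sigma> * p) \<le> ennreal e \<Longrightarrow>
    nnint (\<lambda>x. f x powr m) \<le> ennreal (C1 * e powr (m / p))"
    unfolding m_def Q_def using sobolev[OF p \<sigma>(1) \<sigma>(2)[unfolded Q_def]] by blast
  have \<sigma>p: "0 < \<sigma> * p" using \<sigma> p by simp
  obtain C2 where C2: "0 < C2" "\<And>\<delta> (f :: 'n heis \<Rightarrow> real). 0 < \<delta> \<Longrightarrow> \<delta> \<le> 1 \<Longrightarrow> f \<in> borel_measurable borel \<Longrightarrow> (\<And>x. 0 \<le> f x) \<Longrightarrow>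
    nnint (far_sum \<delta> f p (Q + \<sigma> * p))
     \<le> ennreal (C2 * \<delta> powr - (Q + \<sigma> * p)) * nnint (\<lambda>x. f x powr p)"
    unfolding Q_def using far_power_bound[OF \<sigma>p, where 'n='n and l=p] by blast
  show ?thesis
  proof (rule that)
    show "0 < C1 * (max 1 C2) powr (m / p)" using C1 by simp
    fix f :: "'n heis \<Rightarrow> real" and \<delta> X Y :: real
    assume \<delta>: "0 < \<delta>" "\<delta> \<le> 1" and [measurable]: "f \<in> borel_measurable borel" and f0: "\<And>x. 0 \<le> f x"
    and XY: "0 \<le> X" "0 \<le> Y"
    and X: "nnint (near_diff \<delta> f p (Q + s * p)) \<le> ennreal X"
    and Y: "nnint (\<lambda>x. f x powr p) \<le> ennreal Y"
    let ?d = "\<delta> powr - (Q + \<sigma> * p)"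
    have "gagliardo f p (Q + \<sigma> * p)
      = (\<integral>\<^sup>+ z. ennreal (\<bar>f (fst z) - f (snd z)\<bar> powr p / hdist (fst z) (snd z) powr (Q + \<sigma> * p)) \<partial>lborel)"
      by (subst nn_integral_lborel_prod) simp_all
    also have "\<dots> \<le> (\<integral>\<^sup>+ z. ennreal (near_diff \<delta> f p (Q + s * p) z)
       + ennreal (far_sum \<delta> f p (Q + \<sigma> * p) z) \<partial>lborel)"
    proof (rule nn_integral_mono)
      fix z :: "'n heis \<times> 'n heis"
      obtain x y where z: "z = (x, y)" by (cases z)
      show "ennreal (\<bar>f (fst z) - f (snd z)\<bar> powr p / hdist (fst z) (snd z) powr (Q + \<sigma> * p))
        \<le> ennreal (near_diff \<delta> f p (Q + s * p) z)
       + ennreal (far_sum \<delta> f p (Q + \<sigma> * p) z)"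
      proof (cases "hdist x y < \<delta>")
        case True
        have "\<bar>f x - f y\<bar> powr p / hdist x y powr (Q + \<sigma> * p) \<le> \<bar>f x - f y\<bar> powr p / hdist x y powr (Q + s * p)"
        proof (cases "x = y")
          case False
          then have "0 < hdist x y" by (simp add: less_le)
          moreover have "hdist x y powr (Q + s * p) \<le> hdist x y powr (Q + \<sigma> * p)"
            using True \<delta> \<sigma> p calculation by (intro powr_mono') auto
          ultimately show ?thesis by (intro divide_left_mono mult_pos_pos) auto
        qed simp
        with True show ?thesis by (simp add: z ennreal_leI)
      next
        case False
        have "\<bar>f x - f y\<bar> powr p / hdist x y powr (Q + \<sigma> * p) \<le> (f x powr p + f y powr p) / hdist x y powr (Q + \<sigma> * p)"
          using p by (intro divide_right_mono abs_diff_powr_le f0) auto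
        with False show ?thesis by (simp add: z ennreal_leI)
      qed
    qed
    also have "\<dots> = nnint (near_diff \<delta> f p (Q + s * p))
       + nnint (far_sum \<delta> f p (Q + \<sigma> * p))"
      by (rule nn_integral_add) measurable
    also have "\<dots> \<le> ennreal X + ennreal (C2 * ?d) * nnint (\<lambda>x. f x powr p)"
      by (intro add_mono X C2(2) \<delta> f0) measurable
    also have "\<dots> \<le> ennreal X + ennreal (C2 * ?d) * ennreal Y"
      by (intro add_left_mono mult_left_mono Y) auto
    also have "\<dots> = ennreal (X + C2 * ?d * Y)"
      using XY C2(1) by (simp add: ennreal_mult[symmetric] ennreal_plus[symmetric] del: ennreal_plus)
    also have "\<dots> \<le> ennreal (max 1 C2 * (X + ?d * Y))"
    proof (rule ennreal_leI)
      have "X + C2 * ?d * Y \<le> max 1 C2 * X + max 1 C2 * (?d * Y)"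
        using XY C2(1) mult_right_mono[of 1 "max 1 C2" X] mult_right_mono[of C2 "max 1 C2" "?d * Y"]
        by (simp add: mult.assoc)
      then show "X + C2 * ?d * Y \<le> max 1 C2 * (X + ?d * Y)" by (simp add: distrib_left)
    qed
    finally have e: "gagliardo f p (Q + \<sigma> * p) \<le> ennreal (max 1 C2 * (X + ?d * Y))" .
    have fin: "nnint (\<lambda>x. f x powr p) < \<infinity>" using Y by (simp add: le_less_trans)
    have "nnint (\<lambda>x. f x powr m) \<le> ennreal (C1 * (max 1 C2 * (X + ?d * Y)) powr (m / p))"
      using XY by (intro C1(2) f0 e fin mult_nonneg_nonneg add_nonneg_nonneg) auto
    also have "(max 1 C2 * (X + ?d * Y)) powr (m / p) = max 1 C2 powr (m / p) * (X + ?d * Y) powr (m / p)"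
      by (rule powr_mult)
    finally show "nnint (\<lambda>x. f x powr m) \<le> ennreal (C1 * (max 1 C2) powr (m / p) * (X + ?d * Y) powr (m / p))"
      by (simp add: mult.assoc)
  qed
qed

text \<open>One finite integral, that of \<open>h\<close>, serves both phases:
  \<open>w y powr (l - 1)\<close> is at most \<open>1 + \<bar>u y\<bar> powr (q - 1)\<close>, and
  the kernel decays at least as fast as the tail weight since \<open>sp \<le> \<tau> * l\<close>.
  The summand 1 is integrable against that weight by \<open>nn_integral_hnorm_far\<close>.\<close>

lemma tail_bound:
  fixes u :: "'n::finite heis \<Rightarrow> real" and l q \<tau> sp R :: real
  assumes [measurable]: "u \<in> borel_measurable borel"
    and tail: "(\<integral>\<^sup>+ \<xi>. ennreal (\<bar>u \<xi>\<bar> powr (q - 1) / (1 + hnorm \<xi>) powr (hdimQ TYPE('n) + sp)) \<partial>lborel) < \<infinity>"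
    and l: "1 < l" "l \<le> q" and sp: "0 < sp" "sp \<le> \<tau> * l" and R: "0 \<le> R"
  obtains C where "0 < C" "\<And>\<delta> f w. 0 < \<delta> \<Longrightarrow> \<delta> \<le> 1 \<Longrightarrow> f \<in> borel_measurable borel \<Longrightarrow> w \<in> borel_measurable borel \<Longrightarrow>
    (\<And>x. 0 \<le> f x) \<Longrightarrow> (\<And>x. f x \<noteq> 0 \<Longrightarrow> hnorm x \<le> R) \<Longrightarrow> (\<And>x. 0 \<le> w x) \<Longrightarrow> (\<And>x. w x \<le> \<bar>u x\<bar>) \<Longrightarrow>
    nnint (far_tail \<delta> w f l (hdimQ TYPE('n) + \<tau> * l))
     \<le> ennreal (C * \<delta> powr - (hdimQ TYPE('n) + \<tau> * l)) * nnint f"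
proof -
  let ?Q = "hdimQ TYPE('n)"
  let ?a = "?Q + \<tau> * l"
  have a: "?Q + sp \<le> ?a" "0 \<le> ?Q + sp" using sp by (auto simp: hdimQ_def)
  define h where "h y = (1 + \<bar>u y\<bar> powr (q - 1)) / (1 + hnorm y) powr (?Q + sp)" for y
  have [measurable]: "h \<in> borel_measurable borel" unfolding h_def by measurable
  have h0: "0 \<le> h y" for y by (simp add: h_def)
  have "(\<integral>\<^sup>+ y. ennreal (h y) \<partial>lborel) = (\<integral>\<^sup>+ y. ennreal (1 / (1 + hnorm y) powr (?Q + sp)) + ennreal (\<bar>u y\<bar> powr (q - 1) / (1 + hnorm y) powr (?Q + sp)) \<partial>lborel)"
    by (simp add: h_def add_divide_distrib)
  also have "\<dots> = (\<integral>\<^sup>+ y. ennreal (1 / (1 + hnorm (y::'n heis)) powr (?Q + sp)) \<partial>lborel) + (\<integral>\<^sup>+ y. ennreal (\<bar>u y\<bar> powr (q - 1) / (1 + hnorm y) powr (?Q + sp)) \<partial>lborel)"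
    by (rule nn_integral_add) measurable
  also have "\<dots> < \<infinity>" using tail nn_integral_hnorm_far[OF sp(1), where 'n='n] by simp
  finally obtain T where T: "(\<integral>\<^sup>+ y. ennreal (h y) \<partial>lborel) = ennreal T" "0 \<le> T"
    by (cases "\<integral>\<^sup>+ y. ennreal (h y) \<partial>lborel") auto
  show ?thesis
  proof (rule that)
    \<comment> \<open>The two orders of a pair give \<open>2 * T\<close>; the added 1 keeps the
      constant positive.\<close>
    show "0 < (3 + 2 * R) powr ?a * (2 * T + 1)" using R T by simp
    fix \<delta> :: real and f w :: "'n heis \<Rightarrow> real"
    assume \<delta>: "0 < \<delta>" "\<delta> \<le> 1" and [measurable]: "f \<in> borel_measurable borel" "w \<in> borel_measurable borel"
      and f0: "\<And>x. 0 \<le> f x" and fR: "\<And>x. f x \<noteq> 0 \<Longrightarrow> hnorm x \<le> R" and w0: "\<And>x. 0 \<le> w x" and wu: "\<And>x. w x \<le> \<bar>u x\<bar>"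
    let ?c = "(3 + 2 * R) powr ?a * \<delta> powr - ?a"
    have c0: "0 \<le> ?c" by simp
    have key: "w y powr (l - 1) * f x / hdist x y powr ?a \<le> ?c * (h y * f x)" if d: "\<delta> \<le> hdist x y" for x y
    proof (cases "f x = 0")
      case False
      have 1: "0 < 1 + hnorm y" using hnorm_nonneg[of y] by linarith
      have 2: "0 < hdist x y" using d \<delta> by linarith
      have "\<delta> * (1 + hnorm y) \<le> (3 + 2 * R) * hdist x y"
        by (rule one_plus_hnorm_le_hdist[OF fR[OF False] \<delta> d])
      then have "(\<delta> * (1 + hnorm y)) powr ?a \<le> ((3 + 2 * R) * hdist x y) powr ?a"
        using 1 \<delta> a by (intro powr_mono2) auto
      then have 3: "\<delta> powr ?a * (1 + hnorm y) powr ?a \<le> (3 + 2 * R) powr ?a * hdist x y powr ?a"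
        using 1 \<delta> R by (simp add: powr_mult)
      have "1 / hdist x y powr ?a \<le> (3 + 2 * R) powr ?a / (\<delta> powr ?a * (1 + hnorm y) powr ?a)"
        using 3 1 2 \<delta> by (simp add: divide_simps)
      also have "\<dots> \<le> (3 + 2 * R) powr ?a / (\<delta> powr ?a * (1 + hnorm y) powr (?Q + sp))"
        using a 1 \<delta> by (intro divide_left_mono mult_left_mono powr_mono mult_pos_pos) auto
      also have "\<dots> = ?c * (1 / (1 + hnorm y) powr (?Q + sp))" unfolding powr_minus_divide by simp
      finally have 4: "1 / hdist x y powr ?a \<le> ?c * (1 / (1 + hnorm y) powr (?Q + sp))" .
      have 5: "w y powr (l - 1) \<le> 1 + \<bar>u y\<bar> powr (q - 1)"
      proof -
        have "w y powr (l - 1) \<le> \<bar>u y\<bar> powr (l - 1)" using wu w0 l by (intro powr_mono2) auto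
        also have "\<dots> \<le> 1 + \<bar>u y\<bar> powr (q - 1)"
        proof (cases "\<bar>u y\<bar> \<le> 1")
          case True
          then have "\<bar>u y\<bar> powr (l - 1) \<le> 1" using l by (intro powr_le1) auto
          moreover have "0 \<le> \<bar>u y\<bar> powr (q - 1)" by simp
          ultimately show ?thesis by linarith
        next
          case False
          then have "\<bar>u y\<bar> powr (l - 1) \<le> \<bar>u y\<bar> powr (q - 1)" using l by (intro powr_mono) auto
          then show ?thesis by simp
        qed
        finally show ?thesis .
      qed
      have "w y powr (l - 1) * f x / hdist x y powr ?a = w y powr (l - 1) * (1 / hdist x y powr ?a) * f x" by simp
      also have "\<dots> \<le> (1 + \<bar>u y\<bar> powr (q - 1)) * (?c * (1 / (1 + hnorm y) powr (?Q + sp))) * f x"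
        using 4 5 f0 by (intro mult_right_mono mult_mono) auto
      also have "\<dots> = ?c * (h y * f x)" by (simp add: h_def)
      finally show ?thesis .
    qed simp
    have "(\<integral>\<^sup>+ z. ennreal (if \<delta> \<le> hdist (fst z) (snd z) then (w (fst z) powr (l - 1) * f (snd z) + w (snd z) powr (l - 1) * f (fst z))
        / hdist (fst z) (snd z) powr ?a else 0) \<partial>lborel)
      \<le> (\<integral>\<^sup>+ z. ennreal ?c * (ennreal (h (fst z)) * ennreal (f (snd z)) + ennreal (h (snd z)) * ennreal (f (fst z))) \<partial>lborel)"
    proof (rule nn_integral_mono)
      fix z :: "'n heis \<times> 'n heis"
      obtain x y where z: "z = (x, y)" by (cases z)
      have "(w x powr (l - 1) * f y + w y powr (l - 1) * f x) / hdist x y powr ?a \<le> ?c * (h x * f y + h y * f x)" if "\<delta> \<le> hdist x y"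
        using key[OF that] key[of y x] that by (simp add: add_divide_distrib distrib_left hdist_commute[of y x])
      then show "ennreal (if \<delta> \<le> hdist (fst z) (snd z) then (w (fst z) powr (l - 1) * f (snd z) + w (snd z) powr (l - 1) * f (fst z))
        / hdist (fst z) (snd z) powr ?a else 0) \<le> ennreal ?c * (ennreal (h (fst z)) * ennreal (f (snd z)) + ennreal (h (snd z)) * ennreal (f (fst z)))"
        using f0 h0 by (simp add: z ennreal_mult[symmetric] ennreal_plus[symmetric] ennreal_leI del: ennreal_plus)
    qed
    also have "\<dots> = ennreal ?c * ((\<integral>\<^sup>+ z. ennreal (h (fst z)) * ennreal (f (snd z)) \<partial>lborel) + (\<integral>\<^sup>+ z. ennreal (h (snd z)) * ennreal (f (fst z)) \<partial>lborel))"
      by (simp add: nn_integral_cmult nn_integral_add)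
    also have "(\<integral>\<^sup>+ z. ennreal (h (fst z)) * ennreal (f (snd z)) \<partial>lborel) = ennreal T * nnint f"
      unfolding T(1)[symmetric] by (rule nn_integral_lborel_mult) measurable
    also have "(\<integral>\<^sup>+ z. ennreal (h (snd z)) * ennreal (f (fst z)) \<partial>lborel) = ennreal T * nnint f"
      unfolding T(1)[symmetric] by (subst mult.commute, subst (2) mult.commute, rule nn_integral_lborel_mult) measurable
    also have "ennreal ?c * (ennreal T * nnint f + ennreal T * nnint f)
      = ennreal (?c * (2 * T)) * nnint f"
    proof -
      have "ennreal (?c * (2 * T)) = ennreal ?c * (ennreal T + ennreal T)"
        using T by (simp add: ennreal_mult[symmetric] ennreal_plus[symmetric] del: ennreal_plus)
      then show ?thesis by (simp add: distrib_right mult.assoc)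
    qed
    also have "\<dots> \<le> ennreal ((3 + 2 * R) powr ?a * (2 * T + 1) * \<delta> powr - ?a) * nnint f"
    proof (intro mult_right_mono ennreal_leI)
      have "?c * (2 * T) \<le> ?c * (2 * T + 1)" by (intro mult_left_mono) auto
      then show "?c * (2 * T) \<le> (3 + 2 * R) powr ?a * (2 * T + 1) * \<delta> powr - ?a" by (simp only: mult_ac)
    qed auto
    finally show "(\<integral>\<^sup>+ z. ennreal (if \<delta> \<le> hdist (fst z) (snd z) then (w (fst z) powr (l - 1) * f (snd z) + w (snd z) powr (l - 1) * f (fst z))
        / hdist (fst z) (snd z) powr ?a else 0) \<partial>lborel)
     \<le> ennreal ((3 + 2 * R) powr ?a * (2 * T + 1) * \<delta> powr - ?a) * nnint f" .
  qed
qed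

text \<open>\<open>L\<close> and \<open>R\<close> may have infinite integrals, so the inequality
  cannot be integrated as it stands. The positive and negative parts of \<open>G\<close> have equal
  finite integrals; moving the negative part to the left makes all terms nonnegative, and the common
  finite summand cancels.\<close>

lemma nn_integral_le_of_integral_zero:
  fixes G L R :: "'a \<Rightarrow> real"
  assumes G: "integrable M G" "integral\<^sup>L M G = 0" and [measurable]: "L \<in> borel_measurable M" "R \<in> borel_measurable M"
    and nn: "\<And>z. 0 \<le> L z" "\<And>z. 0 \<le> R z" "0 \<le> c" and le: "\<And>z. L z \<le> R z + c * G z"
  shows "(\<integral>\<^sup>+ z. ennreal (L z) \<partial>M) \<le> (\<integral>\<^sup>+ z. ennreal (R z) \<partial>M)"
proof -
  have [measurable]: "G \<in> borel_measurable M" using G by auto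
  let ?N = "\<integral>\<^sup>+ z. ennreal (- G z) \<partial>M"
  let ?P = "\<integral>\<^sup>+ z. ennreal (G z) \<partial>M"
  have fin: "?P < \<infinity>" "?N < \<infinity>" using G(1) by (auto simp: real_integrable_def top.not_eq_extremum)
  have "enn2real ?P = enn2real ?N" using real_lebesgue_integral_def[OF G(1)] G(2) by simp
  then have PN: "?P = ?N" using fin by (metis ennreal_enn2real infinity_ennreal_def)
  have "(\<integral>\<^sup>+ z. ennreal (L z) \<partial>M) + ennreal c * ?N = (\<integral>\<^sup>+ z. ennreal (L z) + ennreal c * ennreal (- G z) \<partial>M)"
    by (subst nn_integral_add) (auto simp: nn_integral_cmult)
  also have "\<dots> \<le> (\<integral>\<^sup>+ z. ennreal (R z) + ennreal c * ennreal (G z) \<partial>M)"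
  proof (rule nn_integral_mono)
    fix z
    show "ennreal (L z) + ennreal c * ennreal (- G z) \<le> ennreal (R z) + ennreal c * ennreal (G z)"
    proof (cases "0 \<le> G z")
      case True
      then have "ennreal (- G z) = 0" by (simp add: ennreal_neg)
      then show ?thesis using True le[of z] nn by (simp add: ennreal_mult[symmetric] ennreal_plus[symmetric] ennreal_leI del: ennreal_plus)
    next
      case False
      then have "ennreal (G z) = 0" by (simp add: ennreal_neg)
      moreover have "L z + c * (- G z) \<le> R z" using le[of z] by simp
      moreover have "ennreal (L z) + ennreal c * ennreal (- G z) = ennreal (L z + c * (- G z))"
      proof -
        have "ennreal (L z) + ennreal c * ennreal h = ennreal (L z + c * h)" if "0 \<le> h" for h
          using that nn by (simp add: ennreal_mult[symmetric] ennreal_plus[symmetric] del: ennreal_plus)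
        from this[of "- G z"] False show ?thesis by simp
      qed
      ultimately show ?thesis by (simp add: ennreal_leI)
    qed
  qed
  also have "\<dots> = (\<integral>\<^sup>+ z. ennreal (R z) \<partial>M) + ennreal c * ?N"
    by (subst nn_integral_add) (auto simp: nn_integral_cmult PN)
  finally have "ennreal c * ?N + (\<integral>\<^sup>+ z. ennreal (L z) \<partial>M) \<le> ennreal c * ?N + (\<integral>\<^sup>+ z. ennreal (R z) \<partial>M)"
    by (simp add: add.commute)
  moreover have "ennreal c * ?N < \<infinity>" using fin(2) by (simp add: ennreal_mult_less_top)
  ultimately show ?thesis by (auto simp: ennreal_add_left_cancel_le)
qed

section \<open>Caccioppoli inequality\<close>

lemma pos_above_le_abs: "0 \<le> k \<Longrightarrow> pos_above k z \<le> \<bar>z\<bar>"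
  by (simp add: pos_above_def)

lemma measurable_pos_above [measurable]: "pos_above k \<in> borel_measurable borel"
  unfolding pos_above_def[abs_def] by measurable

section \<open>The double-phase setting: energy, form and admissible test functions\<close>

locale double_phase =
  fixes \<Omega> :: "'n::finite heis set" and a :: "'n heis \<Rightarrow> 'n heis \<Rightarrow> real" and p q s t A :: real
  assumes open_domain: "open \<Omega>" and bounded_domain: "bounded \<Omega>"
    and exponents: "1 < p" "p \<le> q" "0 < s" "s \<le> t" "t < 1"
    and a_meas: "(\<lambda>z. a (fst z) (snd z)) \<in> borel_measurable lebesgue"
    and a_nonneg: "\<And>\<xi> \<eta>. 0 \<le> a \<xi> \<eta>" and a_le: "\<And>\<xi> \<eta>. a \<xi> \<eta> \<le> A"
begin

lemma A_nonneg: "0 \<le> A" using a_nonneg[of 0 0] a_le[of 0 0] by linarith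

text \<open>The cutoff carries the larger exponent \<open>q\<close> so that the same test function
  works in both phases, as the absorption in \<open>Jpow_cutoff_near_ordered\<close>
  requires.\<close>

definition cut :: "real \<Rightarrow> ('n heis \<Rightarrow> real) \<Rightarrow> ('n heis \<Rightarrow> real) \<Rightarrow> 'n heis \<Rightarrow> real" where
  "cut k u \<psi> x = pos_above k (u x) * \<psi> x powr q"

definition energy :: "('n heis \<Rightarrow> real) \<Rightarrow> 'n heis \<times> 'n heis \<Rightarrow> real" where
  "energy u z = \<bar>u (fst z) - u (snd z)\<bar> powr p / hdist (fst z) (snd z) powr (hdimQ TYPE('n) + s * p)
     + a (fst z) (snd z) * \<bar>u (fst z) - u (snd z)\<bar> powr q / hdist (fst z) (snd z) powr (hdimQ TYPE('n) + t * q)"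

definition form :: "('n heis \<Rightarrow> real) \<Rightarrow> ('n heis \<Rightarrow> real) \<Rightarrow> 'n heis \<times> 'n heis \<Rightarrow> real" where
  "form u \<phi> z = Jpow p (u (fst z) - u (snd z)) * (\<phi> (fst z) - \<phi> (snd z)) / hdist (fst z) (snd z) powr (hdimQ TYPE('n) + s * p)
     + a (fst z) (snd z) * Jpow q (u (fst z) - u (snd z)) * (\<phi> (fst z) - \<phi> (snd z)) / hdist (fst z) (snd z) powr (hdimQ TYPE('n) + t * q)"

abbreviation total_energy :: "('n heis \<Rightarrow> real) \<Rightarrow> ennreal" where
  "total_energy u \<equiv> \<integral>\<^sup>+ z. ennreal (indicator (COmega \<Omega>) z * energy u z) \<partial>lebesgue"

lemma energy_eq: "Hfun p q s t a (fst z) (snd z) \<bar>u (fst z) - u (snd z)\<bar> / hdist (fst z) (snd z) powr hdimQ TYPE('n) = energy u z"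
  by (simp add: Hfun_def energy_def add_divide_distrib powr_add mult.commute)

lemma energy_nonneg: "0 \<le> energy u z"
  by (simp add: energy_def a_nonneg)

lemma sets_COmega [measurable]: "COmega \<Omega> \<in> sets borel"
proof -
  have "COmega \<Omega> = fst -` \<Omega> \<union> snd -` \<Omega>" by (auto simp: COmega_def)
  then show ?thesis using open_domain by (auto intro!: borel_open open_vimage continuous_intros)
qed

lemma Aspace_iff:
  assumes [measurable]: "u \<in> borel_measurable borel"
  shows "u \<in> Aspace p q s t a \<Omega> \<longleftrightarrow> locint \<Omega> p (\<lambda>x. \<bar>u x\<bar>) < \<infinity> \<and>
     total_energy u < \<infinity>"
proof -
  have "u \<in> borel_measurable lebesgue" using assms by (simp add: measurable_completion)
  moreover have "(\<integral>\<^sup>+ x. indicator \<Omega> x * ennreal (\<bar>u x\<bar> powr p) \<partial>lebesgue) = locint \<Omega> p (\<lambda>x. \<bar>u x\<bar>)"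
    unfolding locint_def nn_integral_completion by (intro nn_integral_cong) (simp add: indicator_def)
  moreover have "(\<integral>\<^sup>+ z. indicator (COmega \<Omega>) z * ennreal (energy u z) \<partial>lebesgue) = total_energy u"
    by (intro nn_integral_cong) (simp add: indicator_def)
  ultimately show ?thesis unfolding Aspace_def energy_eq by simp
qed

lemma a_meas_scaled:
  assumes [measurable]: "f \<in> borel_measurable borel" "g \<in> borel_measurable borel"
  shows "(\<lambda>z. a (fst z) (snd z) * f z / g z) \<in> borel_measurable lebesgue"
proof -
  have [measurable]: "f \<in> borel_measurable lebesgue" "g \<in> borel_measurable lebesgue"
    by (simp_all add: measurable_completion)
  note [measurable] = a_meas
  show ?thesis by measurable
qed

lemma measurable_energy:
  assumes [measurable]: "u \<in> borel_measurable borel"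
  shows "energy u \<in> borel_measurable lebesgue"
  unfolding energy_def[abs_def]
proof (intro borel_measurable_add a_meas_scaled)
  have "(\<lambda>z. \<bar>u (fst z) - u (snd z)\<bar> powr p / hdist (fst z) (snd z) powr (hdimQ TYPE('n) + s * p)) \<in> borel_measurable borel"
    by measurable
  then show "(\<lambda>z. \<bar>u (fst z) - u (snd z)\<bar> powr p / hdist (fst z) (snd z) powr (hdimQ TYPE('n) + s * p)) \<in> borel_measurable lebesgue"
    by (simp add: measurable_completion)
qed measurable

lemma measurable_form:
  assumes [measurable]: "u \<in> borel_measurable borel" "\<phi> \<in> borel_measurable borel"
  shows "form u \<phi> \<in> borel_measurable lebesgue"
  unfolding form_def[abs_def] mult.assoc Jpow_def
proof (intro borel_measurable_add a_meas_scaled)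
  have "(\<lambda>z. \<bar>u (fst z) - u (snd z)\<bar> powr (p - 2) * ((u (fst z) - u (snd z)) * (\<phi> (fst z) - \<phi> (snd z))) / hdist (fst z) (snd z) powr (hdimQ TYPE('n) + s * p)) \<in> borel_measurable borel"
    by measurable
  then show "(\<lambda>z. \<bar>u (fst z) - u (snd z)\<bar> powr (p - 2) * ((u (fst z) - u (snd z)) * (\<phi> (fst z) - \<phi> (snd z))) / hdist (fst z) (snd z) powr (hdimQ TYPE('n) + s * p)) \<in> borel_measurable lebesgue"
    by (simp add: measurable_completion)
qed measurable

lemma abs_form_le: "\<bar>form u \<phi> z\<bar> \<le> energy u z + energy \<phi> z"
proof -
  let ?U = "u (fst z) - u (snd z)" and ?P = "\<phi> (fst z) - \<phi> (snd z)"
  let ?d1 = "hdist (fst z) (snd z) powr (hdimQ TYPE('n) + s * p)" and ?d2 = "hdist (fst z) (snd z) powr (hdimQ TYPE('n) + t * q)"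
  let ?a = "a (fst z) (snd z)"
  have 1: "\<bar>Jpow p ?U * ?P / ?d1\<bar> \<le> (\<bar>?U\<bar> powr p + \<bar>?P\<bar> powr p) / ?d1"
    unfolding abs_divide using abs_Jpow_mult_le[of p ?U ?P] exponents by (simp add: divide_right_mono)
  have 2: "\<bar>?a * (Jpow q ?U * ?P) / ?d2\<bar> \<le> ?a * (\<bar>?U\<bar> powr q + \<bar>?P\<bar> powr q) / ?d2"
    unfolding abs_divide abs_mult[of ?a] using abs_Jpow_mult_le[of q ?U ?P] exponents a_nonneg[of "fst z" "snd z"]
    by (auto intro!: divide_right_mono mult_left_mono)
  have "\<bar>form u \<phi> z\<bar> \<le> \<bar>Jpow p ?U * ?P / ?d1\<bar> + \<bar>?a * (Jpow q ?U * ?P) / ?d2\<bar>"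
    unfolding form_def mult.assoc by (rule abs_triangle_ineq)
  also have "\<dots> \<le> (\<bar>?U\<bar> powr p + \<bar>?P\<bar> powr p) / ?d1 + ?a * (\<bar>?U\<bar> powr q + \<bar>?P\<bar> powr q) / ?d2"
    by (intro add_mono 1 2)
  also have "\<dots> = energy u z + energy \<phi> z"
    by (simp add: energy_def add_divide_distrib distrib_left)
  finally show ?thesis .
qed

text \<open>The Bochner integral of a non-integrable function is 0 by convention, so the equation
  carries information only together with integrability. The latter comes from
  \<open>abs_form_le\<close>: the form of two functions of finite energy is dominated by the sum of
  their energies.\<close>

lemma weak_solution_test:
  assumes u: "weak_solution p q s t a \<Omega> u" and [measurable]: "u \<in> borel_measurable borel" "\<phi> \<in> borel_measurable borel"
    and \<phi>: "\<phi> \<in> Aspace p q s t a \<Omega>" "\<And>x. x \<notin> \<Omega> \<Longrightarrow> \<phi> x = 0"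
  shows "integrable lebesgue (\<lambda>z. indicator (COmega \<Omega>) z * form u \<phi> z)"
    and "(LINT z|lebesgue. indicator (COmega \<Omega>) z * form u \<phi> z) = 0"
proof -
  have uA: "u \<in> Aspace p q s t a \<Omega>" using u by (simp add: weak_solution_def)
  have [measurable]: "energy u \<in> borel_measurable lebesgue" "energy \<phi> \<in> borel_measurable lebesgue" "form u \<phi> \<in> borel_measurable lebesgue"
    by (simp_all add: measurable_energy measurable_form)
  have [measurable]: "COmega \<Omega> \<in> sets lebesgue" using sets_COmega by simp
  show "integrable lebesgue (\<lambda>z. indicator (COmega \<Omega>) z * form u \<phi> z)"
  proof (rule integrableI_bounded)
    have "(\<integral>\<^sup>+ z. ennreal (norm (indicator (COmega \<Omega>) z * form u \<phi> z)) \<partial>lebesgue)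
      \<le> (\<integral>\<^sup>+ z. ennreal (indicator (COmega \<Omega>) z * energy u z) + ennreal (indicator (COmega \<Omega>) z * energy \<phi> z) \<partial>lebesgue)"
      using abs_form_le by (intro nn_integral_mono)
        (auto simp: indicator_def energy_nonneg ennreal_plus[symmetric] simp del: ennreal_plus intro!: ennreal_leI)
    also have "\<dots> = total_energy u + total_energy \<phi>"
      by (rule nn_integral_add) measurable
    also have "\<dots> < \<infinity>" using uA \<phi>(1) by (simp add: Aspace_iff)
    finally show "(\<integral>\<^sup>+ z. ennreal (norm (indicator (COmega \<Omega>) z * form u \<phi> z)) \<partial>lebesgue) < \<infinity>" .
  qed measurable
  show "(LINT z|lebesgue. indicator (COmega \<Omega>) z * form u \<phi> z) = 0"
    using u \<phi> unfolding weak_solution_def set_lebesgue_integral_def form_def by auto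
qed

lemma measurable_cut:
  assumes "u \<in> borel_measurable borel" "is_cutoff \<delta> S \<psi>"
  shows "cut k u \<psi> \<in> borel_measurable borel"
proof -
  note [measurable] = assms(1) is_cutoffD(4)[OF assms(2)]
  show ?thesis unfolding cut_def[abs_def] by measurable
qed

lemma cut_bounds:
  assumes "is_cutoff \<delta> S \<psi>"
  shows "0 \<le> cut k u \<psi> x" "cut k u \<psi> x \<le> indicator S x * pos_above k (u x)" "x \<notin> S \<Longrightarrow> cut k u \<psi> x = 0"
proof -
  note cD = is_cutoffD[OF assms]
  show "0 \<le> cut k u \<psi> x" by (simp add: cut_def)
  show 3: "x \<notin> S \<Longrightarrow> cut k u \<psi> x = 0" using cD(7)[of x] by (auto simp: cut_def)
  have "\<psi> x powr q \<le> 1" using cD(5,6)[of x] exponents by (intro powr_le1) auto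
  then have "cut k u \<psi> x \<le> pos_above k (u x)"
    unfolding cut_def using mult_left_mono[of "\<psi> x powr q" 1 "pos_above k (u x)"] by simp
  with 3 show "cut k u \<psi> x \<le> indicator S x * pos_above k (u x)" by (cases "x \<in> S") auto
qed

lemma nn_integral_cut_le:
  assumes "is_cutoff \<delta> S \<psi>" "0 < l"
  shows "nnint (\<lambda>x. cut k u \<psi> x powr l) \<le> excess S l k u"
  unfolding locint_def
proof (intro nn_integral_mono ennreal_leI)
  fix x
  show "cut k u \<psi> x powr l \<le> indicator S x * pos_above k (u x) powr l"
    using cut_bounds[OF assms(1), where k=k and u=u and x=x] assms(2) by (cases "x \<in> S") (auto intro!: powr_mono2)
qed

lemma cut_vanishes_off_COmega:
  assumes "is_cutoff \<delta> S \<psi>" "S \<subseteq> \<Omega>" "z \<notin> COmega \<Omega>"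
  shows "cut k u \<psi> (fst z) = 0" "cut k u \<psi> (snd z) = 0"
proof -
  have "fst z \<notin> S" "snd z \<notin> S" using assms(2,3) by (auto simp: COmega_def mem_Times_iff)
  then show "cut k u \<psi> (fst z) = 0" "cut k u \<psi> (snd z) = 0" by (auto intro: cut_bounds(3)[OF assms(1)])
qed

lemma locint_pos_above_finite:
  assumes "locint \<Omega> p (\<lambda>x. \<bar>u x\<bar>) < \<infinity>" "S \<subseteq> \<Omega>" "0 \<le> k"
  shows "excess S p k u < \<infinity>"
proof -
  have "excess S p k u \<le> locint \<Omega> p (\<lambda>x. \<bar>u x\<bar>)"
    unfolding locint_def using assms(2,3) exponents
    by (intro nn_integral_mono ennreal_leI) (auto simp: indicator_def pos_above_le_abs intro!: powr_mono2)
  with assms(1) show ?thesis by simp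
qed

text \<open>At near pairs the energy of the test function is bounded by that of \<open>u\<close>
  plus cutoff errors, at far pairs by powers of the test function itself against an integrable
  kernel. Its q-phase makes the q-integrability of the excess on \<open>S\<close> necessary for this
  argument; the factor \<open>2 powr q\<close> covers both exponents.\<close>

lemma cut_mem_Aspace:
  assumes uA: "u \<in> Aspace p q s t a \<Omega>" and [measurable]: "u \<in> borel_measurable borel"
    and cut: "is_cutoff \<delta> S \<psi>" "S \<subseteq> \<Omega>" and k: "0 \<le> k"
    and fin: "excess S q k u < \<infinity>"
  shows "cut k u \<psi> \<in> Aspace p q s t a \<Omega>"
proof -
  note cD = is_cutoffD[OF cut(1)]
  note [measurable] = cD(3,4) measurable_cut[OF assms(2) cut(1)]
  let ?w = "\<lambda>x. pos_above k (u x)" and ?\<phi> = "cut k u \<psi>"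
  have up: "locint \<Omega> p (\<lambda>x. \<bar>u x\<bar>) < \<infinity>" and uE: "total_energy u < \<infinity>"
    using uA by (auto simp: Aspace_iff)
  have wp: "locint S p ?w < \<infinity>" by (rule locint_pos_above_finite[OF up cut(2) k])
  have pl: "0 < p" "0 < q" "s < 1" "t < 1" "0 \<le> q" "0 < s * p" "0 < t * q" using exponents by auto
  define E where "E l \<tau> z = (cutoff_error \<delta> q ?w \<psi> l (hdimQ TYPE('n) + \<tau> * l) z)" for l \<tau> and z :: "'n heis \<times> 'n heis"
  define F where "F l \<tau> z = (far_sum \<delta> ?\<phi> l (hdimQ TYPE('n) + \<tau> * l) z)" for l \<tau> and z :: "'n heis \<times> 'n heis"
  have Em[measurable]: "E l \<tau> \<in> borel_measurable borel" "F l \<tau> \<in> borel_measurable borel" for l \<tau>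
    unfolding E_def F_def by measurable
  have [measurable]: "E l \<tau> \<in> borel_measurable lebesgue" "F l \<tau> \<in> borel_measurable lebesgue" for l \<tau>
    using Em by (simp_all add: measurable_completion)
  have EF0: "0 \<le> E l \<tau> z" "0 \<le> F l \<tau> z" for l \<tau> z by (auto simp: E_def F_def)
  have Efin: "(\<integral>\<^sup>+ z. ennreal (E l \<tau> z) \<partial>lebesgue) < \<infinity>" if l: "0 < l" "\<tau> < 1" "locint S l ?w < \<infinity>" for l \<tau>
  proof -
    obtain C where "0 < C" and C: "\<And>\<delta> S \<psi> (w :: 'n heis \<Rightarrow> real). is_cutoff \<delta> S \<psi> \<Longrightarrow> w \<in> borel_measurable borel \<Longrightarrow> (\<And>x. 0 \<le> w x) \<Longrightarrow>
    nnint (cutoff_error \<delta> q w \<psi> l (hdimQ TYPE('n) + \<tau> * l))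
     \<le> ennreal (C * \<delta> powr - l) * locint S l w"
      by (rule near_error_bound[OF l(1,2) pl(5), where 'n='n]) (rule that, assumption, simp)
    have "nnint (E l \<tau>) \<le> ennreal (C * \<delta> powr - l) * locint S l ?w"
      unfolding E_def by (rule C[OF cut(1)]) auto
    also have "\<dots> < \<infinity>" using l(3) by (simp add: ennreal_mult_less_top)
    finally show ?thesis by (simp add: nn_integral_completion)
  qed
  have Ffin: "(\<integral>\<^sup>+ z. ennreal (F l \<tau> z) \<partial>lebesgue) < \<infinity>" if l: "0 < l" "0 < \<tau> * l" "locint S l ?w < \<infinity>" for l \<tau>
  proof -
    obtain C where "0 < C" and C: "\<And>\<delta> (f :: 'n heis \<Rightarrow> real). 0 < \<delta> \<Longrightarrow> \<delta> \<le> 1 \<Longrightarrow> f \<in> borel_measurable borel \<Longrightarrow> (\<And>x. 0 \<le> f x) \<Longrightarrow>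
    nnint (far_sum \<delta> f l (hdimQ TYPE('n) + \<tau> * l))
     \<le> ennreal (C * \<delta> powr - (hdimQ TYPE('n) + \<tau> * l)) * nnint (\<lambda>x. f x powr l)"
      by (rule far_power_bound[OF l(2), where 'n='n and l=l]) (rule that, assumption, simp)
    have "nnint (F l \<tau>) \<le> ennreal (C * \<delta> powr - (hdimQ TYPE('n) + \<tau> * l)) * nnint (\<lambda>x. ?\<phi> x powr l)"
      unfolding F_def by (rule C[OF cD(1,2)]) (auto simp: cut_bounds[OF cut(1)])
    also have "\<dots> < \<infinity>" using le_less_trans[OF nn_integral_cut_le[OF cut(1) l(1)] l(3)] by (simp add: ennreal_mult_less_top)
    finally show ?thesis by (simp add: nn_integral_completion)
  qed
  have "total_energy ?\<phi> \<le>
    (\<integral>\<^sup>+ z. ennreal (2 powr q) * ennreal (indicator (COmega \<Omega>) z * energy u z) + ennreal (2 powr q) * ennreal (E p s z)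
        + ennreal (2 powr q * A) * ennreal (E q t z) + ennreal (F p s z) + ennreal A * ennreal (F q t z) \<partial>lebesgue)"
  proof (rule nn_integral_mono)
    fix z :: "'n heis \<times> 'n heis"
    obtain x y where z: "z = (x, y)" by (cases z)
    have "indicator (COmega \<Omega>) z * energy ?\<phi> z \<le> 2 powr q * (indicator (COmega \<Omega>) z * energy u z) + 2 powr q * E p s z
        + 2 powr q * A * E q t z + F p s z + A * F q t z"
    proof (cases "z \<in> COmega \<Omega>")
      case False
      then show ?thesis using EF0 A_nonneg by simp
    next
      case True
      let ?d1 = "hdist x y powr (hdimQ TYPE('n) + s * p)" and ?d2 = "hdist x y powr (hdimQ TYPE('n) + t * q)"
      show ?thesis
      proof (cases "hdist x y < \<delta>")
        case d: True
        let ?X = "2 * q * max (?w x) (?w y) * \<bar>\<psi> x - \<psi> y\<bar>"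
        have near: "\<bar>?\<phi> x - ?\<phi> y\<bar> powr l \<le> 2 powr q * (\<bar>u x - u y\<bar> powr l + ?X powr l)" if "1 < l" "l \<le> q" for l
        proof -
          have "\<bar>?\<phi> x - ?\<phi> y\<bar> powr l \<le> 2 powr l * (\<bar>u x - u y\<bar> powr l + ?X powr l)"
            unfolding cut_def using cD(5,6) that exponents by (intro Jpow_cutoff_near(3)) auto
          also have "\<dots> \<le> 2 powr q * (\<bar>u x - u y\<bar> powr l + ?X powr l)"
            using that by (intro mult_right_mono powr_mono) auto
          finally show ?thesis .
        qed
        have "energy ?\<phi> z = \<bar>?\<phi> x - ?\<phi> y\<bar> powr p / ?d1 + a x y * (\<bar>?\<phi> x - ?\<phi> y\<bar> powr q / ?d2)"
          by (simp add: energy_def z)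
        also have "\<dots> \<le> 2 powr q * (\<bar>u x - u y\<bar> powr p + ?X powr p) / ?d1 + a x y * (2 powr q * (\<bar>u x - u y\<bar> powr q + ?X powr q) / ?d2)"
          using near exponents a_nonneg by (intro add_mono divide_right_mono mult_left_mono) auto
        also have "\<dots> = 2 powr q * energy u z + 2 powr q * E p s z + 2 powr q * (a x y * E q t z)"
          using d by (simp add: energy_def E_def z add_divide_distrib algebra_simps)
        also have "\<dots> \<le> 2 powr q * energy u z + 2 powr q * E p s z + 2 powr q * (A * E q t z)"
          using EF0 a_le by (intro add_mono mult_left_mono mult_right_mono) auto
        finally have "energy ?\<phi> z \<le> 2 powr q * energy u z + 2 powr q * E p s z + 2 powr q * (A * E q t z)" .
        then show ?thesis using True d by (simp add: F_def z mult.assoc)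
      next
        case d: False
        have "energy ?\<phi> z = \<bar>?\<phi> x - ?\<phi> y\<bar> powr p / ?d1 + a x y * (\<bar>?\<phi> x - ?\<phi> y\<bar> powr q / ?d2)"
          by (simp add: energy_def z)
        also have "\<dots> \<le> (?\<phi> x powr p + ?\<phi> y powr p) / ?d1 + A * ((?\<phi> x powr q + ?\<phi> y powr q) / ?d2)"
          using exponents a_nonneg a_le A_nonneg cut_bounds[OF cut(1)]
          by (intro add_mono divide_right_mono mult_mono abs_diff_powr_le) auto
        also have "\<dots> = F p s z + A * F q t z" using d by (simp add: F_def z)
        finally have "energy ?\<phi> z \<le> F p s z + A * F q t z" .
        moreover have "0 \<le> 2 powr q * energy u z" by (simp add: energy_nonneg)
        ultimately show ?thesis using True d by (simp add: E_def z)
      qed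
    qed
    then show "ennreal (indicator (COmega \<Omega>) z * energy ?\<phi> z) \<le> ennreal (2 powr q) * ennreal (indicator (COmega \<Omega>) z * energy u z) + ennreal (2 powr q) * ennreal (E p s z)
        + ennreal (2 powr q * A) * ennreal (E q t z) + ennreal (F p s z) + ennreal A * ennreal (F q t z)"
      using EF0 A_nonneg energy_nonneg
      by (simp add: ennreal_mult[symmetric] ennreal_plus[symmetric] ennreal_leI del: ennreal_plus)
  qed
  also have "\<dots> = ennreal (2 powr q) * total_energy u + ennreal (2 powr q) * (\<integral>\<^sup>+ z. ennreal (E p s z) \<partial>lebesgue)
        + ennreal (2 powr q * A) * (\<integral>\<^sup>+ z. ennreal (E q t z) \<partial>lebesgue) + (\<integral>\<^sup>+ z. ennreal (F p s z) \<partial>lebesgue) + ennreal A * (\<integral>\<^sup>+ z. ennreal (F q t z) \<partial>lebesgue)"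
  proof -
    have [measurable]: "energy u \<in> borel_measurable lebesgue" "COmega \<Omega> \<in> sets lebesgue"
      using sets_COmega by (simp_all add: measurable_energy)
    show ?thesis by (simp add: nn_integral_add nn_integral_cmult)
  qed
  also have "\<dots> < \<infinity>"
    using uE Efin[OF pl(1,3) wp] Efin[OF pl(2,4) fin] Ffin[OF pl(1,6) wp] Ffin[OF pl(2,7) fin]
    by (simp add: ennreal_mult_less_top)
  finally have E: "total_energy ?\<phi> < \<infinity>" .
  have "locint \<Omega> p (\<lambda>x. \<bar>?\<phi> x\<bar>) \<le> locint S p ?w"
    unfolding locint_def
  proof (intro nn_integral_mono ennreal_leI)
    fix x
    show "indicator \<Omega> x * \<bar>?\<phi> x\<bar> powr p \<le> indicator S x * ?w x powr p"
      using cut_bounds[OF cut(1), where k=k and u=u and x=x] exponents cut(2)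
      by (cases "x \<in> S") (auto simp: indicator_def intro!: powr_mono2)
  qed
  with wp have "locint \<Omega> p (\<lambda>x. \<bar>?\<phi> x\<bar>) < \<infinity>" by simp
  with E show ?thesis by (simp add: Aspace_iff)
qed

text \<open>The powers p and q of the excess stem from the cutoff errors of the two phases, the
  power 1 from the tail terms, in which the test function is linear. The constant is independent of
  the level and of the cutoff apart from \<open>\<delta>\<close>, as the iteration demands.\<close>

lemma caccioppoli:
  assumes u: "weak_solution p q s t a \<Omega> u" and [measurable]: "u \<in> borel_measurable borel"
    and tail: "(\<integral>\<^sup>+ \<xi>. ennreal (\<bar>u \<xi>\<bar> powr (q - 1) / (1 + hnorm \<xi>) powr (hdimQ TYPE('n) + s * p)) \<partial>lborel) < \<infinity>"
  obtains C where "0 < C" "\<And>\<delta> S \<psi> k. is_cutoff \<delta> S \<psi> \<Longrightarrow> S \<subseteq> \<Omega> \<Longrightarrow> 0 \<le> k \<Longrightarrow> excess S q k u < \<infinity> \<Longrightarrow>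
    nnint (near_diff \<delta> (cut k u \<psi>) p (hdimQ TYPE('n) + s * p))
     \<le> ennreal (C * \<delta> powr - (hdimQ TYPE('n) + q)) * (excess S 1 k u + excess S p k u + excess S q k u)"
proof -
  let ?Q = "hdimQ TYPE('n)"
  have Q: "0 < ?Q" by (simp add: hdimQ_def)
  have pl: "0 < p" "0 < q" "s < 1" "t < 1" "0 \<le> q" "0 < s * p" "0 < t * q" "1 < q" "1 \<le> q" "0 < t"
    using exponents by auto
  have sptq: "s * p \<le> t * q" using exponents by (intro mult_mono) auto
  obtain R where R: "0 \<le> R" "\<And>x. x \<in> \<Omega> \<Longrightarrow> hnorm x \<le> R"
  proof -
    have "compact (hnorm ` closure \<Omega>)"
      using bounded_domain by (intro compact_continuous_image continuous_intros) (simp add: compact_closure)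
    then have "bounded (hnorm ` closure \<Omega>)" by (rule compact_imp_bounded)
    then obtain B where "\<And>x. x \<in> closure \<Omega> \<Longrightarrow> \<bar>hnorm x\<bar> \<le> B" unfolding bounded_iff by auto
    then show ?thesis using closure_subset[of \<Omega>] by (intro that[of "max B 0"]) (auto simp: le_max_iff_disj)
  qed
  obtain C1 where C1: "0 < C1" "\<And>\<delta> S \<psi> (w :: 'n heis \<Rightarrow> real). is_cutoff \<delta> S \<psi> \<Longrightarrow> w \<in> borel_measurable borel \<Longrightarrow> (\<And>x. 0 \<le> w x) \<Longrightarrow>
    nnint (cutoff_error \<delta> q w \<psi> p (?Q + s * p)) \<le> ennreal (C1 * \<delta> powr - p) * locint S p w"
    by (rule near_error_bound[OF pl(1,3) pl(5), where 'n='n]) (rule that, assumption, simp)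
  obtain C2 where C2: "0 < C2" "\<And>\<delta> S \<psi> (w :: 'n heis \<Rightarrow> real). is_cutoff \<delta> S \<psi> \<Longrightarrow> w \<in> borel_measurable borel \<Longrightarrow> (\<And>x. 0 \<le> w x) \<Longrightarrow>
    nnint (cutoff_error \<delta> q w \<psi> q (?Q + t * q)) \<le> ennreal (C2 * \<delta> powr - q) * locint S q w"
    by (rule near_error_bound[OF pl(2,4) pl(5), where 'n='n]) (rule that, assumption, simp)
  obtain C3 where C3: "0 < C3" "\<And>\<delta> f w. 0 < \<delta> \<Longrightarrow> \<delta> \<le> 1 \<Longrightarrow> f \<in> borel_measurable borel \<Longrightarrow> w \<in> borel_measurable borel \<Longrightarrow>
    (\<And>x. 0 \<le> f x) \<Longrightarrow> (\<And>x. f x \<noteq> 0 \<Longrightarrow> hnorm x \<le> R) \<Longrightarrow> (\<And>x. 0 \<le> w x) \<Longrightarrow> (\<And>x. w x \<le> \<bar>u x\<bar>) \<Longrightarrow>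
    nnint (far_tail \<delta> w f p (?Q + s * p))
     \<le> ennreal (C3 * \<delta> powr - (?Q + s * p)) * nnint f"
    by (rule tail_bound[OF assms(2) tail exponents(1,2) pl(6) order_refl R(1)]) (rule that, assumption, simp)
  obtain C4 where C4: "0 < C4" "\<And>\<delta> f w. 0 < \<delta> \<Longrightarrow> \<delta> \<le> 1 \<Longrightarrow> f \<in> borel_measurable borel \<Longrightarrow> w \<in> borel_measurable borel \<Longrightarrow>
    (\<And>x. 0 \<le> f x) \<Longrightarrow> (\<And>x. f x \<noteq> 0 \<Longrightarrow> hnorm x \<le> R) \<Longrightarrow> (\<And>x. 0 \<le> w x) \<Longrightarrow> (\<And>x. w x \<le> \<bar>u x\<bar>) \<Longrightarrow>
    nnint (far_tail \<delta> w f q (?Q + t * q))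
     \<le> ennreal (C4 * \<delta> powr - (?Q + t * q)) * nnint f"
    by (rule tail_bound[OF assms(2) tail pl(8) order_refl pl(6) sptq R(1)]) (rule that, assumption, simp)
  \<comment> \<open>The factor of the form in \<open>Jpow_cutoff_near(2)\<close> for
    \<open>l = p\<close>. It multiplies every error except the near error of the p-phase, whose own
    factor there is \<open>3 * 2 powr p\<close>.\<close>
  define c where "c = 2 * 2 powr p"
  have c0: "0 < c" by (simp add: c_def)
  define K where "K = 3 * 2 powr p * C1 + c * A * C2 + c * C3 + c * A * C4"
  show ?thesis
  proof (rule that[of K])
    show "0 < K" using C1(1) C2(1) C3(1) C4(1) A_nonneg c0 unfolding K_def
      by (intro add_pos_nonneg) auto
    fix \<delta> and S :: "'n heis set" and \<psi> and k :: real
    assume cut: "is_cutoff \<delta> S \<psi>" "S \<subseteq> \<Omega>" and k: "0 \<le> k" and fin: "excess S q k u < \<infinity>"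
    note cD = is_cutoffD[OF cut(1)]
    note [measurable] = cD(3,4) measurable_cut[OF assms(2) cut(1)]
    let ?w = "\<lambda>x. pos_above k (u x)" and ?\<phi> = "cut k u \<psi>"
    let ?N = "?Q + q"
    let ?I = "locint S 1 ?w + locint S p ?w + locint S q ?w"
    have \<phi>\<Omega>: "x \<notin> \<Omega> \<Longrightarrow> ?\<phi> x = 0" for x using cut(2) by (auto intro: cut_bounds(3)[OF cut(1)])
    have uA: "u \<in> Aspace p q s t a \<Omega>" using u by (simp add: weak_solution_def)
    note test = weak_solution_test[OF u assms(2) _ cut_mem_Aspace[OF uA assms(2) cut k fin] \<phi>\<Omega>]
    define L where "L z = (near_diff \<delta> ?\<phi> p (?Q + s * p) z)"
      for z :: "'n heis \<times> 'n heis"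
    define E where "E l \<tau> z = (cutoff_error \<delta> q ?w \<psi> l (?Q + \<tau> * l) z)" for l \<tau> and z :: "'n heis \<times> 'n heis"
    define T where "T l \<tau> z = (far_tail \<delta> ?w ?\<phi> l (?Q + \<tau> * l) z)" for l \<tau> and z :: "'n heis \<times> 'n heis"
    define R' where "R' z = 3 * 2 powr p * E p s z + c * A * E q t z + c * T p s z + c * A * T q t z" for z
    have [measurable]: "E l \<tau> \<in> borel_measurable borel" "T l \<tau> \<in> borel_measurable borel" for l \<tau>
      unfolding E_def T_def by measurable
    have Lm: "L \<in> borel_measurable borel" and Rm: "R' \<in> borel_measurable borel"
      unfolding L_def R'_def by measurable
    have nn: "0 \<le> L z" "0 \<le> E l \<tau> z" "0 \<le> T l \<tau> z" for l \<tau> z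
      using cut_bounds(1)[OF cut(1)] by (auto simp: L_def E_def T_def)
    have R0: "0 \<le> R' z" for z using nn A_nonneg c0 by (simp add: R'_def)
    \<comment> \<open>Off \<open>COmega \<Omega>\<close> the test function vanishes at both points.
      At near pairs the p-phase is coercive up to its error, and the q-phase is nonnegative up to
      its own, so it may be added on the right. Far pairs are absent from \<open>L\<close>, and the
      tail terms compensate the negative part of both phases.\<close>
    have le: "L z \<le> R' z + c * (indicator (COmega \<Omega>) z * form u ?\<phi> z)" for z
    proof (cases "z \<in> COmega \<Omega>")
      case False
      then have "L z = 0" using cut_vanishes_off_COmega[OF cut False] pl by (simp add: L_def)
      then show ?thesis using False R0 by simp
    next
      case True
      obtain x y where z: "z = (x, y)" by (cases z)
      let ?d1 = "hdist x y powr (?Q + s * p)" and ?d2 = "hdist x y powr (?Q + t * q)"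
      let ?G = "\<lambda>l. Jpow l (u x - u y) * (?\<phi> x - ?\<phi> y)"
      have form: "form u ?\<phi> z = ?G p / ?d1 + a x y * (?G q / ?d2)" by (simp add: form_def z)
      show ?thesis
      proof (cases "hdist x y < \<delta>")
        case d: True
        let ?X = "2 * q * max (?w x) (?w y) * \<bar>\<psi> x - \<psi> y\<bar>"
        have 1: "\<bar>?\<phi> x - ?\<phi> y\<bar> powr p \<le> c * ?G p + 3 * 2 powr p * ?X powr p"
          unfolding cut_def c_def using cD(5,6) exponents pl by (intro Jpow_cutoff_near(2)) auto
        have 2: "0 \<le> ?G q + ?X powr q"
          unfolding cut_def using cD(5,6) exponents pl by (intro Jpow_cutoff_near(1)) auto
        have "\<bar>?\<phi> x - ?\<phi> y\<bar> powr p / ?d1 \<le> (c * ?G p + 3 * 2 powr p * ?X powr p) / ?d1"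
          by (rule divide_right_mono[OF 1]) simp
        moreover have "0 \<le> c * (a x y * ((?G q + ?X powr q) / ?d2))"
          using 2 c0 a_nonneg by (intro mult_nonneg_nonneg divide_nonneg_nonneg) auto
        moreover have "c * (a x y * (?X powr q / ?d2)) \<le> c * (A * (?X powr q / ?d2))"
          using c0 a_le by (intro mult_left_mono mult_right_mono) auto
        ultimately have "\<bar>?\<phi> x - ?\<phi> y\<bar> powr p / ?d1 \<le> 3 * 2 powr p * (?X powr p / ?d1) + c * (A * (?X powr q / ?d2)) + c * (?G p / ?d1 + a x y * (?G q / ?d2))"
          by (simp add: add_divide_distrib distrib_left)
        then show ?thesis using True d unfolding form by (simp add: L_def R'_def E_def T_def z mult.assoc)
      next
        case d: False
        have tp: "0 \<le> ?G p + (?w x powr (p - 1) * ?\<phi> y + ?w y powr (p - 1) * ?\<phi> x)"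
          unfolding cut_def using cD(5,6) exponents pl by (intro Jpow_cutoff_far) auto
        have tq: "0 \<le> ?G q + (?w x powr (q - 1) * ?\<phi> y + ?w y powr (q - 1) * ?\<phi> x)"
          unfolding cut_def using cD(5,6) exponents pl by (intro Jpow_cutoff_far) auto
        have "0 \<le> (?G p + (?w x powr (p - 1) * ?\<phi> y + ?w y powr (p - 1) * ?\<phi> x)) / ?d1"
          by (rule divide_nonneg_nonneg[OF tp]) simp
        moreover have "(?w x powr (p - 1) * ?\<phi> y + ?w y powr (p - 1) * ?\<phi> x) / ?d1 = T p s z" using d by (simp add: T_def z)
        ultimately have 1: "0 \<le> ?G p / ?d1 + T p s z" by (simp add: add_divide_distrib)
        have "0 \<le> a x y * ((?G q + (?w x powr (q - 1) * ?\<phi> y + ?w y powr (q - 1) * ?\<phi> x)) / ?d2)"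
          by (intro mult_nonneg_nonneg divide_nonneg_nonneg[OF tq] a_nonneg) simp
        moreover have "(?G q + (?w x powr (q - 1) * ?\<phi> y + ?w y powr (q - 1) * ?\<phi> x)) / ?d2 = ?G q / ?d2 + T q t z"
          using d by (simp add: T_def z add_divide_distrib)
        ultimately have 2: "0 \<le> a x y * (?G q / ?d2) + a x y * T q t z" by (simp only: distrib_left)
        have 3: "a x y * T q t z \<le> A * T q t z" using nn a_le by (intro mult_right_mono) auto
        have "0 \<le> c * (T p s z + A * T q t z + (?G p / ?d1 + a x y * (?G q / ?d2)))"
          using c0 1 2 3 by (intro mult_nonneg_nonneg) auto
        then show ?thesis using True d unfolding form by (simp add: L_def R'_def E_def z distrib_left mult.assoc)
      qed
    qed
    have "nnint L = (\<integral>\<^sup>+ z. ennreal (L z) \<partial>lebesgue)" by (simp add: nn_integral_completion)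
    also have "\<dots> \<le> (\<integral>\<^sup>+ z. ennreal (R' z) \<partial>lebesgue)"
    proof (rule nn_integral_le_of_integral_zero[OF _ _ _ _ nn(1) R0 less_imp_le[OF c0] le])
      show "integrable lebesgue (\<lambda>z. indicator (COmega \<Omega>) z * form u ?\<phi> z)" by (rule test) measurable
      show "(LINT z|lebesgue. indicator (COmega \<Omega>) z * form u ?\<phi> z) = 0" by (rule test) measurable
    qed (use Lm Rm in \<open>simp_all add: measurable_completion\<close>)
    also have "\<dots> = nnint R'" by (simp add: nn_integral_completion)
    also have "\<dots> = (\<integral>\<^sup>+ z. ennreal (3 * 2 powr p) * ennreal (E p s z) + ennreal (c * A) * ennreal (E q t z) + ennreal c * ennreal (T p s z) + ennreal (c * A) * ennreal (T q t z) \<partial>lborel)"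
      unfolding R'_def using nn A_nonneg c0
      by (intro nn_integral_cong) (simp add: ennreal_mult[symmetric] ennreal_plus[symmetric] del: ennreal_plus)
    also have "\<dots> = ennreal (3 * 2 powr p) * nnint (E p s) + ennreal (c * A) * nnint (E q t)
       + ennreal c * nnint (T p s) + ennreal (c * A) * nnint (T q t)"
      by (simp add: nn_integral_add nn_integral_cmult)
    also have "\<dots> \<le> ennreal (3 * 2 powr p * C1 * \<delta> powr - ?N) * ?I + ennreal (c * A * C2 * \<delta> powr - ?N) * ?I
       + ennreal (c * C3 * \<delta> powr - ?N) * ?I + ennreal (c * A * C4 * \<delta> powr - ?N) * ?I"
    proof -
      \<comment> \<open>Each error comes with its own power of \<open>\<delta>\<close> and its own
        excess. Since \<open>\<delta> \<le> 1\<close>, all powers are coarsened to the largest one,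
        and each excess to the sum of the three.\<close>
      have bd: "ennreal b * X \<le> ennreal (b * B * \<delta> powr - ?N) * ?I"
        if "X \<le> ennreal (B * \<delta> powr - e) * Y" "Y \<le> ?I" "e \<le> ?N" "0 \<le> b" "0 \<le> B" for b X B e Y
      proof -
        have "\<delta> powr - e \<le> \<delta> powr - ?N" using cD(1,2) that(3) by (intro powr_mono') auto
        then have "X \<le> ennreal (B * \<delta> powr - ?N) * ?I"
          using that by (intro order_trans[OF that(1)] mult_mono ennreal_leI mult_left_mono) auto
        then have "ennreal b * X \<le> ennreal b * (ennreal (B * \<delta> powr - ?N) * ?I)" by (rule mult_left_mono) simp
        also have "\<dots> = ennreal (b * B * \<delta> powr - ?N) * ?I"
          using that by (simp add: ennreal_mult mult.assoc)
        finally show ?thesis .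
      qed
      have I: "locint S 1 ?w \<le> ?I" "locint S p ?w \<le> ?I" "locint S q ?w \<le> ?I"
        by (auto simp: add_increasing add_increasing2)
      have \<phi>1: "nnint ?\<phi> \<le> locint S 1 ?w"
        using nn_integral_cut_le[OF cut(1), of 1 k u] cut_bounds(1)[OF cut(1)] by simp
      have "s * p \<le> 1 * q" using exponents by (intro mult_mono) auto
      then have sp: "s * p \<le> q" by simp
      have tq: "t * q \<le> q" using mult_left_le_one_le[of q t] exponents by simp
      have \<phi>R: "\<And>x. ?\<phi> x \<noteq> 0 \<Longrightarrow> hnorm x \<le> R" using \<phi>\<Omega> R(2) by blast
      show ?thesis
      proof (intro add_mono)
        show "ennreal (3 * 2 powr p) * nnint (E p s) \<le> ennreal (3 * 2 powr p * C1 * \<delta> powr - ?N) * ?I"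
          using C1(1) exponents Q by (intro bd[OF _ I(2), of _ _ p]) (auto simp: E_def intro!: C1(2)[OF cut(1)])
        show "ennreal (c * A) * nnint (E q t) \<le> ennreal (c * A * C2 * \<delta> powr - ?N) * ?I"
          using C2(1) exponents Q c0 A_nonneg by (intro bd[OF _ I(3), of _ _ q]) (auto simp: E_def intro!: C2(2)[OF cut(1)])
        have "nnint (T p s) \<le> ennreal (C3 * \<delta> powr - (?Q + s * p)) * nnint ?\<phi>"
          unfolding T_def by (rule C3(2)[OF cD(1,2) _ _ cut_bounds(1)[OF cut(1)] \<phi>R]) (auto simp: pos_above_le_abs k)
        then show "ennreal c * nnint (T p s) \<le> ennreal (c * C3 * \<delta> powr - ?N) * ?I"
          using C3(1) c0 sp by (intro bd[OF _ order_trans[OF \<phi>1 I(1)], of _ _ "?Q + s * p"]) auto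
        have "nnint (T q t) \<le> ennreal (C4 * \<delta> powr - (?Q + t * q)) * nnint ?\<phi>"
          unfolding T_def by (rule C4(2)[OF cD(1,2) _ _ cut_bounds(1)[OF cut(1)] \<phi>R]) (auto simp: pos_above_le_abs k)
        then show "ennreal (c * A) * nnint (T q t) \<le> ennreal (c * A * C4 * \<delta> powr - ?N) * ?I"
          using C4(1) c0 tq A_nonneg by (intro bd[OF _ order_trans[OF \<phi>1 I(1)], of _ _ "?Q + t * q"]) auto
      qed
    qed
    also have "\<dots> = ennreal (K * \<delta> powr - ?N) * ?I"
    proof -
      have "ennreal (K * \<delta> powr - ?N) = ennreal (3 * 2 powr p * C1 * \<delta> powr - ?N) + ennreal (c * A * C2 * \<delta> powr - ?N)
       + ennreal (c * C3 * \<delta> powr - ?N) + ennreal (c * A * C4 * \<delta> powr - ?N)"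
        using C1(1) C2(1) C3(1) C4(1) c0 A_nonneg
        by (simp add: K_def distrib_right ennreal_plus[symmetric] del: ennreal_plus)
      then show ?thesis by (simp add: distrib_right)
    qed
    finally show "nnint (near_diff \<delta> ?\<phi> p (?Q + s * p))
       \<le> ennreal (K * \<delta> powr - ?N) * ?I" by (simp only: L_def)
  qed
qed

end

section \<open>De Giorgi iteration\<close>

text \<open>If \<open>s p \<ge> Q\<close>, the order of differentiability is lowered until the Sobolev exponent is \<open>2 q\<close>.\<close>

lemma exists_sobolev_order:
  fixes p q s Q :: real
  assumes "1 < p" "p \<le> q" "0 < s" "0 < Q" and crit: "s * p < Q \<Longrightarrow> q \<le> Q * p / (Q - s * p)"
  obtains \<sigma> where "0 < \<sigma>" "\<sigma> \<le> s" "\<sigma> * p < Q" "q \<le> Q * p / (Q - \<sigma> * p)"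
proof (cases "s * p < Q")
  case True
  then show ?thesis using assms by (intro that[of s]) auto
next
  case False
  define \<sigma> where "\<sigma> = Q * (1 - p / (2 * q)) / p"
  have h: "0 < 1 - p / (2 * q)" "1 - p / (2 * q) < 1" using assms by (auto simp: field_simps)
  have \<sigma>p: "\<sigma> * p = Q * (1 - p / (2 * q))" using assms by (simp add: \<sigma>_def)
  have "Q * (1 - p / (2 * q)) < Q * 1" using h assms by (intro mult_strict_left_mono) auto
  then have lt: "\<sigma> * p < Q" by (simp add: \<sigma>p)
  then have "\<sigma> * p \<le> s * p" using False by simp
  then have "\<sigma> \<le> s" using assms by simp
  moreover have "0 < \<sigma>" using h assms by (simp add: \<sigma>_def)
  moreover have "Q - \<sigma> * p = Q * p / (2 * q)" by (simp add: \<sigma>p algebra_simps)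
  then have "q \<le> Q * p / (Q - \<sigma> * p)" using assms by simp
  ultimately show ?thesis using lt that by blast
qed

text \<open>The ratio \<open>c = b powr (- 1 / \<beta>)\<close> satisfies
  \<open>b * c powr \<beta> = 1\<close>, so the growth \<open>b ^ j\<close> is exactly offset by the
  superlinear power of \<open>c ^ j\<close>. The smallness of \<open>y 0\<close> then closes the
  induction for \<open>y j \<le> y 0 * c ^ j\<close>.\<close>

lemma de_giorgi_sequence:
  fixes y :: "nat \<Rightarrow> real"
  assumes "\<And>j. 0 \<le> y j" "0 < M" "1 < b" "0 < \<beta>"
    and step: "\<And>j. y (Suc j) \<le> M * b ^ j * y j powr (1 + \<beta>)"
    and small: "M * y 0 powr \<beta> \<le> b powr (- 1 / \<beta>)"
  shows "y \<longlonglongrightarrow> 0"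
proof -
  define c where "c = b powr (- 1 / \<beta>)"
  have c: "0 < c" "c < 1" using assms powr_less_mono[of "- 1 / \<beta>" 0 b] by (auto simp: c_def)
  have bc: "b ^ j * (c ^ j) powr (1 + \<beta>) = c ^ j" for j
  proof -
    have "(c ^ j) powr (1 + \<beta>) = c ^ j * (c ^ j) powr \<beta>" using c by (simp add: powr_add)
    also have "(c ^ j) powr \<beta> = (c powr \<beta>) ^ j"
      using c by (simp add: powr_realpow[symmetric] powr_powr mult.commute)
    also have "c powr \<beta> = b powr (- 1 / \<beta> * \<beta>)" unfolding c_def powr_powr ..
    also have "\<dots> = 1 / b" using assms by (simp add: powr_minus_divide)
    finally show ?thesis using assms by (simp add: power_divide)
  qed
  have le: "y j \<le> y 0 * c ^ j" for j
  proof (induction j)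
    case (Suc j)
    have "y (Suc j) \<le> M * b ^ j * y j powr (1 + \<beta>)" by (rule step)
    also have "\<dots> \<le> M * b ^ j * (y 0 * c ^ j) powr (1 + \<beta>)"
      using Suc assms by (intro mult_left_mono powr_mono2) auto
    also have "\<dots> = (M * y 0 powr (1 + \<beta>)) * (b ^ j * (c ^ j) powr (1 + \<beta>))"
      by (simp add: powr_mult)
    also have "\<dots> = (M * y 0 powr \<beta>) * (y 0 * c ^ j)"
      unfolding bc using assms(1)[of 0] by (simp add: powr_add)
    also have "\<dots> \<le> c * (y 0 * c ^ j)"
      using small assms(1)[of 0] c by (intro mult_right_mono) (auto simp: c_def)
    finally show ?case by (simp add: mult_ac)
  qed simp
  have "(\<lambda>j. y 0 * c ^ j) \<longlonglongrightarrow> y 0 * 0" using c by (intro tendsto_mult tendsto_const LIMSEQ_power_zero) auto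
  then show ?thesis using assms(1) le by (intro tendsto_sandwich[of "\<lambda>_. 0" y _ "\<lambda>j. y 0 * c ^ j"]) auto
qed

text \<open>Already 0 from the midpoint of \<open>r1\<close> and \<open>r2\<close> onwards: the
  second half of the gap separates the support from the complement of the
  \<open>r2\<close>-neighbourhood, as \<open>is_cutoff\<close> demands.\<close>

definition bump :: "'a::metric_space set \<Rightarrow> real \<Rightarrow> real \<Rightarrow> 'a \<Rightarrow> real" where
  "bump K r1 r2 x = max 0 (min 1 (((r1 + r2) / 2 - infdist x K) / ((r2 - r1) / 2)))"

text \<open>By \<open>dist_le_hdist\<close> the passage to Euclidean distance costs at most
  \<open>2 + R\<close> near the support. Half the gap divided by \<open>2 + R\<close> is therefore a
  scale below which a point of the support cannot be moved out of the
  \<open>r2\<close>-neighbourhood, and the same number is the inverse Lipschitz constant.\<close>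

lemma is_cutoff_bump:
  fixes K :: "'n::finite heis set"
  assumes r: "r1 < r2" and R: "0 \<le> R" "\<And>x. infdist x K \<le> r2 \<Longrightarrow> norm x \<le> R"
    and \<delta>: "\<delta> = (r2 - r1) / (2 * (2 + R))" "\<delta> \<le> 1"
  shows "is_cutoff \<delta> {x. infdist x K \<le> r2} (bump K r1 r2)"
    and "infdist x K \<le> r1 \<Longrightarrow> bump K r1 r2 x = 1"
proof -
  let ?h = "(r2 - r1) / 2"
  have h: "0 < ?h" using r by simp
  have \<delta>0: "0 < \<delta>" using r R by (simp add: \<delta>)
  have \<delta>h: "(2 + R) * \<delta> = ?h" using R(1) by (simp add: \<delta> field_simps)
  have cont: "continuous_on UNIV (\<lambda>x. infdist x K)" by (intro continuous_intros)
  have supp: "infdist x K < (r1 + r2) / 2" if "bump K r1 r2 x \<noteq> 0" for x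
  proof (rule ccontr)
    assume "\<not> ?thesis"
    then have "((r1 + r2) / 2 - infdist x K) / ?h \<le> 0" using h by (intro divide_nonpos_pos) auto
    then show False using that by (simp add: bump_def)
  qed
  \<comment> \<open>One point with nonzero \<open>bump\<close> is enough: its norm is at most
    \<open>R\<close>, and \<open>dist_le_hdist\<close> may be applied with either point as the
    base.\<close>
  have d: "dist x y \<le> (2 + R) * hdist x y" if "bump K r1 r2 x \<noteq> 0 \<or> bump K r1 r2 y \<noteq> 0" "hdist x y < \<delta>" for x y
  proof -
    have *: "norm z \<le> R" if "bump K r1 r2 z \<noteq> 0" for z using supp[OF that] r by (intro R(2)) auto
    have "dist x y \<le> (2 + norm x) * hdist x y" "dist x y \<le> (2 + norm y) * hdist x y"
      using dist_le_hdist[of y x] dist_le_hdist[of x y] that(2) \<delta> by (simp_all add: dist_commute hdist_commute)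
    moreover have "(2 + norm x) * hdist x y \<le> (2 + R) * hdist x y \<or> (2 + norm y) * hdist x y \<le> (2 + R) * hdist x y"
      using that(1)
    proof
      assume "bump K r1 r2 x \<noteq> 0"
      from *[OF this] show ?thesis by (intro disjI1 mult_right_mono) auto
    next
      assume "bump K r1 r2 y \<noteq> 0"
      from *[OF this] show ?thesis by (intro disjI2 mult_right_mono) auto
    qed
    ultimately show ?thesis by linarith
  qed
  show "is_cutoff \<delta> {x. infdist x K \<le> r2} (bump K r1 r2)"
    unfolding is_cutoff_def
  proof (intro conjI allI impI)
    show "{x. infdist x K \<le> r2} \<in> sets borel"
      by (intro borel_closed closed_Collect_le cont continuous_intros)
    show "bump K r1 r2 \<in> borel_measurable borel"
      unfolding bump_def[abs_def] by (intro borel_measurable_continuous_onI continuous_intros cont) (use r in auto)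
    fix x y :: "'n heis" assume xy: "hdist x y < \<delta>"
    show "y \<in> {x. infdist x K \<le> r2}" if "bump K r1 r2 x \<noteq> 0"
    proof -
      have "dist x y \<le> (2 + R) * hdist x y" using d xy that by blast
      also have "\<dots> \<le> (2 + R) * \<delta>" using xy R by (intro mult_left_mono) auto
      also note \<delta>h
      finally have "dist x y \<le> ?h" .
      moreover have "infdist y K \<le> infdist x K + dist y x" by (rule infdist_triangle)
      ultimately have "infdist y K \<le> r2" using supp[OF that] by (simp add: dist_commute field_simps)
      then show ?thesis by simp
    qed
    show "\<bar>bump K r1 r2 x - bump K r1 r2 y\<bar> \<le> hdist x y / \<delta>"
    proof (cases "bump K r1 r2 x \<noteq> 0 \<or> bump K r1 r2 y \<noteq> 0")
      case True
      have "\<bar>bump K r1 r2 x - bump K r1 r2 y\<bar> \<le> \<bar>((r1 + r2) / 2 - infdist x K) / ?h - ((r1 + r2) / 2 - infdist y K) / ?h\<bar>"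
        unfolding bump_def by linarith
      also have "\<dots> = \<bar>infdist y K - infdist x K\<bar> / ?h"
      proof -
        have "(c - A) / H - (c - B) / H = (B - A) / H" for c A B H :: real by (simp add: diff_divide_distrib)
        then show ?thesis by (simp only: abs_div_pos[OF h])
      qed
      also have "\<dots> \<le> dist x y / ?h"
        using infdist_triangle_abs[of y K x] h by (intro divide_right_mono) (auto simp: dist_commute)
      also have "\<dots> \<le> (2 + R) * hdist x y / ((2 + R) * \<delta>)"
        unfolding \<delta>h using h by (intro divide_right_mono d True xy) auto
      also have "\<dots> = hdist x y / \<delta>" using R by simp
      finally show ?thesis .
    qed (use \<delta>0 in simp)
  qed (use \<delta>0 \<delta> in \<open>auto simp: bump_def\<close>)
  show "infdist x K \<le> r1 \<Longrightarrow> bump K r1 r2 x = 1"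
    using h by (simp add: bump_def min_def max_def pos_le_divide_eq field_simps)
qed

section \<open>Initial integrability and a single level step\<close>

context double_phase
begin

text \<open>Drawn from membership in the energy space alone, using only p-th powers. This breaks a
  circle: \<open>caccioppoli\<close>, the means of gaining integrability, already presupposes q-th
  powers of the excess.\<close>

lemma cut_Lm_finite:
  assumes uA: "u \<in> Aspace p q s t a \<Omega>" and [measurable]: "u \<in> borel_measurable borel"
    and cut: "is_cutoff \<delta> S \<psi>" "S \<subseteq> \<Omega>" and k: "0 \<le> k"
    and \<sigma>: "0 < \<sigma>" "\<sigma> \<le> s" "\<sigma> * p < hdimQ TYPE('n)"
  shows "(\<integral>\<^sup>+ x. ennreal (cut k u \<psi> x powr (hdimQ TYPE('n) * p / (hdimQ TYPE('n) - \<sigma> * p))) \<partial>lborel) < \<infinity>"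
proof -
  let ?Q = "hdimQ TYPE('n)"
  note cD = is_cutoffD[OF cut(1)]
  note [measurable] = cD(3,4) measurable_cut[OF assms(2) cut(1)]
  let ?w = "\<lambda>x. pos_above k (u x)" and ?\<phi> = "cut k u \<psi>"
  have up: "locint \<Omega> p (\<lambda>x. \<bar>u x\<bar>) < \<infinity>" and uE: "total_energy u < \<infinity>"
    using uA by (auto simp: Aspace_iff)
  have wp: "locint S p ?w < \<infinity>" by (rule locint_pos_above_finite[OF up cut(2) k])
  have pl: "0 < p" "s < 1" "0 \<le> q" "1 \<le> q" using exponents by auto
  define E where "E z = (cutoff_error \<delta> q ?w \<psi> p (?Q + s * p) z)" for z :: "'n heis \<times> 'n heis"
  define L where "L z = (near_diff \<delta> ?\<phi> p (?Q + s * p) z)"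
      for z :: "'n heis \<times> 'n heis"
  have Em: "E \<in> borel_measurable borel" unfolding E_def by measurable
  have [measurable]: "E \<in> borel_measurable lebesgue" "energy u \<in> borel_measurable lebesgue" "COmega \<Omega> \<in> sets lebesgue"
    using Em sets_COmega by (simp_all add: measurable_completion measurable_energy)
  have E0: "0 \<le> E z" for z by (auto simp: E_def)
  obtain C where "0 < C" and C: "\<And>\<delta> S \<psi> (w :: 'n heis \<Rightarrow> real). is_cutoff \<delta> S \<psi> \<Longrightarrow> w \<in> borel_measurable borel \<Longrightarrow> (\<And>x. 0 \<le> w x) \<Longrightarrow>
    nnint (cutoff_error \<delta> q w \<psi> p (?Q + s * p))
     \<le> ennreal (C * \<delta> powr - p) * locint S p w"
    by (rule near_error_bound[OF pl(1,2) pl(3), where 'n='n]) (rule that, assumption, simp)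
  have "nnint E \<le> ennreal (C * \<delta> powr - p) * locint S p ?w"
    unfolding E_def by (rule C[OF cut(1)]) auto
  also have "\<dots> < \<infinity>" using wp by (simp add: ennreal_mult_less_top)
  finally have Efin: "(\<integral>\<^sup>+ z. ennreal (E z) \<partial>lebesgue) < \<infinity>" by (simp add: nn_integral_completion)
  have "nnint L = (\<integral>\<^sup>+ z. ennreal (L z) \<partial>lebesgue)" by (simp add: nn_integral_completion)
  also have "\<dots> \<le> (\<integral>\<^sup>+ z. ennreal (2 powr p) * ennreal (indicator (COmega \<Omega>) z * energy u z) + ennreal (2 powr p) * ennreal (E z) \<partial>lebesgue)"
  proof (rule nn_integral_mono)
    fix z :: "'n heis \<times> 'n heis"
    have "L z \<le> 2 powr p * (indicator (COmega \<Omega>) z * energy u z) + 2 powr p * E z"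
    proof (cases "z \<in> COmega \<Omega>")
      case False
      then have "L z = 0" using cut_vanishes_off_COmega[OF cut False] pl by (simp add: L_def)
      then show ?thesis using False E0[of z] by simp
    next
      case True
      obtain x y where z: "z = (x, y)" by (cases z)
      show ?thesis
      proof (cases "hdist x y < \<delta>")
        case d: True
        let ?d1 = "hdist x y powr (?Q + s * p)"
        let ?X = "2 * q * max (?w x) (?w y) * \<bar>\<psi> x - \<psi> y\<bar>"
        have "\<bar>?\<phi> x - ?\<phi> y\<bar> powr p \<le> 2 powr p * (\<bar>u x - u y\<bar> powr p + ?X powr p)"
          unfolding cut_def using cD(5,6) exponents pl by (intro Jpow_cutoff_near(3)) auto
        then have "\<bar>?\<phi> x - ?\<phi> y\<bar> powr p / ?d1 \<le> 2 powr p * (\<bar>u x - u y\<bar> powr p + ?X powr p) / ?d1"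
          by (rule divide_right_mono) simp
        also have "\<dots> = 2 powr p * (\<bar>u x - u y\<bar> powr p / ?d1) + 2 powr p * (?X powr p / ?d1)"
          by (simp add: add_divide_distrib distrib_left)
        also have "\<dots> \<le> 2 powr p * energy u z + 2 powr p * E z"
          using d a_nonneg[of x y] by (intro add_mono mult_left_mono) (auto simp: energy_def E_def z)
        finally show ?thesis using True d by (simp add: L_def z)
      next
        case False
        then show ?thesis using E0[of z] energy_nonneg[of u z] by (simp add: L_def z)
      qed
    qed
    then show "ennreal (L z) \<le> ennreal (2 powr p) * ennreal (indicator (COmega \<Omega>) z * energy u z) + ennreal (2 powr p) * ennreal (E z)"
      using E0 energy_nonneg by (simp add: ennreal_mult[symmetric] ennreal_plus[symmetric] ennreal_leI del: ennreal_plus)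
  qed
  also have "\<dots> = ennreal (2 powr p) * total_energy u + ennreal (2 powr p) * (\<integral>\<^sup>+ z. ennreal (E z) \<partial>lebesgue)"
    by (simp add: nn_integral_add nn_integral_cmult)
  also have "\<dots> < \<infinity>" using uE Efin by (simp add: ennreal_mult_less_top)
  finally obtain X where X: "nnint L = ennreal X" "0 \<le> X"
    by (cases "\<integral>\<^sup>+ z. ennreal (L z) \<partial>lborel") auto
  have "nnint (\<lambda>x. ?\<phi> x powr p) < \<infinity>"
    using le_less_trans[OF nn_integral_cut_le[OF cut(1) pl(1)] wp] .
  then obtain Y where Y: "nnint (\<lambda>x. ?\<phi> x powr p) = ennreal Y" "0 \<le> Y"
    by (cases "\<integral>\<^sup>+ x. ennreal (?\<phi> x powr p) \<partial>lborel") auto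
  obtain C' where "0 < C'" and C': "\<And>(f :: 'n heis \<Rightarrow> real) \<delta> X Y. 0 < \<delta> \<Longrightarrow> \<delta> \<le> 1 \<Longrightarrow> f \<in> borel_measurable borel \<Longrightarrow> (\<And>x. 0 \<le> f x) \<Longrightarrow>
    0 \<le> X \<Longrightarrow> 0 \<le> Y \<Longrightarrow>
    nnint (near_diff \<delta> f p (?Q + s * p)) \<le> ennreal X \<Longrightarrow>
    nnint (\<lambda>x. f x powr p) \<le> ennreal Y \<Longrightarrow>
    (\<integral>\<^sup>+ x. ennreal (f x powr (?Q * p / (?Q - \<sigma> * p))) \<partial>lborel) \<le> ennreal (C' * (X + \<delta> powr - (?Q + \<sigma> * p) * Y) powr (?Q * p / (?Q - \<sigma> * p) / p))"
    by (rule sobolev_near[OF pl(1) \<sigma>(1,3,2)]) (rule that, assumption, simp)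
  have "(\<integral>\<^sup>+ x. ennreal (?\<phi> x powr (?Q * p / (?Q - \<sigma> * p))) \<partial>lborel) \<le> ennreal (C' * (X + \<delta> powr - (?Q + \<sigma> * p) * Y) powr (?Q * p / (?Q - \<sigma> * p) / p))"
    by (rule C'[OF cD(1,2) _ cut_bounds(1)[OF cut(1)] X(2) Y(2)]) (use X(1) Y(1) in \<open>simp_all add: L_def\<close>)
  then show ?thesis by (simp add: le_less_trans)
qed

text \<open>Where \<open>u\<close> exceeds \<open>k'\<close>, the excess over \<open>k\<close> is at
  least \<open>h\<close>. As \<open>h \<le> 1\<close>, every power between 1 and \<open>m\<close> of
  the upper excess is thus at most \<open>h powr - m\<close> times the m-th power of the lower one.
  This merges the three terms of \<open>caccioppoli\<close> into one quantity, which
  \<open>sobolev_near\<close> raises to the power \<open>m / p\<close>.\<close>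

lemma level_step:
  assumes u: "weak_solution p q s t a \<Omega> u" and [measurable]: "u \<in> borel_measurable borel"
    and tail: "(\<integral>\<^sup>+ \<xi>. ennreal (\<bar>u \<xi>\<bar> powr (q - 1) / (1 + hnorm \<xi>) powr (hdimQ TYPE('n) + s * p)) \<partial>lborel) < \<infinity>"
    and \<sigma>: "0 < \<sigma>" "\<sigma> \<le> s" "\<sigma> * p < hdimQ TYPE('n)"
    and m: "m = hdimQ TYPE('n) * p / (hdimQ TYPE('n) - \<sigma> * p)" "q \<le> m"
  obtains C where "0 < C" "\<And>\<delta> S \<psi> k k' h y. is_cutoff \<delta> S \<psi> \<Longrightarrow> S \<subseteq> \<Omega> \<Longrightarrow> 0 \<le> k \<Longrightarrow> k + h \<le> k' \<Longrightarrow> 0 < h \<Longrightarrow> h \<le> 1 \<Longrightarrow> 0 \<le> y \<Longrightarrow>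
    excess S m k u \<le> ennreal y \<Longrightarrow>
    nnint (\<lambda>x. cut k' u \<psi> x powr m) \<le> ennreal (C * (\<delta> powr - (hdimQ TYPE('n) + q) * h powr - m * y) powr (m / p))"
proof -
  let ?Q = "hdimQ TYPE('n)"
  have pl: "0 < p" "1 \<le> p" "1 \<le> q" using exponents by auto
  have \<sigma>q: "\<sigma> * p \<le> q"
  proof -
    have "\<sigma> * p \<le> 1 * q" using exponents \<sigma> by (intro mult_mono) auto
    then show ?thesis by simp
  qed
  obtain C1 where C1: "0 < C1" "\<And>\<delta> S \<psi> k. is_cutoff \<delta> S \<psi> \<Longrightarrow> S \<subseteq> \<Omega> \<Longrightarrow> 0 \<le> k \<Longrightarrow> excess S q k u < \<infinity> \<Longrightarrow>
    nnint (near_diff \<delta> (cut k u \<psi>) p (?Q + s * p))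
     \<le> ennreal (C1 * \<delta> powr - (?Q + q)) * (excess S 1 k u + excess S p k u + excess S q k u)"
    by (rule caccioppoli[OF u assms(2) tail]) (rule that, assumption, simp)
  obtain C2 where C2: "0 < C2" "\<And>(f :: 'n heis \<Rightarrow> real) \<delta> X Y. 0 < \<delta> \<Longrightarrow> \<delta> \<le> 1 \<Longrightarrow> f \<in> borel_measurable borel \<Longrightarrow> (\<And>x. 0 \<le> f x) \<Longrightarrow>
    0 \<le> X \<Longrightarrow> 0 \<le> Y \<Longrightarrow>
    nnint (near_diff \<delta> f p (?Q + s * p)) \<le> ennreal X \<Longrightarrow>
    nnint (\<lambda>x. f x powr p) \<le> ennreal Y \<Longrightarrow>
    nnint (\<lambda>x. f x powr m) \<le> ennreal (C2 * (X + \<delta> powr - (?Q + \<sigma> * p) * Y) powr (m / p))"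
    by (rule sobolev_near[OF pl(1) \<sigma>(1,3,2), folded m(1)]) (rule that, assumption, simp)
  show ?thesis
  \<comment> \<open>\<open>3 * C1\<close> accounts for the three excesses in the Caccioppoli
    estimate, 1 for the p-th power term that \<open>sobolev_near\<close> adds for far pairs.\<close>
  proof (rule that[of "C2 * (3 * C1 + 1) powr (m / p)"])
    show "0 < C2 * (3 * C1 + 1) powr (m / p)" using C1(1) C2(1) by simp
    fix \<delta> and S :: "'n heis set" and \<psi> and k k' h y :: real
    assume cut: "is_cutoff \<delta> S \<psi>" "S \<subseteq> \<Omega>" and k: "0 \<le> k" "k + h \<le> k'" and h: "0 < h" "h \<le> 1" and y: "0 \<le> y"
      and Y: "excess S m k u \<le> ennreal y"
    note cD = is_cutoffD[OF cut(1)]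
    note [measurable] = cD(3,4) measurable_cut[OF assms(2) cut(1)]
    let ?w = "\<lambda>x. pos_above k (u x)" and ?w' = "\<lambda>x. pos_above k' (u x)"
    let ?y = "h powr - m * y"
    have y0: "0 \<le> ?y" using y by simp
    have level: "locint S l ?w' \<le> ennreal ?y" if l: "1 \<le> l" "l \<le> m" for l
    proof -
      have "locint S l ?w' \<le> (\<integral>\<^sup>+ x. ennreal (h powr - m) * ennreal (indicator S x * ?w x powr m) \<partial>lborel)"
        unfolding locint_def
      proof (rule nn_integral_mono)
        fix x
        have "?w' x powr l \<le> h powr - m * ?w x powr m"
        proof (cases "u x \<le> k'")
          case True
          then show ?thesis using l by (simp add: pos_above_def)
        next
          case False
          then have w: "h \<le> ?w x" "?w' x \<le> ?w x" "0 < ?w x" using k h by (auto simp: pos_above_def)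
          have "?w' x powr l \<le> ?w x powr l" using w l by (intro powr_mono2) auto
          also have "\<dots> = ?w x powr m * ?w x powr - (m - l)" by (simp flip: powr_add)
          also have "\<dots> \<le> ?w x powr m * h powr - (m - l)"
            using w h l by (intro mult_left_mono powr_mono2') auto
          also have "\<dots> \<le> ?w x powr m * h powr - m"
            using h l by (intro mult_left_mono powr_mono') auto
          finally show ?thesis by (simp add: mult.commute)
        qed
        then show "ennreal (indicator S x * ?w' x powr l) \<le> ennreal (h powr - m) * ennreal (indicator S x * ?w x powr m)"
          by (simp add: ennreal_mult[symmetric] indicator_def ennreal_leI)
      qed
      also have "\<dots> = ennreal (h powr - m) * locint S m ?w"
        unfolding locint_def by (rule nn_integral_cmult) measurable
      also have "\<dots> \<le> ennreal (h powr - m) * ennreal y" by (intro mult_left_mono Y) simp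
      finally show ?thesis using y by (simp add: ennreal_mult)
    qed
    have I: "locint S 1 ?w' \<le> ennreal ?y" "locint S p ?w' \<le> ennreal ?y" "locint S q ?w' \<le> ennreal ?y"
      using exponents m(2) by (auto intro!: level)
    have fin: "locint S q ?w' < \<infinity>" using I(3) by (simp add: le_less_trans)
    have k': "0 \<le> k'" using k h by simp
    let ?N = "?Q + q" and ?c = "C1 * \<delta> powr - (?Q + q)"
    have c0: "0 \<le> ?c" using C1(1) by simp
    have X: "nnint (near_diff \<delta> (cut k' u \<psi>) p (?Q + s * p))
       \<le> ennreal (?c * (3 * ?y))"
    proof -
      have "locint S 1 ?w' + locint S p ?w' + locint S q ?w' \<le> ennreal ?y + ennreal ?y + ennreal ?y" by (intro add_mono I)
      also have "\<dots> = ennreal (3 * ?y)"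
      proof -
        have "ennreal c + ennreal c + ennreal c = ennreal (3 * c)" if "0 \<le> c" for c
          using that by (simp add: ennreal_plus[symmetric] del: ennreal_plus)
        then show ?thesis using y0 by blast
      qed
      finally have *: "locint S 1 ?w' + locint S p ?w' + locint S q ?w' \<le> ennreal (3 * ?y)" .
      note C1(2)[OF cut k' fin]
      also have "ennreal ?c * (locint S 1 ?w' + locint S p ?w' + locint S q ?w') \<le> ennreal ?c * ennreal (3 * ?y)"
        by (intro mult_left_mono *) simp
      also have "\<dots> = ennreal (?c * (3 * ?y))" using c0 y0 by (intro ennreal_mult[symmetric]) auto
      finally show ?thesis .
    qed
    have Z: "nnint (\<lambda>x. cut k' u \<psi> x powr p) \<le> ennreal ?y"
      using nn_integral_cut_le[OF cut(1) pl(1)] I(2) by (rule order_trans)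
    have "nnint (\<lambda>x. cut k' u \<psi> x powr m) \<le> ennreal (C2 * (?c * (3 * ?y) + \<delta> powr - (?Q + \<sigma> * p) * ?y) powr (m / p))"
      by (rule C2(2)[OF cD(1,2) _ cut_bounds(1)[OF cut(1)] _ y0 X Z]) (use c0 y0 in auto)
    also have "\<dots> \<le> ennreal (C2 * (3 * C1 + 1) powr (m / p) * (\<delta> powr - ?N * h powr - m * y) powr (m / p))"
    proof (rule ennreal_leI)
      have "\<delta> powr - (?Q + \<sigma> * p) \<le> \<delta> powr - ?N" using cD(1,2) \<sigma>q by (intro powr_mono') auto
      then have "\<delta> powr - (?Q + \<sigma> * p) * ?y \<le> \<delta> powr - ?N * ?y" by (rule mult_right_mono[OF _ y0])
      then have "?c * (3 * ?y) + \<delta> powr - (?Q + \<sigma> * p) * ?y \<le> (3 * C1 + 1) * (\<delta> powr - ?N * ?y)"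
        by (simp add: algebra_simps)
      then have "(?c * (3 * ?y) + \<delta> powr - (?Q + \<sigma> * p) * ?y) powr (m / p) \<le> ((3 * C1 + 1) * (\<delta> powr - ?N * ?y)) powr (m / p)"
        using C1(1) y y0 m(2) exponents by (intro powr_mono2 add_nonneg_nonneg mult_nonneg_nonneg divide_nonneg_nonneg) auto
      also have "\<dots> = (3 * C1 + 1) powr (m / p) * (\<delta> powr - ?N * h powr - m * y) powr (m / p)"
        by (simp add: powr_mult mult.assoc)
      finally show "C2 * (?c * (3 * ?y) + \<delta> powr - (?Q + \<sigma> * p) * ?y) powr (m / p) \<le> C2 * (3 * C1 + 1) powr (m / p) * (\<delta> powr - ?N * h powr - m * y) powr (m / p)"
        using C2(1) by (simp add: mult.assoc)
    qed
    finally show "nnint (\<lambda>x. cut k' u \<psi> x powr m) \<le> ennreal (C2 * (3 * C1 + 1) powr (m / p) * (\<delta> powr - ?N * h powr - m * y) powr (m / p))" .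
  qed
qed

end

lemma locint_mono:
  assumes "S \<subseteq> S'" "\<And>x. x \<in> S \<Longrightarrow> 0 \<le> w x" "\<And>x. x \<in> S \<Longrightarrow> w x \<le> w' x" "0 \<le> l"
  shows "locint S l w \<le> locint S' l w'"
  unfolding locint_def using assms
  by (intro nn_integral_mono ennreal_leI) (auto simp: indicator_def intro!: powr_mono2)

section \<open>Lebesgue measurability, Borel representatives and change of sign\<close>

lemma AE_lebesgue_pair:
  fixes P :: "'a::euclidean_space \<Rightarrow> bool"
  assumes "AE x in lebesgue. P x"
  shows "AE z in (lebesgue :: ('a \<times> 'a) measure). P (fst z) \<and> P (snd z)"
proof -
  have "AE x in lborel. P x" using assms by (simp add: AE_completion_iff)
  then obtain N where N: "{x. \<not> P x} \<subseteq> N" "N \<in> null_sets lborel"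
    by (auto elim!: AE_E simp: null_sets_def)
  then have [measurable]: "N \<in> sets borel" by (auto simp: null_sets_def)
  have "AE z in lborel \<Otimes>\<^sub>M lborel. fst z \<notin> N \<and> snd (z :: 'a \<times> 'a) \<notin> N"
  proof (rule lborel_pair.AE_pair_measure)
    show "{z \<in> space (lborel \<Otimes>\<^sub>M lborel). fst z \<notin> N \<and> snd (z :: 'a \<times> 'a) \<notin> N} \<in> sets (lborel \<Otimes>\<^sub>M lborel)"
      by measurable
    have "AE y in lborel. y \<notin> N" using N(2) by (rule AE_not_in)
    then show "AE x in lborel. AE y in lborel. fst (x, y) \<notin> N \<and> snd (x, y) \<notin> N" by auto
  qed
  then have "AE z in (lborel :: ('a \<times> 'a) measure). fst z \<notin> N \<and> snd z \<notin> N" by (simp only: lborel_prod)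
  then have "AE z in (lborel :: ('a \<times> 'a) measure). P (fst z) \<and> P (snd z)"
    by eventually_elim (use N(1) in auto)
  then show ?thesis by (rule AE_completion)
qed

text \<open>The preimage of a null set under either projection is null, so the composition agrees
  almost everywhere with that of a Borel representative.\<close>

lemma measurable_lebesgue_fst_snd:
  fixes h :: "'a::euclidean_space \<Rightarrow> real"
  assumes "h \<in> borel_measurable lebesgue"
  shows "(\<lambda>z. h (fst z)) \<in> borel_measurable (lebesgue :: ('a \<times> 'a) measure)"
    and "(\<lambda>z. h (snd z)) \<in> borel_measurable (lebesgue :: ('a \<times> 'a) measure)"
proof -
  obtain g where [measurable]: "g \<in> borel_measurable lborel" and hg: "AE x in lborel. h x = g x"
    using completion_ex_borel_measurable_real[OF assms] by blast
  have "AE x in lebesgue. g x = h x" using AE_completion[OF hg] by eventually_elim simp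
  note ae = AE_lebesgue_pair[OF this]
  have [measurable]: "g \<in> borel_measurable borel" using \<open>g \<in> borel_measurable lborel\<close> by simp
  have "(\<lambda>z. g (fst z)) \<in> borel_measurable (borel :: ('a \<times> 'a) measure)" "(\<lambda>z. g (snd z)) \<in> borel_measurable (borel :: ('a \<times> 'a) measure)"
    by measurable
  then have "(\<lambda>z. g (fst z)) \<in> borel_measurable (lebesgue :: ('a \<times> 'a) measure)" "(\<lambda>z. g (snd z)) \<in> borel_measurable (lebesgue :: ('a \<times> 'a) measure)"
    by (simp_all add: measurable_completion)
  then show "(\<lambda>z. h (fst z)) \<in> borel_measurable (lebesgue :: ('a \<times> 'a) measure)"
    and "(\<lambda>z. h (snd z)) \<in> borel_measurable (lebesgue :: ('a \<times> 'a) measure)"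
    using ae by (auto intro: borel_measurable_AE[where f = "\<lambda>z. g (fst z)"] borel_measurable_AE[where f = "\<lambda>z. g (snd z)"] elim: eventually_mono)
qed

context double_phase
begin

lemma weak_solution_iff:
  "weak_solution p q s t a \<Omega> u \<longleftrightarrow> u \<in> Aspace p q s t a \<Omega> \<and>
    (\<forall>\<phi> \<in> Aspace p q s t a \<Omega>. (AE \<xi> in lebesgue. \<xi> \<notin> \<Omega> \<longrightarrow> \<phi> \<xi> = 0) \<longrightarrow>
       (LINT z|lebesgue. indicator (COmega \<Omega>) z * form u \<phi> z) = 0)"
  by (simp add: weak_solution_def form_def set_lebesgue_integral_def)

text \<open>Complements \<open>measurable_form\<close>: when the solution is changed on a null set,
  the test functions remain arbitrary members of the energy space and are only Lebesgue
  measurable.\<close>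

lemma measurable_form_lebesgue:
  assumes u: "u \<in> borel_measurable lebesgue" and \<phi>: "\<phi> \<in> borel_measurable lebesgue"
  shows "form u \<phi> \<in> borel_measurable lebesgue"
proof -
  note [measurable] = measurable_lebesgue_fst_snd[OF u] measurable_lebesgue_fst_snd[OF \<phi>] a_meas
  have "(\<lambda>z :: 'n heis \<times> 'n heis. hdist (fst z) (snd z)) \<in> borel_measurable lborel" by measurable
  then have [measurable]: "(\<lambda>z :: 'n heis \<times> 'n heis. hdist (fst z) (snd z)) \<in> borel_measurable lebesgue"
    by (rule measurable_completion)
  show ?thesis unfolding form_def[abs_def] Jpow_def by measurable
qed

lemma weak_solution_AE_cong:
  assumes u: "weak_solution p q s t a \<Omega> u" and g: "g \<in> borel_measurable lebesgue"
    and ae: "AE x in lebesgue. u x = g x"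
  shows "weak_solution p q s t a \<Omega> g"
proof -
  have uA: "u \<in> Aspace p q s t a \<Omega>" using u by (simp add: weak_solution_def)
  then have um: "u \<in> borel_measurable lebesgue" by (simp add: Aspace_def)
  note ae2 = AE_lebesgue_pair[OF ae]
  have 1: "(\<integral>\<^sup>+ \<xi>. indicator \<Omega> \<xi> * ennreal (\<bar>g \<xi>\<bar> powr p) \<partial>lebesgue) = (\<integral>\<^sup>+ \<xi>. indicator \<Omega> \<xi> * ennreal (\<bar>u \<xi>\<bar> powr p) \<partial>lebesgue)"
    using ae by (intro nn_integral_cong_AE) (auto elim: eventually_mono)
  have 2: "(\<integral>\<^sup>+ z. indicator (COmega \<Omega>) z * ennreal (Hfun p q s t a (fst z) (snd z) \<bar>g (fst z) - g (snd z)\<bar> / hdist (fst z) (snd z) powr hdimQ TYPE('n)) \<partial>lebesgue)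
    = (\<integral>\<^sup>+ z. indicator (COmega \<Omega>) z * ennreal (Hfun p q s t a (fst z) (snd z) \<bar>u (fst z) - u (snd z)\<bar> / hdist (fst z) (snd z) powr hdimQ TYPE('n)) \<partial>lebesgue)"
    using ae2 by (intro nn_integral_cong_AE) (auto elim: eventually_mono)
  have gA: "g \<in> Aspace p q s t a \<Omega>" using uA g by (simp only: Aspace_def mem_Collect_eq 1 2)
  have [measurable]: "COmega \<Omega> \<in> sets lebesgue" using sets_COmega by simp
  have "(LINT z|lebesgue. indicator (COmega \<Omega>) z * form g \<phi> z) = (LINT z|lebesgue. indicator (COmega \<Omega>) z * form u \<phi> z)"
    if "\<phi> \<in> Aspace p q s t a \<Omega>" for \<phi>
  proof -
    have \<phi>: "\<phi> \<in> borel_measurable lebesgue" using that by (simp add: Aspace_def)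
    note [measurable] = measurable_form_lebesgue[OF um \<phi>] measurable_form_lebesgue[OF g \<phi>]
    show ?thesis
      using ae2 by (intro integral_cong_AE) (measurable, auto simp: form_def elim: eventually_mono)
  qed
  with u gA show ?thesis unfolding weak_solution_iff by simp
qed

text \<open>\<open>Jpow\<close> is odd, so the form merely changes sign for every test function.
  This turns the upper bound for solutions into a lower one.\<close>

lemma weak_solution_uminus:
  assumes "weak_solution p q s t a \<Omega> u"
  shows "weak_solution p q s t a \<Omega> (\<lambda>x. - u x)"
proof -
  have 1: "\<bar>- u x - - u y\<bar> = \<bar>u x - u y\<bar>" for x y by simp
  have 2: "Jpow l (- u x - - u y) = - Jpow l (u x - u y)" for l x y
    using Jpow_minus[of l "u x - u y"] by simp
  have "(\<lambda>x. - u x) \<in> Aspace p q s t a \<Omega>"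
    using assms unfolding weak_solution_def Aspace_def mem_Collect_eq 1 by simp
  moreover have "form (\<lambda>x. - u x) \<phi> z = - form u \<phi> z" for \<phi> z
    unfolding form_def 2 by simp
  ultimately show ?thesis using assms unfolding weak_solution_iff by simp
qed

text \<open>The iteration runs on Euclidean neighbourhoods of \<open>K\<close> with radii between
  \<open>r / 2\<close> and \<open>r\<close>; the layer between \<open>r\<close> and
  \<open>2 * r\<close> is spent on the initial integrability of the m-th power.\<close>

lemma bounded_above_on_compact:
  assumes u: "weak_solution p q s t a \<Omega> u" and [measurable]: "u \<in> borel_measurable borel"
    and tail: "(\<integral>\<^sup>+ \<xi>. ennreal (\<bar>u \<xi>\<bar> powr (q - 1) / (1 + hnorm \<xi>) powr (hdimQ TYPE('n) + s * p)) \<partial>lborel) < \<infinity>"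
    and crit: "s * p < hdimQ TYPE('n) \<Longrightarrow> q \<le> hdimQ TYPE('n) * p / (hdimQ TYPE('n) - s * p)"
    and K: "compact K" "K \<subseteq> \<Omega>" "K \<noteq> {}"
  shows "\<exists>B. AE x in lborel. x \<in> K \<longrightarrow> u x \<le> B"
proof -
  let ?Q = "hdimQ TYPE('n)"
  have Q: "0 < ?Q" by (simp add: hdimQ_def)
  have uA: "u \<in> Aspace p q s t a \<Omega>" using u by (simp add: weak_solution_def)
  obtain \<sigma> where \<sigma>: "0 < \<sigma>" "\<sigma> \<le> s" "\<sigma> * p < ?Q" "q \<le> ?Q * p / (?Q - \<sigma> * p)"
    using exists_sobolev_order[OF exponents(1,2,3) Q crit] by blast
  define m where "m = ?Q * p / (?Q - \<sigma> * p)"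
  have qm: "q \<le> m" using \<sigma>(4) by (simp add: m_def)
  have pm: "p < m"
  proof -
    have "p * (?Q - \<sigma> * p) < ?Q * p" using \<sigma>(1) exponents by (simp add: algebra_simps)
    then show ?thesis using \<sigma>(3) by (simp add: m_def pos_less_divide_eq)
  qed
  have pl: "0 < p" "0 < m" "0 < q" using exponents pm by auto
  obtain e where e: "0 < e" "(\<Union>x\<in>K. ball x e) \<subseteq> \<Omega>"
    using compact_subset_open_imp_ball_epsilon_subset[OF K(1) open_domain K(2)] by blast
  \<comment> \<open>A third of \<open>e\<close> keeps even the \<open>2 * r\<close>-neighbourhood
    inside \<open>\<Omega>\<close>; the bound 1 keeps all gaps between radii at most 1, as
    \<open>bump\<close> requires.\<close>
  define r where "r = min 1 (e / 3)"
  have r: "0 < r" "r \<le> 1" "2 * r < e" using e(1) by (auto simp: r_def min_def)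
  define S where "S \<rho> = {x. infdist x K \<le> \<rho>}" for \<rho>
  have S\<Omega>: "S \<rho> \<subseteq> \<Omega>" if "\<rho> \<le> 2 * r" for \<rho>
  proof
    fix x assume "x \<in> S \<rho>"
    then have "infdist x K < e" using that r by (simp add: S_def)
    moreover obtain y where "y \<in> K" "infdist x K = dist x y"
      using infdist_attains_inf[OF compact_imp_closed[OF K(1)] K(3), of x] by blast
    ultimately have "x \<in> (\<Union>x\<in>K. ball x e)" by (auto simp: dist_commute)
    with e(2) show "x \<in> \<Omega>" by blast
  qed
  obtain R0 where R0: "\<And>x. x \<in> \<Omega> \<Longrightarrow> norm x \<le> R0" using bounded_domain unfolding bounded_iff by blast
  define R where "R = max R0 0"
  have R: "0 \<le> R" "\<And>x. x \<in> \<Omega> \<Longrightarrow> norm x \<le> R" using R0 by (auto simp: R_def le_max_iff_disj)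
  have bump: "is_cutoff ((r2 - r1) / (2 * (2 + R))) (S r2) (bump K r1 r2)" "\<And>x. x \<in> S r1 \<Longrightarrow> bump K r1 r2 x = 1"
    if "r1 < r2" "r2 \<le> 2 * r" "r2 - r1 \<le> 1" for r1 r2
  proof -
    have 1: "norm x \<le> R" if "infdist x K \<le> r2" for x
    proof (rule R(2))
      show "x \<in> \<Omega>" using that S\<Omega>[OF \<open>r2 \<le> 2 * r\<close>] unfolding S_def by blast
    qed
    have "r2 - r1 \<le> 2 * (2 + R)" using that R(1) by simp
    then have 2: "(r2 - r1) / (2 * (2 + R)) \<le> 1" using R(1) by simp
    show "is_cutoff ((r2 - r1) / (2 * (2 + R))) (S r2) (bump K r1 r2)"
      unfolding S_def by (rule is_cutoff_bump(1)[OF that(1) R(1) 1 refl 2])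
    show "\<And>x. x \<in> S r1 \<Longrightarrow> bump K r1 r2 x = 1"
      unfolding S_def using is_cutoff_bump(2)[OF that(1) R(1) 1 refl 2] by simp
  qed
  have locint_le_cut: "excess (S r1) m k u \<le> (\<integral>\<^sup>+ x. ennreal (cut k u (bump K r1 r2) x powr m) \<partial>lborel)"
    if "r1 < r2" "r2 \<le> 2 * r" "r2 - r1 \<le> 1" for r1 r2 k
    unfolding locint_def
  proof (intro nn_integral_mono ennreal_leI)
    fix x show "indicator (S r1) x * pos_above k (u x) powr m \<le> cut k u (bump K r1 r2) x powr m"
      using bump(2)[OF that, of x] by (cases "x \<in> S r1") (auto simp: cut_def)
  qed
  have Sm[measurable]: "S \<rho> \<in> sets borel" for \<rho>
    unfolding S_def by (intro borel_closed closed_Collect_le continuous_intros)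
  let ?J = "\<lambda>\<rho> k. locint (S \<rho>) m (\<lambda>x. pos_above k (u x))"
  have J_mono: "?J \<rho> k \<le> ?J \<rho>' k'" if "\<rho> \<le> \<rho>'" "k' \<le> k" for \<rho> \<rho>' k k'
    using that pl by (intro locint_mono) (auto simp: S_def pos_above_def)
  have J0: "?J r 0 < \<infinity>"
  proof -
    have "?J r 0 \<le> (\<integral>\<^sup>+ x. ennreal (cut 0 u (bump K r (2 * r)) x powr m) \<partial>lborel)"
      using r by (intro locint_le_cut) auto
    also have "\<dots> < \<infinity>" unfolding m_def
      by (rule cut_Lm_finite[OF uA assms(2) bump(1) S\<Omega> _ \<sigma>(1,2,3)]) (use r in auto)
    finally show ?thesis .
  qed
  obtain C where C: "0 < C" "\<And>\<delta> S \<psi> k k' h y. is_cutoff \<delta> S \<psi> \<Longrightarrow> S \<subseteq> \<Omega> \<Longrightarrow> 0 \<le> k \<Longrightarrow> k + h \<le> k' \<Longrightarrow> 0 < h \<Longrightarrow> h \<le> 1 \<Longrightarrow> 0 \<le> y \<Longrightarrow>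
    excess S m k u \<le> ennreal y \<Longrightarrow>
    nnint (\<lambda>x. cut k' u \<psi> x powr m) \<le> ennreal (C * (\<delta> powr - (?Q + q) * h powr - m * y) powr (m / p))"
    by (rule level_step[OF u assms(2) tail \<sigma>(1,2,3) m_def qm]) (rule that, assumption, simp)
  define \<beta> where "\<beta> = m / p - 1"
  have \<beta>: "0 < \<beta>" "1 + \<beta> = m / p" using pm pl by (auto simp: \<beta>_def)
  define N where "N = ?Q + q"
  \<comment> \<open>The cutoff scale at step 0: the first gap between radii is \<open>r / 4\<close>,
    to be divided by \<open>2 * (2 + R)\<close>. It halves at every further step.\<close>
  define \<delta>0 where "\<delta>0 = r / (8 * (2 + R))"
  have \<delta>0: "0 < \<delta>0" using r R(1) by (simp add: \<delta>0_def)
  \<comment> \<open>At step \<open>j\<close> the cutoff scale costs \<open>(2 powr N) ^ j\<close>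
    and the level gap \<open>(1/2) ^ Suc j\<close> costs \<open>2 powr m * (2 powr m) ^ j\<close>,
    all raised to the power \<open>m / p\<close>. The stray \<open>2 powr m\<close> coming from
    \<open>Suc j\<close> goes into \<open>D\<close> below.\<close>
  define b where "b = (2 powr (N + m)) powr (m / p)"
  have b: "1 < b"
  proof -
    have "0 < (N + m) * (m / p)" using Q pl by (intro mult_pos_pos) (auto simp: N_def)
    then show ?thesis using powr_less_mono[of 0 "(N + m) * (m / p)" 2] by (simp add: b_def powr_powr)
  qed
  define D where "D = C * (\<delta>0 powr - N * 2 powr m) powr (m / p)"
  have D: "0 < D" using C(1) \<delta>0 by (simp add: D_def)
  have Jlim: "(\<lambda>n. ?J r (real n)) \<longlonglongrightarrow> 0"
  proof -
    have "(\<lambda>n. \<integral>\<^sup>+ x. ennreal (indicator (S r) x * pos_above (real n) (u x) powr m) \<partial>lborel) \<longlonglongrightarrow> (\<integral>\<^sup>+ x. 0 \<partial>(lborel :: 'n heis measure))"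
    proof (rule nn_integral_dominated_convergence[where w = "\<lambda>x. ennreal (indicator (S r) x * pos_above 0 (u x) powr m)"])
      show "AE x in lborel. ennreal (indicator (S r) x * pos_above (real n) (u x) powr m) \<le> ennreal (indicator (S r) x * pos_above 0 (u x) powr m)" for n
        using pl by (intro AE_I2 ennreal_leI mult_left_mono powr_mono2) (auto simp: pos_above_def)
      show "(\<integral>\<^sup>+ x. ennreal (indicator (S r) x * pos_above 0 (u x) powr m) \<partial>lborel) < \<infinity>" using J0 by (simp add: locint_def)
      show "AE x in lborel. (\<lambda>n. ennreal (indicator (S r) x * pos_above (real n) (u x) powr m)) \<longlonglongrightarrow> 0"
      proof (rule AE_I2)
        fix x
        obtain n0 where "u x \<le> real n0" using real_arch_simple by blast
        then have "\<forall>\<^sub>F n in sequentially. ennreal (indicator (S r) x * pos_above (real n) (u x) powr m) = 0"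
          unfolding eventually_sequentially by (intro exI[of _ n0]) (auto simp: pos_above_def)
        then show "(\<lambda>n. ennreal (indicator (S r) x * pos_above (real n) (u x) powr m)) \<longlonglongrightarrow> 0"
          by (rule tendsto_eventually)
      qed
    qed measurable
    then show ?thesis by (simp add: locint_def)
  qed
  have "(\<lambda>n. D * enn2real (?J r (real n)) powr \<beta>) \<longlonglongrightarrow> D * 0 powr \<beta>"
  proof (intro tendsto_mult tendsto_const tendsto_powr')
    show "(\<lambda>n. enn2real (?J r (real n))) \<longlonglongrightarrow> 0"
      using Jlim by (intro tendsto_enn2real) simp_all
  qed (use \<beta> in auto)
  then have "\<forall>\<^sub>F n in sequentially. D * enn2real (?J r (real n)) powr \<beta> < b powr (- 1 / \<beta>)"
    using b by (intro order_tendstoD(2)) auto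
  then obtain n where n: "D * enn2real (?J r (real n)) powr \<beta> < b powr (- 1 / \<beta>)"
    by (auto simp: eventually_sequentially)
  \<comment> \<open>Radii fall from \<open>r\<close> towards \<open>r / 2\<close> while levels rise
    from \<open>n\<close> towards \<open>n + 1\<close>, both geometrically, so that each step pays
    only a fixed factor more than the previous one.\<close>
  define rr where "rr j = r / 2 * (1 + (1/2) ^ j)" for j :: nat
  define kk where "kk j = real n + (1 - (1/2) ^ j)" for j :: nat
  have p1: "(1/2::real) ^ j \<le> 1" "0 < (1/2::real) ^ j" for j by (simp_all add: power_le_one)
  have rr: "rr (Suc j) < rr j" "rr j \<le> r" "0 \<le> rr j" "rr j - rr (Suc j) = r / 4 * (1/2) ^ j" for j
  proof -
    show "rr j - rr (Suc j) = r / 4 * (1/2) ^ j" by (simp add: rr_def field_simps)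
    moreover have "0 < r / 4 * (1/2) ^ j" using r by simp
    ultimately show "rr (Suc j) < rr j" by linarith
    show "0 \<le> rr j" using r by (simp add: rr_def)
    have "r / 2 * (1 + (1/2) ^ j) \<le> r / 2 * 2" using r p1(1)[of j] by (intro mult_left_mono) auto
    then show "rr j \<le> r" by (simp add: rr_def)
  qed
  have kk: "0 \<le> kk j" "kk j \<le> real n + 1" "kk j + (1/2) ^ Suc j = kk (Suc j)" for j
  proof -
    show "0 \<le> kk j" "kk j \<le> real n + 1"
      unfolding kk_def using p1[of j] of_nat_0_le_iff[of n, where 'a=real] by linarith+
    show "kk j + (1/2) ^ Suc j = kk (Suc j)" by (simp add: kk_def field_simps)
  qed
  define y where "y j = enn2real (?J (rr j) (kk j))" for j
  have fin: "?J (rr j) (kk j) = ennreal (y j)" for j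
  proof -
    have "?J (rr j) (kk j) < \<infinity>" using le_less_trans[OF J_mono[of "rr j" r 0 "kk j"] J0] rr kk by simp
    then show ?thesis by (simp add: y_def ennreal_enn2real_if)
  qed
  have "y \<longlonglongrightarrow> 0"
  proof (rule de_giorgi_sequence[OF _ D b \<beta>(1)])
    show "0 \<le> y j" for j by (simp add: y_def)
    show "D * y 0 powr \<beta> \<le> b powr (- 1 / \<beta>)" using n by (simp add: y_def rr_def kk_def)
    fix j
    have r12: "rr (Suc j) < rr j" "rr j \<le> 2 * r" "rr j - rr (Suc j) \<le> 1"
    proof -
      show "rr (Suc j) < rr j" "rr j \<le> 2 * r" using rr(1,2)[of j] r by auto
      show "rr j - rr (Suc j) \<le> 1" using rr(2)[of j] rr(3)[of "Suc j"] r by linarith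
    qed
    let ?\<delta> = "(rr j - rr (Suc j)) / (2 * (2 + R))"
    have \<delta>: "?\<delta> = \<delta>0 * (1/2) ^ j" unfolding rr(4) \<delta>0_def by simp
    have "ennreal (y (Suc j)) \<le> (\<integral>\<^sup>+ x. ennreal (cut (kk (Suc j)) u (bump K (rr (Suc j)) (rr j)) x powr m) \<partial>lborel)"
      unfolding fin[symmetric] by (rule locint_le_cut[OF r12])
    also have "\<dots> \<le> ennreal (C * (?\<delta> powr - (?Q + q) * ((1/2) ^ Suc j) powr - m * y j) powr (m / p))"
    proof (rule C(2)[OF bump(1)[OF r12] S\<Omega>[OF r12(2)] kk(1)])
      show "kk j + (1/2) ^ Suc j \<le> kk (Suc j)" using kk(3)[of j] by simp
      show "0 < (1/2::real) ^ Suc j" "(1/2::real) ^ Suc j \<le> 1" by (rule p1)+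
      show "0 \<le> y j" by (simp add: y_def)
      show "?J (rr j) (kk j) \<le> ennreal (y j)" by (simp only: fin order_refl)
    qed
    also have "C * (?\<delta> powr - (?Q + q) * ((1/2) ^ Suc j) powr - m * y j) powr (m / p) = D * b ^ j * y j powr (1 + \<beta>)"
    proof -
      have half: "((1/2) ^ i) powr - c = (2 powr c) ^ i" for i :: nat and c :: real
      proof -
        have "((1/2::real) ^ i) powr - c = 1 / ((1 / 2 ^ i) powr c)" by (simp add: powr_minus_divide power_one_over)
        also have "\<dots> = (2 ^ i) powr c" by (simp add: powr_divide)
        also have "\<dots> = (2 powr c) ^ i" by (simp add: powr_realpow[symmetric] powr_powr mult.commute)
        finally show ?thesis .
      qed
      have "?\<delta> powr - (?Q + q) * ((1/2) ^ Suc j) powr - m * y j = (\<delta>0 powr - N * 2 powr m) * ((2 powr (N + m)) ^ j * y j)"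
        unfolding \<delta> powr_mult N_def[symmetric] half by (simp add: powr_add power_mult_distrib)
      then have "C * (?\<delta> powr - (?Q + q) * ((1/2) ^ Suc j) powr - m * y j) powr (m / p) = D * (((2 powr (N + m)) ^ j) powr (m / p) * y j powr (m / p))"
        unfolding D_def by (simp only: powr_mult mult.assoc)
      also have "((2 powr (N + m)) ^ j) powr (m / p) = b ^ j"
        by (simp add: b_def powr_realpow[symmetric] powr_powr mult_ac)
      finally show ?thesis by (simp add: \<beta>(2) mult.assoc)
    qed
    finally show "y (Suc j) \<le> D * b ^ j * y j powr (1 + \<beta>)"
      using D b by (subst (asm) ennreal_le_iff) auto
  qed
  then have "(\<lambda>j. ennreal (y j)) \<longlonglongrightarrow> ennreal 0" by (rule tendsto_ennrealI)
  \<comment> \<open>\<open>K\<close> lies in every neighbourhood and no level exceeds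
    \<open>n + 1\<close>, so this integral is below every \<open>y j\<close> and must
    vanish.\<close>
  moreover have "excess K m (real n + 1) u \<le> ennreal (y j)" for j
    unfolding fin[symmetric] using rr(3)[of j] kk(2)[of j] pl
    by (intro locint_mono) (auto simp: S_def pos_above_def)
  ultimately have "excess K m (real n + 1) u \<le> ennreal 0"
    by (intro LIMSEQ_le_const) auto
  then have "(\<integral>\<^sup>+ x. ennreal (indicator K x * pos_above (real n + 1) (u x) powr m) \<partial>lborel) = 0" by (simp add: locint_def)
  moreover have [measurable]: "K \<in> sets borel" using K(1) by (simp add: compact_imp_closed)
  ultimately have "AE x in lborel. ennreal (indicator K x * pos_above (real n + 1) (u x) powr m) = 0"
    by (subst (asm) nn_integral_0_iff_AE) measurable
  then have "AE x in lborel. x \<in> K \<longrightarrow> u x \<le> real n + 1"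
    by eventually_elim (auto simp: indicator_def pos_above_def ennreal_eq_0_iff split: if_splits)
  then show ?thesis by blast
qed

end

text \<open>The estimates are proved for Borel functions, so \<open>u\<close> is first replaced by a
  Borel representative, which is again a weak solution with the same tail. The one-sided bound is
  then applied to it and to its negative.\<close>

theorem theorem1p1:
  fixes \<Omega> :: "'n::finite heis set"
    and a :: "'n heis \<Rightarrow> 'n heis \<Rightarrow> real"
    and p q s t :: real
    and u :: "'n heis \<Rightarrow> real"
  assumes "open \<Omega>" and "bounded \<Omega>"
    and "1 < p" and "p \<le> q"
    and "0 < s" and "s \<le> t" and "t < 1"
    and a_meas: "(\<lambda>z. a (fst z) (snd z)) \<in> borel_measurable lebesgue"
    and a_nonneg: "\<And>\<xi> \<eta>. 0 \<le> a \<xi> \<eta>"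
    and a_sym: "\<And>\<xi> \<eta>. a \<xi> \<eta> = a \<eta> \<xi>"
    and a_bdd: "\<exists>C. \<forall>\<xi> \<eta>. a \<xi> \<eta> \<le> C"
    and crit: "s * p < hdimQ TYPE('n) \<Longrightarrow> q \<le> hdimQ TYPE('n) * p / (hdimQ TYPE('n) - s * p)"
    and "weak_solution p q s t a \<Omega> u"
    and "u \<in> Ltail (q - 1) (s * p)"
  shows "\<forall>K. compact K \<and> K \<subseteq> \<Omega> \<longrightarrow> (\<exists>M. AE \<xi> in lebesgue. \<xi> \<in> K \<longrightarrow> \<bar>u \<xi>\<bar> \<le> M)"
proof (intro allI impI, elim conjE)
  fix K assume K: "compact K" "K \<subseteq> \<Omega>"
  obtain A where A: "\<And>\<xi> \<eta>. a \<xi> \<eta> \<le> A" using a_bdd by blast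
  interpret double_phase \<Omega> a p q s t A
    by unfold_locales (use assms A in auto)
  have um: "u \<in> borel_measurable lebesgue"
    and ut: "(\<integral>\<^sup>+ \<xi>. ennreal (\<bar>u \<xi>\<bar> powr (q - 1) / (1 + hnorm \<xi>) powr (hdimQ TYPE('n) + s * p)) \<partial>lebesgue) < \<infinity>"
    using \<open>u \<in> Ltail (q - 1) (s * p)\<close> by (auto simp: Ltail_def)
  obtain g where gm: "g \<in> borel_measurable lborel" and "AE x in lborel. u x = g x"
    using completion_ex_borel_measurable_real[OF um] by blast
  then have ug: "AE x in lebesgue. u x = g x" by (intro AE_completion)
  from gm have [measurable]: "g \<in> borel_measurable borel" by simp
  have wg: "weak_solution p q s t a \<Omega> g"
    using weak_solution_AE_cong[OF \<open>weak_solution p q s t a \<Omega> u\<close> measurable_completion[OF gm] ug] .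
  have "(\<integral>\<^sup>+ \<xi>. ennreal (\<bar>g \<xi>\<bar> powr (q - 1) / (1 + hnorm \<xi>) powr (hdimQ TYPE('n) + s * p)) \<partial>lebesgue)
     = (\<integral>\<^sup>+ \<xi>. ennreal (\<bar>u \<xi>\<bar> powr (q - 1) / (1 + hnorm \<xi>) powr (hdimQ TYPE('n) + s * p)) \<partial>lebesgue)"
    using ug by (intro nn_integral_cong_AE) (auto elim: eventually_mono)
  with ut have gt: "(\<integral>\<^sup>+ \<xi>. ennreal (\<bar>g \<xi>\<bar> powr (q - 1) / (1 + hnorm \<xi>) powr (hdimQ TYPE('n) + s * p)) \<partial>lborel) < \<infinity>"
    by (simp add: nn_integral_completion)
  show "\<exists>M. AE \<xi> in lebesgue. \<xi> \<in> K \<longrightarrow> \<bar>u \<xi>\<bar> \<le> M"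
  proof (cases "K = {}")
    \<comment> \<open>The empty set is treated apart because \<open>infdist\<close> to it is 0 by
      convention, so its neighbourhoods would be the whole space.\<close>
    case False
    obtain B1 where B1: "AE x in lborel. x \<in> K \<longrightarrow> g x \<le> B1"
      using bounded_above_on_compact[OF wg \<open>g \<in> borel_measurable borel\<close> gt crit K False] by blast
    obtain B2 where B2: "AE x in lborel. x \<in> K \<longrightarrow> - g x \<le> B2"
      using bounded_above_on_compact[OF weak_solution_uminus[OF wg] _ _ crit K False] gt by auto
    have "AE x in lebesgue. x \<in> K \<longrightarrow> \<bar>u x\<bar> \<le> max B1 B2"
      using AE_completion[OF B1] AE_completion[OF B2] ug by eventually_elim auto
    then show ?thesis by blast
  qed simp
qed

end
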